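(* Let $x\in\mathscr{O}$, let $\mathcal{A}(x,\Theta)$ be a non-linear affine process and let $F\in C^2(\mathbb{R})$. Then, for every $P\in\mathcal{A}(x,\Theta)$, the process $\tilde X=F(X)$ is a $P$-semimartingale whose differential characteristics $(\tilde\beta^P,\tilde\alpha)$ satisfy $$\tilde\alpha_s\in a^F(X_s),\qquad \tilde\beta^P_s\in b^F(X_s)$$ for $dP\otimes ds$-almost all $(\omega,s)\in\Omega\times(0,T]$, where for $y\in\mathbb{R}$ $$a^F(y):=\big[(F'(y))^2(\underline a^0+\underline a^1y^+),\ (F'(y))^2(\bar a^0+\bar a^1y^+)\big],$$ $$b^F(y):=\Big[\inf_{(\beta,\alpha)\in b^*(y)\times a^*(y)}\big(F'(y)\beta+\tfrac12F''(y)\alpha\big),\ \sup_{(\beta,\alpha)\in b^*(y)\times a^*(y)}\big(F'(y)\beta+\tfrac12F''(y)\alpha\big)\Big].$$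
   Context: Fix $T>0$ and let $\Omega=C([0,T])$ be the space of continuous real-valued paths with the topology of uniform convergence and Borel $\sigma$-field $\mathscr{F}$; $X_t(\omega)=\omega_t$ is the canonical process and $\mathbb{F}=(\mathscr{F}_t)$, $\mathscr{F}_t=\sigma(X_s,0\le s\le t)$, the raw filtration it generates. For a probability measure $P$ on $\Omega$, a continuous process $Y$ is a $P$-$\mathbb{F}$-semimartingale if $Y=Y_0+B^P+M^P$ with $B^P$ continuous of locally finite variation, $M^P$ a continuous $P$-$\mathbb{F}$-local martingale, $B^P_0=M^P_0=0$. If $B^P=\int_0^\cdot\beta^P_s\,ds$ and $\langle M^P\rangle=\int_0^\cdot\alpha_s\,ds$ for predictable processes $\beta^P$ and $\alpha\ge0$, the characteristics are absolutely continuous and $(\beta^P,\alpha)$ are called the differential characteristics. $\mathfrak{P}^{ac}_{sem}$ denotes the set of $P$ under which $X$ is a semimartingale with absolutely continuous characteristics. Parameter set: $\Theta=[\underline b^0,\bar b^0]\times[\underline b^1,\bar b^1]\times[\underline a^0,\bar a^0]\times[\underline a^1,\bar a^1]\subset\mathbb{R}^2\times\mathbb{R}_{\ge0}^2$ with finite bounds. For $x\in\mathbb{R}$ set $b^*(x)=\{b^0+b^1x: b^i\in[\underline b^i,\bar b^i]\}$ and $a^*(x)=\{a^0+a^1x^+: a^i\in[\underline a^i,\bar a^i]\}$, $x^+=\max\{x,0\}$. The state space $\mathscr{O}$ is one of $\mathbb{R}$, $\mathbb{R}_{\ge0}$, $\mathbb{R}_{>0}$. The non-linear affine process starting at $x\in\mathscr{O}$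 is the set $\mathcal{A}(x,\Theta)$ of all $P\in\mathfrak{P}^{ac}_{sem}$ with $P(X_0=x)=1$ that are affine-dominated by $\Theta$, i.e. such that $\beta^P_s\in b^*(X_s)$ and $\alpha_s\in a^*(X_s)$ for $dP\otimes ds$-almost all $(\omega,s)\in\Omega\times(0,T]$, where $(\beta^P,\alpha)$ are the differential characteristics of $X$ under $P$. *)

theory Defs
  imports "HOL-Probability.Probability"
begin

section \<open>Path space and canonical filtration\<close>

type_synonym path = "real \<Rightarrow> real"
type_synonym process = "real \<Rightarrow> path \<Rightarrow> real"

text \<open>Continuous real functions on the interval from 0 to T with the supremum metric. As elements
  of \<^const>\<open>cfunspace\<close> they are extensional, i.e. \<^const>\<open>undefined\<close> outside the interval.\<close>

definition path_metric :: "real \<Rightarrow> path metric" where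
  "path_metric T = cfunspace (top_of_set {0..T}) euclidean_metric"

abbreviation paths :: "real \<Rightarrow> path set" where
  "paths T \<equiv> mspace (path_metric T)"

definition path_borel :: "real \<Rightarrow> path measure" where
  "path_borel T = sigma (paths T) {U. openin (mtopology_of (path_metric T)) U}"

definition path_law :: "real \<Rightarrow> path measure \<Rightarrow> bool" where
  "path_law T P \<longleftrightarrow> prob_space P \<and> sets P = sets (path_borel T)"

definition canonical :: process where
  "canonical t \<omega> = \<omega> t"

text \<open>The raw filtration. The index ranges over all reals; it is trivial for negative times and
  constant from T on, so only the times between 0 and T carry information.\<close>

definition raw_filtration :: "real \<Rightarrow> real \<Rightarrow> path measure" where
  "raw_filtration T t =
     sigma (paths T) {canonical s -` A \<inter> paths T | s A. s \<in> {0..T} \<and> s \<le> t \<and> A \<in> sets borel}"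

section \<open>Processes on the interval from 0 to T\<close>

text \<open>Path continuity is required for every path; the finite variation of B and all identities
  between processes are required P-almost surely.\<close>

definition adapted :: "real \<Rightarrow> process \<Rightarrow> bool" where
  "adapted T Y \<longleftrightarrow> (\<forall>t\<in>{0..T}. Y t \<in> borel_measurable (raw_filtration T t))"

definition continuous_process :: "real \<Rightarrow> process \<Rightarrow> bool" where
  "continuous_process T Y \<longleftrightarrow> (\<forall>\<omega>\<in>paths T. continuous_on {0..T} (\<lambda>t. Y t \<omega>))"

definition finite_variation_on :: "real \<Rightarrow> (real \<Rightarrow> real) \<Rightarrow> bool" where
  "finite_variation_on T f \<longleftrightarrow>
     (\<exists>C. \<forall>(n::nat) (u::nat \<Rightarrow> real). mono u \<longrightarrow> range u \<subseteq> {0..T} \<longrightarrow>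
        (\<Sum>i<n. \<bar>f (u (Suc i)) - f (u i)\<bar>) \<le> C)"

definition predictable_algebra :: "real \<Rightarrow> (path \<times> real) measure" where
  "predictable_algebra T = sigma (paths T \<times> {0..T})
     ({A \<times> {0} | A. A \<in> sets (raw_filtration T 0)} \<union>
      {A \<times> {s<..t} | A s t. 0 \<le> s \<and> s \<le> t \<and> t \<le> T \<and> A \<in> sets (raw_filtration T s)})"

definition predictable :: "real \<Rightarrow> process \<Rightarrow> bool" where
  "predictable T Y \<longleftrightarrow> (\<lambda>(\<omega>, s). Y s \<omega>) \<in> borel_measurable (predictable_algebra T)"

definition is_martingale :: "real \<Rightarrow> path measure \<Rightarrow> process \<Rightarrow> bool" where
  "is_martingale T P M \<longleftrightarrow>
     adapted T M \<and> (\<forall>t\<in>{0..T}. integrable P (M t)) \<and>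
     (\<forall>s\<in>{0..T}. \<forall>t\<in>{s..T}. AE \<omega> in P. real_cond_exp P (raw_filtration T s) (M t) \<omega> = M s \<omega>)"

text \<open>On a compact time interval a localizing sequence has to reach the end point T after finitely
  many steps, almost surely. Values of a stopping time above T play the role of infinity.\<close>

definition is_local_martingale :: "real \<Rightarrow> path measure \<Rightarrow> process \<Rightarrow> bool" where
  "is_local_martingale T P M \<longleftrightarrow>
     adapted T M \<and>
     (\<exists>\<tau>::nat \<Rightarrow> path \<Rightarrow> real.
        (\<forall>n. stopping_time (raw_filtration T) (\<tau> n)) \<and>
        (\<forall>n. \<forall>\<omega>\<in>paths T. 0 \<le> \<tau> n \<omega> \<and> \<tau> n \<omega> \<le> \<tau> (Suc n) \<omega>) \<and>
        (AE \<omega> in P. \<exists>n. T \<le> \<tau> n \<omega>) \<and>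
        (\<forall>n. is_martingale T P (\<lambda>t \<omega>. M (min t (\<tau> n \<omega>)) \<omega>)))"

section \<open>Semimartingales and differential characteristics\<close>

definition semimartingale_decomposition ::
    "real \<Rightarrow> path measure \<Rightarrow> process \<Rightarrow> process \<Rightarrow> process \<Rightarrow> bool" where
  "semimartingale_decomposition T P Y B M \<longleftrightarrow>
     adapted T Y \<and> continuous_process T Y \<and>
     adapted T B \<and> continuous_process T B \<and>
     (AE \<omega> in P. finite_variation_on T (\<lambda>t. B t \<omega>)) \<and>
     continuous_process T M \<and> is_local_martingale T P M \<and>
     (AE \<omega> in P. B 0 \<omega> = 0 \<and> M 0 \<omega> = 0) \<and>
     (AE \<omega> in P. \<forall>t\<in>{0..T}. Y t \<omega> = Y 0 \<omega> + B t \<omega> + M t \<omega>)"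

definition semimartingale :: "real \<Rightarrow> path measure \<Rightarrow> process \<Rightarrow> bool" where
  "semimartingale T P Y \<longleftrightarrow> (\<exists>B M. semimartingale_decomposition T P Y B M)"

text \<open>A is the angle bracket of the continuous local martingale M: the continuous increasing
  process, unique up to indistinguishability, that starts at 0 and compensates the square of M.\<close>

definition angle_bracket :: "real \<Rightarrow> path measure \<Rightarrow> process \<Rightarrow> process \<Rightarrow> bool" where
  "angle_bracket T P M A \<longleftrightarrow>
     adapted T A \<and> continuous_process T A \<and>
     (AE \<omega> in P. A 0 \<omega> = 0 \<and> mono_on {0..T} (\<lambda>t. A t \<omega>)) \<and>
     is_local_martingale T P (\<lambda>t \<omega>. (M t \<omega>)\<^sup>2 - A t \<omega>)"

definition is_time_integral :: "real \<Rightarrow> path measure \<Rightarrow> process \<Rightarrow> process \<Rightarrow> bool" where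
  "is_time_integral T P A g \<longleftrightarrow>
     (AE \<omega> in P. set_integrable lborel {0..T} (\<lambda>s. g s \<omega>) \<and>
        (\<forall>t\<in>{0..T}. A t \<omega> = (LBINT s:{0..t}. g s \<omega>)))"

definition differential_characteristics ::
    "real \<Rightarrow> path measure \<Rightarrow> process \<Rightarrow> process \<Rightarrow> process \<Rightarrow> bool" where
  "differential_characteristics T P Y \<beta> \<alpha> \<longleftrightarrow>
     predictable T \<beta> \<and> predictable T \<alpha> \<and> (\<forall>\<omega>\<in>paths T. \<forall>s\<in>{0..T}. 0 \<le> \<alpha> s \<omega>) \<and>
     (\<exists>B M A. semimartingale_decomposition T P Y B M \<and> angle_bracket T P M A \<and>
        is_time_integral T P B \<beta> \<and> is_time_integral T P A \<alpha>)"

definition ac_semimartingale_laws :: "real \<Rightarrow> path measure set" where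
  "ac_semimartingale_laws T =
     {P. path_law T P \<and> (\<exists>\<beta> \<alpha>. differential_characteristics T P canonical \<beta> \<alpha>)}"

text \<open>Almost everywhere with respect to the product of P and Lebesgue measure on times in (0,T].\<close>

definition ae_path_time :: "real \<Rightarrow> path measure \<Rightarrow> (path \<Rightarrow> real \<Rightarrow> bool) \<Rightarrow> bool" where
  "ae_path_time T P Q \<longleftrightarrow> (AE (\<omega>, s) in P \<Otimes>\<^sub>M restrict_space lborel {0<..T}. Q \<omega> s)"

section \<open>Non-linear affine processes\<close>

record affine_bounds =
  b0_lo :: real
  b0_hi :: real
  b1_lo :: real
  b1_hi :: real
  a0_lo :: real
  a0_hi :: real
  a1_lo :: real
  a1_hi :: real

definition valid_bounds :: "affine_bounds \<Rightarrow> bool" where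
  "valid_bounds \<Theta> \<longleftrightarrow>
     b0_lo \<Theta> \<le> b0_hi \<Theta> \<and> b1_lo \<Theta> \<le> b1_hi \<Theta> \<and>
     0 \<le> a0_lo \<Theta> \<and> a0_lo \<Theta> \<le> a0_hi \<Theta> \<and> 0 \<le> a1_lo \<Theta> \<and> a1_lo \<Theta> \<le> a1_hi \<Theta>"

definition b_star :: "affine_bounds \<Rightarrow> real \<Rightarrow> real set" where
  "b_star \<Theta> x =
     {b0 + b1 * x | b0 b1. b0 \<in> {b0_lo \<Theta>..b0_hi \<Theta>} \<and> b1 \<in> {b1_lo \<Theta>..b1_hi \<Theta>}}"

definition a_star :: "affine_bounds \<Rightarrow> real \<Rightarrow> real set" where
  "a_star \<Theta> x =
     {a0 + a1 * max x 0 | a0 a1. a0 \<in> {a0_lo \<Theta>..a0_hi \<Theta>} \<and> a1 \<in> {a1_lo \<Theta>..a1_hi \<Theta>}}"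

text \<open>Differential characteristics are unique up to null sets of the product measure, so it does
  not matter which version is tested for affine domination.\<close>

definition nonlinear_affine :: "real \<Rightarrow> real \<Rightarrow> affine_bounds \<Rightarrow> path measure set" where
  "nonlinear_affine T x \<Theta> =
     {P \<in> ac_semimartingale_laws T.
        (AE \<omega> in P. canonical 0 \<omega> = x) \<and>
        (\<exists>\<beta> \<alpha>. differential_characteristics T P canonical \<beta> \<alpha> \<and>
           ae_path_time T P (\<lambda>\<omega> s. \<beta> s \<omega> \<in> b_star \<Theta> (canonical s \<omega>) \<and>
                                   \<alpha> s \<omega> \<in> a_star \<Theta> (canonical s \<omega>)))}"

section \<open>Transformation by a twice continuously differentiable function\<close>

definition C2 :: "(real \<Rightarrow> real) \<Rightarrow> bool" where
  "C2 F \<longleftrightarrow> (\<forall>y. F differentiable at y) \<and> (\<forall>y. deriv F differentiable at y) \<and>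
     continuous_on UNIV (deriv (deriv F))"

definition a_F :: "affine_bounds \<Rightarrow> (real \<Rightarrow> real) \<Rightarrow> real \<Rightarrow> real set" where
  "a_F \<Theta> F y = {(deriv F y)\<^sup>2 * (a0_lo \<Theta> + a1_lo \<Theta> * max y 0) ..
                (deriv F y)\<^sup>2 * (a0_hi \<Theta> + a1_hi \<Theta> * max y 0)}"

definition b_F :: "affine_bounds \<Rightarrow> (real \<Rightarrow> real) \<Rightarrow> real \<Rightarrow> real set" where
  "b_F \<Theta> F y =
     {(INF (\<beta>, \<alpha>) \<in> b_star \<Theta> y \<times> a_star \<Theta> y. deriv F y * \<beta> + 1/2 * deriv (deriv F) y * \<alpha>) ..
      (SUP (\<beta>, \<alpha>) \<in> b_star \<Theta> y \<times> a_star \<Theta> y. deriv F y * \<beta> + 1/2 * deriv (deriv F) y * \<alpha>)}"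

end

theory Submission
  imports Defs
begin

text \<open>No stochastic integral is needed. After localization along hitting times of X everything is
  bounded and the two characteristics of X are Lipschitz in time. For a \<open>C\<^sup>2\<close> function f, a second order
  Taylor expansion along uniform partitions, together with the two martingale properties of M and of
  \<open>M\<^sup>2 - A\<close>, shows that \<open>f(X)\<close> minus the time integral of \<open>f'(X) \<beta> + f''(X) \<alpha> / 2\<close> is a local
  martingale; the remainder vanishes because the paths are continuous and the second moments of the
  discrete quadratic variations are bounded. Using this for F and for \<open>F\<^sup>2\<close> identifies the angle bracket
  of the martingale part of \<open>F(X)\<close> as the time integral of \<open>F'(X)\<^sup>2 \<alpha>\<close>. Finally, a continuous local
  martingale of finite variation vanishes, so that any other version of the differential
  characteristics agrees almost everywhere with this one, which takes values in the stated
  intervals.\<close>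

section \<open>Partitions and essentially bounded random variables\<close>

text \<open>The obstacle is the raw filtration, which is neither complete nor right-continuous,
  together with path continuity demanded on every path. Null sets cannot be repaired afterwards, so
  all processes are built to be adapted, and continuous on every path: the given characteristics are
  clamped into the intervals of affine domination, where they grow at most linearly in |X|, and
  hitting times are those of closed levels by continuous processes, which are stopping times without
  augmentation. Linear growth is also why |X| alone has to be localized: up to its hitting time both
  integrands are bounded, hence the drift B, the bracket A and finally M = X - X_0 - B. The
  martingale property is tested against bounded multipliers, which turns conditional arguments into
  plain expectations. With drifts b_f of f and b_g of g = f^2, the integrand of the bracket is b_g -
  2 f b_f = (f')^2 \<alpha>, in which \<beta> and f'' cancel.\<close>

definition grid :: "real \<Rightarrow> real \<Rightarrow> nat \<Rightarrow> nat \<Rightarrow> real" where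
  "grid s t n i = s + (t - s) * real i / real n"

lemma grid_0 [simp]: "grid s t n 0 = s"
  by (simp add: grid_def)

lemma grid_end [simp]: "0 < n \<Longrightarrow> grid s t n n = t"
  by (simp add: grid_def)

lemma grid_step: "grid s t n (Suc i) - grid s t n i = (t - s) / real n"
  by (simp add: grid_def diff_divide_distrib add_divide_distrib algebra_simps)

lemma grid_mono: "s \<le> t \<Longrightarrow> i \<le> j \<Longrightarrow> grid s t n i \<le> grid s t n j"
  by (auto simp: grid_def intro!: divide_right_mono mult_left_mono)

text \<open>For \<open>n = 0\<close> division by zero collapses the grid to \<open>s\<close>, so the
  bound survives in that case too.\<close>

lemma grid_le: "s \<le> t \<Longrightarrow> i \<le> n \<Longrightarrow> grid s t n i \<le> t"
  using grid_mono[of s t i n n] by (cases "n = 0") (auto simp: grid_def)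

lemma grid_ge: "s \<le> t \<Longrightarrow> s \<le> grid s t n i"
  using grid_mono[of s t 0 i n] by simp

lemma sum_telescope_grid:
  "0 < n \<Longrightarrow> (\<Sum>i<n. f (grid s t n (Suc i)) - f (grid s t n i)) = (f t - f s :: real)"
  using sum_lessThan_telescope[of "\<lambda>i. f (grid s t n i)" n] by simp

text \<open>Uniform continuity on the compact interval: one mesh size controls all cells
  simultaneously. This is how path continuity enters the limit arguments along partitions.\<close>

lemma grid_osc_eventually_small:
  fixes f :: "real \<Rightarrow> real"
  assumes "continuous_on {s..t} f" "s \<le> t" "0 < e"
  shows "\<forall>\<^sub>F n in sequentially. \<forall>i<n. \<bar>f (grid s t n (Suc i)) - f (grid s t n i)\<bar> < e"
proof -
  have "uniformly_continuous_on {s..t} f"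
    by (intro compact_uniformly_continuous assms) auto
  then obtain d where d: "d > 0" "\<And>u v. u \<in> {s..t} \<Longrightarrow> v \<in> {s..t} \<Longrightarrow> dist v u < d \<Longrightarrow> dist (f v) (f u) < e"
    using \<open>0 < e\<close> unfolding uniformly_continuous_on_def by metis
  have "(\<lambda>n. (t - s) / real n) \<longlonglongrightarrow> 0" by real_asymp
  then have "\<forall>\<^sub>F n in sequentially. (t - s) / real n < d"
    using d(1) by (simp add: order_tendstoD(2))
  then show ?thesis
  proof eventually_elim
    case (elim n)
    show ?case
    proof safe
      fix i assume "i < n"
      then have "grid s t n i \<in> {s..t}" "grid s t n (Suc i) \<in> {s..t}"
        using \<open>s \<le> t\<close> by (auto intro: grid_le grid_ge)
      moreover have "dist (grid s t n (Suc i)) (grid s t n i) < d"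
        using elim \<open>s \<le> t\<close> grid_mono[of s t i "Suc i" n] grid_step[of s t n i] by (simp add: dist_real_def)
      ultimately show "\<bar>f (grid s t n (Suc i)) - f (grid s t n i)\<bar> < e"
        using d(2) by (auto simp: dist_real_def)
    qed
  qed
qed

section \<open>Almost surely bounded random variables as integrable multipliers\<close>

context prob_space
begin

text \<open>Almost sure boundedness is stable under ring operations and continuous images, and
  together with measurability it gives integrability. Through the closure rules most integrability
  goals below become automatic.\<close>

definition ae_bounded :: "('a \<Rightarrow> real) \<Rightarrow> bool" where
  "ae_bounded Z \<longleftrightarrow> (\<exists>c. AE \<omega> in M. \<bar>Z \<omega>\<bar> \<le> c)"

lemma ae_boundedI: "AE \<omega> in M. \<bar>Z \<omega>\<bar> \<le> c \<Longrightarrow> ae_bounded Z"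
  by (auto simp: ae_bounded_def)

lemma ae_bounded_const [simp, intro!]: "ae_bounded (\<lambda>_. c)"
  by (rule ae_boundedI[of _ "\<bar>c\<bar>"]) simp

lemma ae_bounded_indicator [simp, intro!]: "ae_bounded (\<lambda>\<omega>. indicator A \<omega>)"
  by (rule ae_boundedI[of _ 1]) (simp add: indicator_def)

lemma ae_bounded_of_bool [simp, intro!]: "ae_bounded (\<lambda>\<omega>. of_bool (Q \<omega>))"
  by (rule ae_boundedI[of _ 1]) simp

lemma ae_bounded_add [intro!]: "ae_bounded f \<Longrightarrow> ae_bounded g \<Longrightarrow> ae_bounded (\<lambda>\<omega>. f \<omega> + g \<omega>)"
  unfolding ae_bounded_def
  apply (elim exE)
  subgoal for c d by (rule exI[of _ "c + d"]) (auto elim!: eventually_elim2)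
  done

lemma ae_bounded_mult [intro!]: "ae_bounded f \<Longrightarrow> ae_bounded g \<Longrightarrow> ae_bounded (\<lambda>\<omega>. f \<omega> * g \<omega>)"
  unfolding ae_bounded_def
  apply (elim exE)
  subgoal for c d
    by (rule exI[of _ "c * d"]) (auto elim!: eventually_elim2 simp: abs_mult intro!: mult_mono')
  done

lemma ae_bounded_divide [intro!]: "ae_bounded f \<Longrightarrow> ae_bounded (\<lambda>\<omega>. f \<omega> / c)"
  unfolding divide_inverse by auto

lemma ae_bounded_minus [intro!]: "ae_bounded f \<Longrightarrow> ae_bounded (\<lambda>\<omega>. - f \<omega>)"
  by (simp add: ae_bounded_def)

lemma ae_bounded_diff [intro!]: "ae_bounded f \<Longrightarrow> ae_bounded g \<Longrightarrow> ae_bounded (\<lambda>\<omega>. f \<omega> - g \<omega>)"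
  using ae_bounded_add[of f "\<lambda>\<omega>. - g \<omega>"] by auto

lemma ae_bounded_abs [intro!]: "ae_bounded f \<Longrightarrow> ae_bounded (\<lambda>\<omega>. \<bar>f \<omega>\<bar>)"
  by (simp add: ae_bounded_def)

lemma ae_bounded_power [intro!]: "ae_bounded f \<Longrightarrow> ae_bounded (\<lambda>\<omega>. f \<omega> ^ n)"
  by (induction n) auto

lemma ae_bounded_sum [intro!]: "(\<And>i. i \<in> I \<Longrightarrow> ae_bounded (f i)) \<Longrightarrow> ae_bounded (\<lambda>\<omega>. \<Sum>i\<in>I. f i \<omega>)"
  by (induction I rule: infinite_finite_induct) auto

lemma ae_bounded_integrable: "f \<in> borel_measurable M \<Longrightarrow> ae_bounded f \<Longrightarrow> integrable M f"
  by (auto simp: ae_bounded_def real_norm_def[symmetric] simp del: real_norm_def intro: integrable_const_bound)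

lemma ae_bounded_compose:
  assumes "ae_bounded Z" "continuous_on UNIV g"
  shows "ae_bounded (\<lambda>\<omega>. g (Z \<omega>))"
proof -
  obtain c where c: "AE \<omega> in M. \<bar>Z \<omega>\<bar> \<le> c" using assms(1) by (auto simp: ae_bounded_def)
  have "compact (g ` {-c..c})"
    by (intro compact_continuous_image continuous_on_subset[OF assms(2)]) auto
  then obtain d where d: "\<And>y. y \<in> {-c..c} \<Longrightarrow> \<bar>g y\<bar> \<le> d"
    by (fastforce dest!: compact_imp_bounded simp: bounded_iff)
  from c show ?thesis
    by (intro ae_boundedI[of _ d]) (auto intro!: d elim!: eventually_mono)
qed

end

text \<open>No usual conditions are imposed, because the raw filtration of the path space has to be
  an instance, and only times in \<open>[0, T]\<close> are constrained.\<close>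

locale filtered_prob = prob_space P for P :: "'a measure" +
  fixes F :: "real \<Rightarrow> 'a measure" and T :: real
  assumes subalgebra_F: "0 \<le> t \<Longrightarrow> t \<le> T \<Longrightarrow> subalgebra P (F t)"
    and F_mono: "0 \<le> s \<Longrightarrow> s \<le> t \<Longrightarrow> t \<le> T \<Longrightarrow> sets (F s) \<subseteq> sets (F t)"
begin

lemma F_measurable_P: "Z \<in> borel_measurable (F t) \<Longrightarrow> 0 \<le> t \<Longrightarrow> t \<le> T \<Longrightarrow> Z \<in> borel_measurable P"
  by (rule measurable_from_subalg[OF subalgebra_F])

lemma F_measurable_mono:
  assumes "Z \<in> borel_measurable (F s)" "0 \<le> s" "s \<le> t" "t \<le> T"
  shows "Z \<in> borel_measurable (F t)"
  using assms F_mono[of s t] subalgebra_F[of s] subalgebra_F[of t]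
  by (intro measurable_from_subalg[OF _ assms(1)]) (auto simp: subalgebra_def)

text \<open>The martingale property without integrability, stated through bounded multipliers.\<close>

definition centered :: "(real \<Rightarrow> 'a \<Rightarrow> real) \<Rightarrow> bool" where
  "centered N \<longleftrightarrow> (\<forall>s t Z. 0 \<le> s \<longrightarrow> s \<le> t \<longrightarrow> t \<le> T \<longrightarrow> Z \<in> borel_measurable (F s) \<longrightarrow>
     ae_bounded Z \<longrightarrow> expectation (\<lambda>\<omega>. Z \<omega> * (N t \<omega> - N s \<omega>)) = 0)"

lemma centeredD:
  "centered N \<Longrightarrow> 0 \<le> s \<Longrightarrow> s \<le> t \<Longrightarrow> t \<le> T \<Longrightarrow> Z \<in> borel_measurable (F s) \<Longrightarrow> ae_bounded Z \<Longrightarrow>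
    expectation (\<lambda>\<omega>. Z \<omega> * (N t \<omega> - N s \<omega>)) = 0"
  unfolding centered_def by blast

text \<open>Orthogonality of increments: expanding the square leaves the cross term
  \<open>2 * N s * (N t - N s)\<close>, and \<open>Z * 2 * N s\<close> is again a bounded multiplier
  known at time \<open>s\<close>.\<close>

lemma centered_square_increment:
  assumes N: "\<And>t. 0 \<le> t \<Longrightarrow> t \<le> T \<Longrightarrow> N t \<in> borel_measurable (F t)"
    and bd: "\<And>t. 0 \<le> t \<Longrightarrow> t \<le> T \<Longrightarrow> ae_bounded (N t)"
    and "centered N" "0 \<le> s" "s \<le> t" "t \<le> T" and Z: "Z \<in> borel_measurable (F s)" "ae_bounded Z"
  shows "expectation (\<lambda>\<omega>. Z \<omega> * (N t \<omega> - N s \<omega>)\<^sup>2) = expectation (\<lambda>\<omega>. Z \<omega> * ((N t \<omega>)\<^sup>2 - (N s \<omega>)\<^sup>2))"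
proof -
  have s: "0 \<le> s" "s \<le> T" and t: "0 \<le> t" "t \<le> T" using assms by auto
  note [measurable] = F_measurable_P[OF N[OF t] t] F_measurable_P[OF N[OF s] s] F_measurable_P[OF Z(1) s]
  note bd' = bd[OF s] bd[OF t] Z(2)
  have "expectation (\<lambda>\<omega>. (Z \<omega> * (2 * N s \<omega>)) * (N t \<omega> - N s \<omega>)) = 0"
    using Z(1) N[OF s] bd' assms by (intro centeredD) auto
  moreover have "Z \<omega> * (N t \<omega> - N s \<omega>)\<^sup>2 = Z \<omega> * ((N t \<omega>)\<^sup>2 - (N s \<omega>)\<^sup>2) - (Z \<omega> * (2 * N s \<omega>)) * (N t \<omega> - N s \<omega>)" for \<omega>
    by (simp add: algebra_simps power2_eq_square)
  moreover have "integrable P (\<lambda>\<omega>. Z \<omega> * ((N t \<omega>)\<^sup>2 - (N s \<omega>)\<^sup>2))"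
      "integrable P (\<lambda>\<omega>. (Z \<omega> * (2 * N s \<omega>)) * (N t \<omega> - N s \<omega>))"
    using bd' by (auto intro!: ae_bounded_integrable)
  ultimately show ?thesis by simp
qed

end

section \<open>Quadratic variation along partitions\<close>

text \<open>Lagrange form of the remainder. The interval is written with \<open>min\<close> and
  \<open>max\<close> because increments of a path have either sign, and it is closed so that
  \<open>x = y\<close> is included.\<close>

lemma Taylor_second_order:
  fixes f f' f'' :: "real \<Rightarrow> real"
  assumes "\<And>y. (f has_real_derivative f' y) (at y)" "\<And>y. (f' has_real_derivative f'' y) (at y)"
  shows "\<exists>\<xi>\<in>{min x y..max x y}. f y - f x - f' x * (y - x) = f'' \<xi> / 2 * (y - x)\<^sup>2"
proof (cases "x = y")
  case False
  \<comment> \<open>The family of derivatives in the form that Taylor's theorem expects; from order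
    2 on it is constantly \<open>f''\<close>, since only the steps below order 2 have to be
    verified.\<close>
  let ?d = "\<lambda>m. if m = 0 then f else if m = Suc 0 then f' else f''"
  have "\<exists>t. (if y < x then y < t \<and> t < x else x < t \<and> t < y) \<and>
      f y = (\<Sum>m<2. (?d m x / fact m) * (y - x) ^ m) + (?d 2 t / fact 2) * (y - x) ^ 2"
    using False assms
    by (intro Taylor[where a = "min x y" and b = "max x y"]) (auto simp: less_2_cases_iff)
  then show ?thesis
    by (auto simp: numeral_2_eq_2 split: if_splits)
qed auto

text \<open>The situation after localization: \<open>m\<close> is a stopped martingale bounded by
  \<open>K\<close>, and \<open>a\<close> is its bracket, whose paths are Lipschitz with constant
  \<open>C\<close>. Both martingale properties are kept in the multiplier form.\<close>

locale quadratic_setting = filtered_prob +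
  fixes m a :: "real \<Rightarrow> 'a \<Rightarrow> real" and K C :: real
  assumes nonneg: "0 \<le> K" "0 \<le> C"
    and m_adapted: "\<And>t. 0 \<le> t \<Longrightarrow> t \<le> T \<Longrightarrow> m t \<in> borel_measurable (F t)"
    and a_adapted: "\<And>t. 0 \<le> t \<Longrightarrow> t \<le> T \<Longrightarrow> a t \<in> borel_measurable (F t)"
    and m_bounded: "AE \<omega> in P. \<forall>t\<in>{0..T}. \<bar>m t \<omega>\<bar> \<le> K"
    and a_bounded: "\<And>t. 0 \<le> t \<Longrightarrow> t \<le> T \<Longrightarrow> ae_bounded (a t)"
    and a_lipschitz: "AE \<omega> in P. \<forall>s\<in>{0..T}. \<forall>t\<in>{s..T}. \<bar>a t \<omega> - a s \<omega>\<bar> \<le> C * (t - s)"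
    and m_centered: "centered m"
    and m_square_centered: "centered (\<lambda>t \<omega>. (m t \<omega>)\<^sup>2 - a t \<omega>)"
begin

lemma m_ae_bounded: "0 \<le> t \<Longrightarrow> t \<le> T \<Longrightarrow> ae_bounded (m t)"
  by (rule ae_boundedI[of _ K]) (use m_bounded in \<open>auto elim!: eventually_mono\<close>)

lemma m_measurable: "0 \<le> t \<Longrightarrow> t \<le> T \<Longrightarrow> m t \<in> borel_measurable P"
  using m_adapted F_measurable_P by blast

lemma a_measurable: "0 \<le> t \<Longrightarrow> t \<le> T \<Longrightarrow> a t \<in> borel_measurable P"
  using a_adapted F_measurable_P by blast

text \<open>Multiplier form of E[(m_t - m_s)^2 - (a_t - a_s) | F_s] = 0: orthogonality turns the
  square of the increment into the increment of the square, which \<open>a\<close>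
  compensates.\<close>

lemma square_increment:
  assumes "0 \<le> s" "s \<le> t" "t \<le> T" and Z: "Z \<in> borel_measurable (F s)" "ae_bounded Z"
  shows "expectation (\<lambda>\<omega>. Z \<omega> * ((m t \<omega> - m s \<omega>)\<^sup>2 - (a t \<omega> - a s \<omega>))) = 0"
proof -
  have s: "0 \<le> s" "s \<le> T" and t: "0 \<le> t" "t \<le> T" using assms by auto
  note [measurable] = m_measurable[OF s] m_measurable[OF t] a_measurable[OF s] a_measurable[OF t]
    F_measurable_P[OF Z(1) s]
  note bd = m_ae_bounded[OF s] m_ae_bounded[OF t] a_bounded[OF s] a_bounded[OF t] Z(2)
  have 1: "expectation (\<lambda>\<omega>. Z \<omega> * (m t \<omega> - m s \<omega>)\<^sup>2) = expectation (\<lambda>\<omega>. Z \<omega> * ((m t \<omega>)\<^sup>2 - (m s \<omega>)\<^sup>2))"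
    using assms m_adapted m_ae_bounded m_centered by (intro centered_square_increment) auto
  have 2: "expectation (\<lambda>\<omega>. Z \<omega> * (((m t \<omega>)\<^sup>2 - a t \<omega>) - ((m s \<omega>)\<^sup>2 - a s \<omega>))) = 0"
    using centeredD[OF m_square_centered] assms by blast
  have "expectation (\<lambda>\<omega>. Z \<omega> * ((m t \<omega> - m s \<omega>)\<^sup>2 - (a t \<omega> - a s \<omega>)))
      = expectation (\<lambda>\<omega>. Z \<omega> * (m t \<omega> - m s \<omega>)\<^sup>2) - expectation (\<lambda>\<omega>. Z \<omega> * (a t \<omega> - a s \<omega>))"
    using bd by (subst Bochner_Integration.integral_diff[symmetric])
      (auto intro!: ae_bounded_integrable Bochner_Integration.integral_cong simp: algebra_simps)
  also have "\<dots> = expectation (\<lambda>\<omega>. Z \<omega> * ((m t \<omega>)\<^sup>2 - (m s \<omega>)\<^sup>2)) - expectation (\<lambda>\<omega>. Z \<omega> * (a t \<omega> - a s \<omega>))"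
    by (simp add: 1)
  also have "\<dots> = expectation (\<lambda>\<omega>. Z \<omega> * (((m t \<omega>)\<^sup>2 - a t \<omega>) - ((m s \<omega>)\<^sup>2 - a s \<omega>)))"
    using bd by (subst Bochner_Integration.integral_diff[symmetric])
      (auto intro!: ae_bounded_integrable Bochner_Integration.integral_cong simp: algebra_simps)
  finally show ?thesis using 2 by simp
qed

lemma expectation_square_increment_le:
  assumes "0 \<le> s" "s \<le> t" "t \<le> T"
  shows "expectation (\<lambda>\<omega>. (m t \<omega> - m s \<omega>)\<^sup>2) \<le> C * (t - s)"
proof -
  have s: "0 \<le> s" "s \<le> T" and t: "0 \<le> t" "t \<le> T" using assms by auto
  note [measurable] = m_measurable[OF s] m_measurable[OF t] a_measurable[OF s] a_measurable[OF t]
  note bd = m_ae_bounded[OF s] m_ae_bounded[OF t] a_bounded[OF s] a_bounded[OF t]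
  have "expectation (\<lambda>\<omega>. 1 * ((m t \<omega> - m s \<omega>)\<^sup>2 - (a t \<omega> - a s \<omega>))) = 0"
    using assms by (intro square_increment) auto
  then have "expectation (\<lambda>\<omega>. (m t \<omega> - m s \<omega>)\<^sup>2) = expectation (\<lambda>\<omega>. a t \<omega> - a s \<omega>)"
    using bd by (subst (asm) mult_1, subst (asm) Bochner_Integration.integral_diff)
      (auto intro!: ae_bounded_integrable)
  also have "\<dots> \<le> C * (t - s)"
    using bd a_lipschitz assms
    by (intro integral_le_const) (auto intro!: ae_bounded_integrable elim!: eventually_mono simp: abs_le_iff)
  finally show ?thesis .
qed

text \<open>The compensated squares form a discrete martingale, which bounds the second moment of the
  discrete quadratic variation uniformly in the mesh.\<close>

lemma quadratic_variation_moments: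
  assumes st: "0 \<le> s" "s \<le> t" "t \<le> T" and n: "0 < n"
  defines "Q \<equiv> \<lambda>\<omega>. \<Sum>i<n. (m (grid s t n (Suc i)) \<omega> - m (grid s t n i) \<omega>)\<^sup>2"
  shows "expectation Q \<le> C * (t - s)"
    and "expectation (\<lambda>\<omega>. (Q \<omega>)\<^sup>2) \<le> 16 * K\<^sup>2 * (C * (t - s)) + 6 * (C * (t - s))\<^sup>2"
    and "Q \<in> borel_measurable P" "ae_bounded Q"
proof -
  define u where "u = grid s t n"
  define h where "h = (t - s) / real n"
  define L where "L = C * (t - s)"
  have h: "h \<ge> 0" "u (Suc i) - u i = h" for i
    using st by (auto simp: h_def u_def grid_step)
  have hn: "real n * h = t - s" using n by (simp add: h_def)
  have u: "0 \<le> u i" "u i \<le> T" if "i \<le> n" for i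
    using that st grid_ge[of s t n i] grid_le[of s t i n] by (auto simp: u_def)
  have u_le: "u i \<le> u j" if "i \<le> j" for i j
    using that st by (auto simp: u_def intro: grid_mono)
  define d where "d i \<omega> = m (u (Suc i)) \<omega> - m (u i) \<omega>" for i \<omega>
  define da where "da i \<omega> = a (u (Suc i)) \<omega> - a (u i) \<omega>" for i \<omega>
  have Q: "Q = (\<lambda>\<omega>. \<Sum>i<n. (d i \<omega>)\<^sup>2)" by (simp add: Q_def d_def u_def)
  have [measurable]: "d i \<in> borel_measurable P" "da i \<in> borel_measurable P" if "i < n" for i
    using that unfolding d_def da_def by (auto intro!: borel_measurable_diff m_measurable a_measurable u)
  have bd: "ae_bounded (d i)" "ae_bounded (da i)" if "i < n" for i
    using that unfolding d_def da_def by (auto intro!: m_ae_bounded a_bounded u)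
  show Qm: "Q \<in> borel_measurable P" unfolding Q by measurable
  show Qb: "ae_bounded Q" unfolding Q using bd by auto
  have Ed2: "expectation (\<lambda>\<omega>. (d i \<omega>)\<^sup>2) \<le> C * h" if "i < n" for i
    using expectation_square_increment_le[of "u i" "u (Suc i)"] that u[of i] u[of "Suc i"] u_le[of i "Suc i"] h(2)[of i]
    by (simp add: d_def)
  have "expectation Q = (\<Sum>i<n. expectation (\<lambda>\<omega>. (d i \<omega>)\<^sup>2))"
    unfolding Q using bd by (intro Bochner_Integration.integral_sum ae_bounded_integrable) auto
  also have "\<dots> \<le> (\<Sum>i<n. C * h)" by (intro sum_mono Ed2) auto
  also have "\<dots> = C * (t - s)" using hn by (simp add: mult.left_commute)
  finally show "expectation Q \<le> C * (t - s)" .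
  \<comment> \<open>The compensated squares, a discrete martingale along the grid. At the end point
    \<open>Q\<close> equals \<open>S n\<close> plus the increment of \<open>a\<close>, so the second
    moment of \<open>Q\<close> is reduced to that of \<open>S n\<close>.\<close>
  define S where "S k \<omega> = (\<Sum>i<k. (d i \<omega>)\<^sup>2 - da i \<omega>)" for k \<omega>
  have S_ad: "S k \<in> borel_measurable (F (u k))" if "k \<le> n" for k
  proof -
    have "m (u i) \<in> borel_measurable (F (u k))" "a (u i) \<in> borel_measurable (F (u k))" if "i \<le> k" for i
      using that \<open>k \<le> n\<close> u u_le by (auto intro!: F_measurable_mono[of _ "u i" "u k"] m_adapted a_adapted)
    then show ?thesis unfolding S_def d_def da_def
      by (intro borel_measurable_sum borel_measurable_diff borel_measurable_power) auto
  qed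
  have S_bd: "ae_bounded (S k)" if "k \<le> n" for k
    unfolding S_def using bd that by auto
  have S_m [measurable]: "S k \<in> borel_measurable P" if "k \<le> n" for k
    using F_measurable_P[OF S_ad[OF that]] u[OF that] by auto
  \<comment> \<open>Martingale increments are orthogonal, so second moments add up. With (p - q)^2
    \<le> 2 p^2 + 2 q^2 and d^2 \<le> (2 K)^2 one step costs at most 8 K^2 d^2 + 2 (C h)^2, and the
    mean of d^2 is at most \<open>C * h\<close>.\<close>
  have ES: "expectation (\<lambda>\<omega>. (S k \<omega>)\<^sup>2) \<le> real k * (8 * K\<^sup>2 * (C * h) + 2 * (C * h)\<^sup>2)" if "k \<le> n" for k
    using that
  proof (induction k)
    case 0
    then show ?case by (simp add: S_def)
  next
    case (Suc k)
    have k: "k < n" "k \<le> n" using Suc by auto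
    define D where "D \<omega> = (d k \<omega>)\<^sup>2 - da k \<omega>" for \<omega>
    have [measurable]: "D \<in> borel_measurable P" unfolding D_def using k by measurable
    have Db: "ae_bounded D" unfolding D_def using bd k by auto
    have "expectation (\<lambda>\<omega>. S k \<omega> * D \<omega>) = 0"
      unfolding D_def d_def da_def
      using k u[of k] u[of "Suc k"] u_le[of k "Suc k"] S_ad S_bd by (intro square_increment) auto
    moreover have "expectation (\<lambda>\<omega>. (S (Suc k) \<omega>)\<^sup>2)
        = expectation (\<lambda>\<omega>. (S k \<omega>)\<^sup>2 + 2 * (S k \<omega> * D \<omega>) + (D \<omega>)\<^sup>2)"
      by (simp add: S_def D_def power2_eq_square algebra_simps)
    moreover have "\<dots> = expectation (\<lambda>\<omega>. (S k \<omega>)\<^sup>2) + 2 * expectation (\<lambda>\<omega>. S k \<omega> * D \<omega>) + expectation (\<lambda>\<omega>. (D \<omega>)\<^sup>2)"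
    proof -
      have "integrable P (\<lambda>\<omega>. (S k \<omega>)\<^sup>2)" "integrable P (\<lambda>\<omega>. S k \<omega> * D \<omega>)" "integrable P (\<lambda>\<omega>. (D \<omega>)\<^sup>2)"
        using k Db S_bd S_m by (auto intro!: ae_bounded_integrable)
      then show ?thesis by simp
    qed
    moreover have "expectation (\<lambda>\<omega>. (D \<omega>)\<^sup>2) \<le> 8 * K\<^sup>2 * (C * h) + 2 * (C * h)\<^sup>2"
    proof -
      have "AE \<omega> in P. (D \<omega>)\<^sup>2 \<le> 8 * K\<^sup>2 * (d k \<omega>)\<^sup>2 + 2 * (C * h)\<^sup>2"
        using m_bounded a_lipschitz
      proof eventually_elim
        case (elim \<omega>)
        have "\<bar>d k \<omega>\<bar> \<le> \<bar>m (u (Suc k)) \<omega>\<bar> + \<bar>m (u k) \<omega>\<bar>" by (simp add: d_def)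
        also have "\<dots> \<le> 2 * K"
          using elim(1) u[of k] u[of "Suc k"] k by (smt (verit) Suc_leI atLeastAtMost_iff)
        finally have "(d k \<omega>)\<^sup>2 \<le> (2 * K)\<^sup>2" using nonneg by (intro power2_le_iff_abs_le[THEN iffD2]) auto
        then have 1: "(d k \<omega>)\<^sup>2 * (d k \<omega>)\<^sup>2 \<le> (2 * K)\<^sup>2 * (d k \<omega>)\<^sup>2" by (intro mult_right_mono) auto
        have "\<bar>da k \<omega>\<bar> \<le> C * h"
          using elim(2)[rule_format, of "u k" "u (Suc k)"] u[of k] u[of "Suc k"] u_le[of k "Suc k"] k h(2)[of k]
          by (simp add: da_def)
        then have 2: "(da k \<omega>)\<^sup>2 \<le> (C * h)\<^sup>2" using nonneg h by (intro power2_le_iff_abs_le[THEN iffD2]) auto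
        have "(D \<omega>)\<^sup>2 \<le> 2 * ((d k \<omega>)\<^sup>2 * (d k \<omega>)\<^sup>2) + 2 * (da k \<omega>)\<^sup>2"
          using zero_le_power2[of "(d k \<omega>)\<^sup>2 + da k \<omega>"]
          unfolding D_def power2_sum power2_diff by (simp add: power2_eq_square)
        with 1 2 show ?case by (simp add: power2_eq_square)
      qed
      then have "expectation (\<lambda>\<omega>. (D \<omega>)\<^sup>2) \<le> expectation (\<lambda>\<omega>. 8 * K\<^sup>2 * (d k \<omega>)\<^sup>2 + 2 * (C * h)\<^sup>2)"
        using k bd Db by (intro integral_mono_AE ae_bounded_integrable) auto
      also have "\<dots> = 8 * K\<^sup>2 * expectation (\<lambda>\<omega>. (d k \<omega>)\<^sup>2) + 2 * (C * h)\<^sup>2"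
      proof -
        have "integrable P (\<lambda>\<omega>. (d k \<omega>)\<^sup>2)" using k bd by (intro ae_bounded_integrable) auto
        then show ?thesis by (simp add: prob_space)
      qed
      also have "\<dots> \<le> 8 * K\<^sup>2 * (C * h) + 2 * (C * h)\<^sup>2"
        using Ed2[OF k(1)] by (intro add_right_mono mult_left_mono) auto
      finally show ?thesis .
    qed
    ultimately show ?case using Suc by (simp add: algebra_simps)
  qed
  have "AE \<omega> in P. (Q \<omega>)\<^sup>2 \<le> 2 * (S n \<omega>)\<^sup>2 + 2 * L\<^sup>2"
    using a_lipschitz
  proof eventually_elim
    case (elim \<omega>)
    have "(\<Sum>i<n. da i \<omega>) = a t \<omega> - a s \<omega>"
      using sum_telescope_grid[OF n, of "\<lambda>t. a t \<omega>" s t] by (simp add: da_def u_def)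
    then have Q_eq: "Q \<omega> = S n \<omega> + (a t \<omega> - a s \<omega>)" by (simp add: Q S_def sum_subtractf)
    have "\<bar>a t \<omega> - a s \<omega>\<bar> \<le> L" using elim st by (simp add: L_def)
    then have 2: "(a t \<omega> - a s \<omega>)\<^sup>2 \<le> L\<^sup>2"
      using nonneg st by (intro power2_le_iff_abs_le[THEN iffD2]) (auto simp: L_def)
    have "(Q \<omega>)\<^sup>2 \<le> 2 * (S n \<omega>)\<^sup>2 + 2 * (a t \<omega> - a s \<omega>)\<^sup>2"
      using zero_le_power2[of "S n \<omega> - (a t \<omega> - a s \<omega>)"]
      unfolding Q_eq power2_sum[of "S n \<omega>"] power2_diff[of "S n \<omega>"] by simp
    with 2 show ?case by simp
  qed
  then have "expectation (\<lambda>\<omega>. (Q \<omega>)\<^sup>2) \<le> expectation (\<lambda>\<omega>. 2 * (S n \<omega>)\<^sup>2 + 2 * L\<^sup>2)"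
    using Qm Qb S_bd S_m by (intro integral_mono_AE ae_bounded_integrable) auto
  also have "\<dots> = 2 * expectation (\<lambda>\<omega>. (S n \<omega>)\<^sup>2) + 2 * L\<^sup>2"
  proof -
    have "integrable P (\<lambda>\<omega>. (S n \<omega>)\<^sup>2)" using S_bd S_m by (intro ae_bounded_integrable) auto
    then show ?thesis by (simp add: prob_space)
  qed
  also have "\<dots> \<le> 2 * (real n * (8 * K\<^sup>2 * (C * h) + 2 * (C * h)\<^sup>2)) + 2 * L\<^sup>2"
    using ES[of n] by simp
  also have "real n * (8 * K\<^sup>2 * (C * h) + 2 * (C * h)\<^sup>2) = 8 * K\<^sup>2 * (C * (real n * h)) + 2 * C\<^sup>2 * (h * (real n * h))"
    by (simp add: algebra_simps power2_eq_square)
  also have "\<dots> = 8 * K\<^sup>2 * L + 2 * C\<^sup>2 * (h * (t - s))" by (simp add: hn L_def)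
  \<comment> \<open>Replacing one factor \<open>h\<close> by \<open>t - s\<close> removes the mesh
    from the bound. Doubling and adding \<open>2 * L\<^sup>2\<close> then yields the constants 16
    and 6.\<close>
  also have "\<dots> \<le> 8 * K\<^sup>2 * L + 2 * C\<^sup>2 * ((t - s) * (t - s))"
  proof -
    have "1 * h \<le> real n * h" using n h by (intro mult_right_mono) auto
    then have "h \<le> t - s" using hn by simp
    then show ?thesis using st by (intro add_left_mono mult_left_mono mult_right_mono) auto
  qed
  also have "\<dots> = 8 * K\<^sup>2 * L + 2 * L\<^sup>2" by (simp add: L_def power2_eq_square)
  finally show "expectation (\<lambda>\<omega>. (Q \<omega>)\<^sup>2) \<le> 16 * K\<^sup>2 * (C * (t - s)) + 6 * (C * (t - s))\<^sup>2"
    by (simp add: L_def)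
qed

end

section \<open>The change of variables formula for bounded processes\<close>

text \<open>The stopped picture: \<open>x\<close> is the process, \<open>b\<close> its drift and
  \<open>m\<close> its martingale part with bracket \<open>a\<close>. A single \<open>K\<close>
  bounds \<open>x\<close> and \<open>m\<close>, and a single \<open>C\<close> is a Lipschitz
  constant for both \<open>a\<close> and \<open>b\<close>.\<close>

locale ito_setting = quadratic_setting +
  fixes x b :: "real \<Rightarrow> 'a \<Rightarrow> real"
  assumes x_adapted: "\<And>t. 0 \<le> t \<Longrightarrow> t \<le> T \<Longrightarrow> x t \<in> borel_measurable (F t)"
    and b_adapted: "\<And>t. 0 \<le> t \<Longrightarrow> t \<le> T \<Longrightarrow> b t \<in> borel_measurable (F t)"
    and x_bounded: "AE \<omega> in P. \<forall>t\<in>{0..T}. \<bar>x t \<omega>\<bar> \<le> K"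
    and b_bounded: "\<And>t. 0 \<le> t \<Longrightarrow> t \<le> T \<Longrightarrow> ae_bounded (b t)"
    and x_continuous: "AE \<omega> in P. continuous_on {0..T} (\<lambda>t. x t \<omega>)"
    and b_lipschitz: "AE \<omega> in P. \<forall>s\<in>{0..T}. \<forall>t\<in>{s..T}. \<bar>b t \<omega> - b s \<omega>\<bar> \<le> C * (t - s)"
    and x_decomposition: "AE \<omega> in P. \<forall>t\<in>{0..T}. x t \<omega> = x 0 \<omega> + b t \<omega> + m t \<omega>"
begin

lemma x_ae_bounded: "0 \<le> t \<Longrightarrow> t \<le> T \<Longrightarrow> ae_bounded (x t)"
  by (rule ae_boundedI[of _ K]) (use x_bounded in \<open>auto elim!: eventually_mono\<close>)

lemma x_measurable: "0 \<le> t \<Longrightarrow> t \<le> T \<Longrightarrow> x t \<in> borel_measurable P"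
  using x_adapted F_measurable_P by blast

lemma b_measurable: "0 \<le> t \<Longrightarrow> t \<le> T \<Longrightarrow> b t \<in> borel_measurable P"
  using b_adapted F_measurable_P by blast

text \<open>Taylor's formula with squared increments of \<open>x\<close> replaced by those of
  \<open>m\<close> leaves two errors: the drift, which costs a small multiple of the quadratic
  variation plus a term of order 1/n, and the oscillation of \<open>f''\<close> over one cell. The
  latter is small off the event that some increment of \<open>x\<close> is large. On that event the
  discrete quadratic variation need not be bounded uniformly in \<open>n\<close>, so convergence is
  claimed in mean and rests on its second moment.\<close>

lemma ito_remainder_tendsto:
  fixes f f' f'' :: "real \<Rightarrow> real"
  assumes st: "0 \<le> s" "s \<le> t" "t \<le> T"
    and f': "\<And>y. (f has_real_derivative f' y) (at y)"
    and f'': "\<And>y. (f' has_real_derivative f'' y) (at y)"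
    and cont: "continuous_on UNIV f''"
  defines "e \<equiv> \<lambda>n \<omega>. \<Sum>i<n. let u = grid s t n i; v = grid s t n (Suc i) in
    f (x v \<omega>) - f (x u \<omega>) - f' (x u \<omega>) * (x v \<omega> - x u \<omega>) - f'' (x u \<omega>) / 2 * (m v \<omega> - m u \<omega>)\<^sup>2"
  shows "(\<lambda>n. expectation (\<lambda>\<omega>. \<bar>e n \<omega>\<bar>)) \<longlonglongrightarrow> 0"
proof (rule LIMSEQ_I)
  define L where "L = C * (t - s)"
  have L: "L \<ge> 0" using nonneg st by (simp add: L_def)
  have "compact (f'' ` {-K..K})"
    by (intro compact_continuous_image continuous_on_subset[OF cont]) auto
  then obtain D0 where D0: "\<And>y. y \<in> {-K..K} \<Longrightarrow> \<bar>f'' y\<bar> \<le> D0"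
    by (fastforce dest!: compact_imp_bounded simp: bounded_iff)
  define D where "D = max D0 0"
  have D: "\<bar>f'' y\<bar> \<le> D" if "\<bar>y\<bar> \<le> K" for y
    using D0[of y] that by (simp add: D_def abs_le_iff)
  have D_nn: "D \<ge> 0" by (simp add: D_def)
  define C2 where "C2 = 16 * K\<^sup>2 * L + 6 * L\<^sup>2"
  have C2: "C2 \<ge> 0" using L by (simp add: C2_def)
  \<comment> \<open>\<open>l\<close> will be the common small parameter, and \<open>A\<close>
    collects the coefficients it receives in the final estimate: those from the means of
    \<open>Q\<close> and of its square, plus 2 for the two terms that are eventually below
    \<open>l\<close>. Hence the choice \<open>l = \<epsilon> / A\<close>.\<close>
  define A where "A = D / 2 * L + L + 2 * D * C2 + 2"
  have A: "A > 0" using L D_nn C2 by (simp add: A_def add_nonneg_pos)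
  fix \<epsilon> :: real assume "\<epsilon> > 0"
  define l where "l = \<epsilon> / A"
  have l: "l > 0" using \<open>\<epsilon> > 0\<close> A by (simp add: l_def)
  have "uniformly_continuous_on {-K..K} f''"
    by (intro compact_uniformly_continuous continuous_on_subset[OF cont]) auto
  then obtain d where d: "d > 0" "\<And>y z. \<bar>y\<bar> \<le> K \<Longrightarrow> \<bar>z\<bar> \<le> K \<Longrightarrow> \<bar>z - y\<bar> < d \<Longrightarrow> \<bar>f'' z - f'' y\<bar> < l"
    using l unfolding uniformly_continuous_on_def dist_real_def
    apply atomize_elim
    apply (drule spec[of _ l])
    apply (auto simp: abs_le_iff)
    done
  \<comment> \<open>The exceptional event. Outside it every increment of \<open>x\<close> is below
    the modulus \<open>d\<close>, so \<open>f''\<close> moves by less than \<open>l\<close> within a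
    cell.\<close>
  define E where "E n = {\<omega>\<in>space P. \<exists>i\<in>{..<n}. d \<le> \<bar>x (grid s t n (Suc i)) \<omega> - x (grid s t n i) \<omega>\<bar>}" for n
  \<comment> \<open>Bounds the sum of \<open>n\<close> squared drift increments, each at most
    \<open>(L / n)\<^sup>2\<close>.\<close>
  define bn where "bn n = L\<^sup>2 / real n" for n
  have grid_in: "0 \<le> grid s t n i" "grid s t n i \<le> T" if "i \<le> n" for n i
    using that st grid_ge[of s t n i] grid_le[of s t i n] by auto
  have xm: "x (grid s t n i) \<in> borel_measurable P" if "i \<le> n" for n i
    by (intro x_measurable grid_in that)
  have Em [measurable]: "E n \<in> sets P" for n
  proof -
    have "E n = (\<Union>i\<in>{..<n}. {\<omega>\<in>space P. d \<le> \<bar>x (grid s t n (Suc i)) \<omega> - x (grid s t n i) \<omega>\<bar>})"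
      by (auto simp: E_def)
    also have "\<dots> \<in> sets P"
    proof (intro sets.finite_UN)
      fix i assume "i \<in> {..<n}"
      then have [measurable]: "x (grid s t n i) \<in> borel_measurable P" "x (grid s t n (Suc i)) \<in> borel_measurable P"
        by (auto intro!: xm)
      show "{\<omega>\<in>space P. d \<le> \<bar>x (grid s t n (Suc i)) \<omega> - x (grid s t n i) \<omega>\<bar>} \<in> sets P" by measurable
    qed auto
    finally show ?thesis .
  qed
  \<comment> \<open>By continuity almost every path eventually leaves \<open>E n\<close> for good,
    so its probability tends to 0. No rate comes with this, so the term is merely compared with
    \<open>l\<close> once \<open>l\<close> is fixed.\<close>
  have "(\<lambda>n. expectation (\<lambda>\<omega>. indicator (E n) \<omega>)) \<longlonglongrightarrow> expectation (\<lambda>\<omega>. 0 :: real)"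
  proof (rule integral_dominated_convergence[where w = "\<lambda>_. 1"])
    show "AE \<omega> in P. (\<lambda>n. indicator (E n) \<omega> :: real) \<longlonglongrightarrow> 0"
      using x_continuous
    proof eventually_elim
      case (elim \<omega>)
      have "\<forall>\<^sub>F n in sequentially. \<forall>i<n. \<bar>x (grid s t n (Suc i)) \<omega> - x (grid s t n i) \<omega>\<bar> < d"
        using st d(1) by (intro grid_osc_eventually_small continuous_on_subset[OF elim]) auto
      then have "\<forall>\<^sub>F n in sequentially. indicator (E n) \<omega> = (0::real)"
        by eventually_elim (auto simp: E_def indicator_def)
      then show ?case by (rule tendsto_eventually)
    qed
  qed auto
  then have E_lim: "(\<lambda>n. D / (2 * l) * prob (E n)) \<longlonglongrightarrow> 0"
    by (intro tendsto_mult_right_zero) simp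
  have bn_lim: "(\<lambda>n. (D / 2 * (1 / l + 1) + l + 2 * D) * bn n) \<longlonglongrightarrow> 0"
    unfolding bn_def by real_asymp
  from order_tendstoD(2)[OF E_lim l] order_tendstoD(2)[OF bn_lim l] eventually_gt_at_top[of 0]
  have "\<forall>\<^sub>F n in sequentially. norm (expectation (\<lambda>\<omega>. \<bar>e n \<omega>\<bar>) - 0) < \<epsilon>"
  proof eventually_elim
    case (elim n)
    note n = \<open>0 < n\<close>
    define Q where "Q \<omega> = (\<Sum>i<n. (m (grid s t n (Suc i)) \<omega> - m (grid s t n i) \<omega>)\<^sup>2)" for \<omega>
    have Q: "expectation Q \<le> L" "expectation (\<lambda>\<omega>. (Q \<omega>)\<^sup>2) \<le> C2"
        and Q_m [measurable]: "Q \<in> borel_measurable P" and Qb: "ae_bounded Q"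
      using quadratic_variation_moments[OF st n] by (simp_all add: Q_def[abs_def] C2_def L_def)
    have int_Q: "integrable P Q" "integrable P (\<lambda>\<omega>. (Q \<omega>)\<^sup>2)"
      using Qb by (auto intro!: ae_bounded_integrable)
    \<comment> \<open>Pathwise majorant of the remainder. \<open>R_alt\<close> regroups it by its
      random parts \<open>Q\<close>, the square of \<open>Q\<close> and the indicator of
      \<open>E n\<close>, so that the expectation can be read off.\<close>
    define R where "R \<omega> = D / 2 * (l * Q \<omega> + (1 / l + 1) * bn n) + l / 2 * (2 * Q \<omega> + 2 * bn n)
      + D * (2 * l * (Q \<omega>)\<^sup>2 + indicator (E n) \<omega> / (2 * l) + 2 * bn n)" for \<omega>
    have R_alt: "R = (\<lambda>\<omega>. (D / 2 * l + l) * Q \<omega> + 2 * D * l * (Q \<omega>)\<^sup>2 + D / (2 * l) * indicator (E n) \<omega>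
        + (D / 2 * (1 / l + 1) + l + 2 * D) * bn n)"
      using l by (intro ext) (simp add: R_def field_simps)
    have int_E: "integrable P (\<lambda>\<omega>. indicator (E n) \<omega> :: real)"
      by (intro ae_bounded_integrable) auto
    have int_R: "integrable P R"
      unfolding R_alt using int_Q int_E
      by (intro Bochner_Integration.integrable_add integrable_mult_right integrable_const)
    have ER: "expectation R = (D / 2 * l + l) * expectation Q + 2 * D * l * expectation (\<lambda>\<omega>. (Q \<omega>)\<^sup>2)
        + D / (2 * l) * prob (E n) + (D / 2 * (1 / l + 1) + l + 2 * D) * bn n"
      unfolding R_alt using int_Q int_E by (simp add: prob_space del: times_divide_eq_left)
    have "AE \<omega> in P. \<bar>e n \<omega>\<bar> \<le> R \<omega>"
      using x_bounded x_decomposition b_lipschitz AE_space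
    proof eventually_elim
      case (elim \<omega>)
      let ?x = "\<lambda>i. x (grid s t n i) \<omega>"
      let ?m = "\<lambda>i. m (grid s t n i) \<omega>"
      define dx where "dx i = ?x (Suc i) - ?x i" for i
      define dm where "dm i = ?m (Suc i) - ?m i" for i
      define db where "db i = b (grid s t n (Suc i)) \<omega> - b (grid s t n i) \<omega>" for i
      define I :: real where "I = indicator (E n) \<omega>"
      have I: "I \<ge> 0" "I * I = I" by (auto simp: I_def indicator_def)
      have xK: "\<bar>?x i\<bar> \<le> K" if "i \<le> n" for i
        using elim(1) grid_in[OF that] by auto
      have dx: "dx i = dm i + db i" if "i < n" for i
        using elim(2)[rule_format, of "grid s t n i"] elim(2)[rule_format, of "grid s t n (Suc i)"]
          grid_in[of i n] grid_in[of "Suc i" n] that by (simp add: dx_def dm_def db_def)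
      have db: "(db i)\<^sup>2 \<le> (L / real n)\<^sup>2" if "i < n" for i
      proof -
        have "\<bar>db i\<bar> \<le> C * ((t - s) / real n)"
          using elim(3)[rule_format, of "grid s t n i" "grid s t n (Suc i)"] grid_in[of i n] grid_in[of "Suc i" n] that
            grid_mono[of s t i "Suc i" n] st grid_step[of s t n i] by (simp add: db_def)
        then show ?thesis using L by (intro power2_le_iff_abs_le[THEN iffD2]) (auto simp: L_def)
      qed
      have sum_db: "(\<Sum>i<n. (db i)\<^sup>2) \<le> bn n"
      proof -
        have "(\<Sum>i<n. (db i)\<^sup>2) \<le> (\<Sum>i<n. (L / real n)\<^sup>2)" by (intro sum_mono db) auto
        also have "\<dots> = bn n" using n by (simp add: bn_def power2_eq_square field_simps)
        finally show ?thesis .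
      qed
      have term_le: "\<bar>f (?x (Suc i)) - f (?x i) - f' (?x i) * dx i - f'' (?x i) / 2 * (dm i)\<^sup>2\<bar>
          \<le> D / 2 * (l * (dm i)\<^sup>2 + (1 / l + 1) * (db i)\<^sup>2) + (l / 2 + D * I) * (2 * (dm i)\<^sup>2 + 2 * (db i)\<^sup>2)"
        if i: "i < n" for i
      proof -
        obtain \<xi> where \<xi>: "\<xi> \<in> {min (?x i) (?x (Suc i))..max (?x i) (?x (Suc i))}"
          "f (?x (Suc i)) - f (?x i) - f' (?x i) * dx i = f'' \<xi> / 2 * (dx i)\<^sup>2"
          using Taylor_second_order[OF f' f'', where x = "?x i" and y = "?x (Suc i)"] by (auto simp: dx_def)
        have xi: "\<bar>?x i\<bar> \<le> K" "\<bar>?x (Suc i)\<bar> \<le> K" using i by (auto intro!: xK)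
        have \<xi>K: "\<bar>\<xi>\<bar> \<le> K" using \<xi>(1) xi by (auto simp: abs_le_iff min_def max_def split: if_splits)
        have \<xi>d: "\<bar>\<xi> - ?x i\<bar> \<le> \<bar>dx i\<bar>" using \<xi>(1) by (auto simp: dx_def min_def max_def split: if_splits)
        \<comment> \<open>One bound for both events: \<open>l\<close> from the modulus off
          \<open>E n\<close>, and twice the bound \<open>D\<close> of |f''| on it, switched on by
          the indicator \<open>I\<close>.\<close>
        have osc: "\<bar>f'' \<xi> - f'' (?x i)\<bar> \<le> l + 2 * D * I"
        proof (cases "\<omega> \<in> E n")
          case True
          then show ?thesis using D[OF \<xi>K] D[OF xi(1)] l by (simp add: I_def)
        next
          case False
          then have "\<bar>dx i\<bar> < d" using i elim(4) by (auto simp: E_def dx_def not_le)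
          then show ?thesis using d(2)[OF xi(1) \<xi>K] \<xi>d False by (simp add: I_def)
        qed
        have dx2: "(dx i)\<^sup>2 \<le> 2 * (dm i)\<^sup>2 + 2 * (db i)\<^sup>2"
          using zero_le_power2[of "dm i - db i"] unfolding dx[OF i] power2_sum power2_diff by simp
        have cross: "\<bar>(dx i)\<^sup>2 - (dm i)\<^sup>2\<bar> \<le> l * (dm i)\<^sup>2 + (1 / l + 1) * (db i)\<^sup>2"
        proof -
          \<comment> \<open>Arithmetic-geometric mean inequality with weight \<open>l\<close>: the
            cross term costs a small multiple of the quadratic variation and a multiple of the
            vanishing drift sum.\<close>
          have "2 * \<bar>dm i * db i\<bar> \<le> l * (dm i)\<^sup>2 + (db i)\<^sup>2 / l"
          proof -
            have "0 \<le> (l * \<bar>dm i\<bar> - \<bar>db i\<bar>)\<^sup>2 / l" using l by simp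
            also have "\<dots> = l * (dm i)\<^sup>2 + (db i)\<^sup>2 / l - 2 * \<bar>dm i * db i\<bar>"
              using l by (simp add: power2_diff field_simps power2_eq_square abs_mult)
            finally show ?thesis by simp
          qed
          moreover have "\<bar>(dx i)\<^sup>2 - (dm i)\<^sup>2\<bar> \<le> 2 * \<bar>dm i * db i\<bar> + (db i)\<^sup>2"
            unfolding dx[OF i] power2_sum using abs_triangle_ineq[of "(db i)\<^sup>2" "2 * dm i * db i"]
            by (simp add: abs_mult)
          ultimately show ?thesis by (simp add: algebra_simps)
        qed
        have "\<bar>f (?x (Suc i)) - f (?x i) - f' (?x i) * dx i - f'' (?x i) / 2 * (dm i)\<^sup>2\<bar>
            = \<bar>f'' (?x i) / 2 * ((dx i)\<^sup>2 - (dm i)\<^sup>2) + (f'' \<xi> - f'' (?x i)) / 2 * (dx i)\<^sup>2\<bar>"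
          unfolding \<xi>(2) by (simp add: field_simps)
        also have "\<dots> \<le> \<bar>f'' (?x i)\<bar> / 2 * \<bar>(dx i)\<^sup>2 - (dm i)\<^sup>2\<bar> + \<bar>f'' \<xi> - f'' (?x i)\<bar> / 2 * (dx i)\<^sup>2"
          by (rule order_trans[OF abs_triangle_ineq]) (simp add: abs_mult)
        also have "\<dots> \<le> D / 2 * (l * (dm i)\<^sup>2 + (1 / l + 1) * (db i)\<^sup>2) + (l + 2 * D * I) / 2 * (2 * (dm i)\<^sup>2 + 2 * (db i)\<^sup>2)"
          using D[OF xi(1)] cross osc dx2 D_nn I l by (intro add_mono mult_mono) auto
        finally show ?thesis by (simp add: add_divide_distrib)
      qed
      have "\<bar>e n \<omega>\<bar> \<le> (\<Sum>i<n. D / 2 * (l * (dm i)\<^sup>2 + (1 / l + 1) * (db i)\<^sup>2) + (l / 2 + D * I) * (2 * (dm i)\<^sup>2 + 2 * (db i)\<^sup>2))"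
        unfolding e_def Let_def
        by (rule order_trans[OF sum_abs], rule sum_mono) (use term_le in \<open>auto simp: dx_def dm_def\<close>)
      also have "\<dots> = D / 2 * (l * Q \<omega> + (1 / l + 1) * (\<Sum>i<n. (db i)\<^sup>2)) + (l / 2 + D * I) * (2 * Q \<omega> + 2 * (\<Sum>i<n. (db i)\<^sup>2))"
        unfolding Q_def dm_def sum.distrib sum_distrib_left[symmetric] ..
      also have "\<dots> \<le> D / 2 * (l * Q \<omega> + (1 / l + 1) * bn n) + (l / 2 + D * I) * (2 * Q \<omega> + 2 * bn n)"
        using sum_db D_nn I l by (intro add_mono mult_left_mono) auto
      also have "\<dots> \<le> R \<omega>"
      proof -
        \<comment> \<open>Completing the square with \<open>I * I = I\<close> exchanges the
          indicator times \<open>Q\<close> for a small multiple of the square of \<open>Q\<close>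
          plus a multiple of the indicator. Here the second moment bound is spent.\<close>
        have "I * Q \<omega> \<le> l * (Q \<omega>)\<^sup>2 + I / (4 * l)"
        proof -
          have "0 \<le> (2 * l * Q \<omega> - I)\<^sup>2 / (4 * l)" using l by simp
          also have "\<dots> = l * (Q \<omega>)\<^sup>2 + I * I / (4 * l) - I * Q \<omega>"
            using l by (simp add: power2_diff field_simps power2_eq_square)
          finally show ?thesis using I by simp
        qed
        moreover have "I * bn n \<le> bn n"
          by (auto simp: I_def indicator_def bn_def)
        ultimately have "I * (2 * Q \<omega> + 2 * bn n) \<le> 2 * l * (Q \<omega>)\<^sup>2 + I / (2 * l) + 2 * bn n"
          by (simp add: algebra_simps)
        from mult_left_mono[OF this D_nn] show ?thesis
          unfolding R_def I_def[symmetric] by (simp add: algebra_simps)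
      qed
      finally show ?case .
    qed
    then have "expectation (\<lambda>\<omega>. \<bar>e n \<omega>\<bar>) \<le> expectation R"
      by (intro integral_mono_AE') (use int_R in auto)
    also have "\<dots> \<le> (D / 2 * l + l) * L + 2 * D * l * C2
        + D / (2 * l) * prob (E n) + (D / 2 * (1 / l + 1) + l + 2 * D) * bn n"
      unfolding ER using Q D_nn l by (intro add_mono mult_left_mono) auto
    also have "\<dots> < (D / 2 * l + l) * L + 2 * D * l * C2 + l + l"
      using elim by linarith
    also have "\<dots> = l * A" by (simp add: A_def algebra_simps)
    also have "\<dots> = \<epsilon>" using A by (simp add: l_def)
    finally have "expectation (\<lambda>\<omega>. \<bar>e n \<omega>\<bar>) < \<epsilon>" .
    moreover have "0 \<le> expectation (\<lambda>\<omega>. \<bar>e n \<omega>\<bar>)" by simp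
    ultimately show ?case by simp
  qed
  then show "\<exists>no. \<forall>n\<ge>no. norm (expectation (\<lambda>\<omega>. \<bar>e n \<omega>\<bar>) - 0) < \<epsilon>"
    by (simp add: eventually_sequentially)
qed

text \<open>Telescope \<open>f\<close> along a grid and test against \<open>Z\<close>. The
  first-order martingale terms and the compensated squares have expectation 0, the remainder
  vanishes in mean, and what is left are Riemann sums for the drift. \<open>J\<close> enters only
  through the limits of these sums, so any representation of the drift as an integral fits.\<close>

theorem ito_centered:
  fixes f f' f'' :: "real \<Rightarrow> real" and J :: "real \<Rightarrow> 'a \<Rightarrow> real"
  assumes f': "\<And>y. (f has_real_derivative f' y) (at y)"
    and f'': "\<And>y. (f' has_real_derivative f'' y) (at y)"
    and cont: "continuous_on UNIV f''"
    and J_meas: "\<And>t. 0 \<le> t \<Longrightarrow> t \<le> T \<Longrightarrow> J t \<in> borel_measurable P"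
    and J_lim: "\<And>s t. 0 \<le> s \<Longrightarrow> s \<le> t \<Longrightarrow> t \<le> T \<Longrightarrow> AE \<omega> in P.
      (\<lambda>n. \<Sum>i<n. let u = grid s t n i; v = grid s t n (Suc i) in
        f' (x u \<omega>) * (b v \<omega> - b u \<omega>) + f'' (x u \<omega>) / 2 * (a v \<omega> - a u \<omega>)) \<longlonglongrightarrow> J t \<omega> - J s \<omega>"
  shows "centered (\<lambda>t \<omega>. f (x t \<omega>) - J t \<omega>)"
  unfolding centered_def
proof safe
  fix s t :: real and Z :: "'a \<Rightarrow> real"
  assume st: "0 \<le> s" "s \<le> t" "t \<le> T" and Z: "Z \<in> borel_measurable (F s)" "ae_bounded Z"
  have s: "0 \<le> s" "s \<le> T" and t: "0 \<le> t" "t \<le> T" using st by auto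
  have cont_f: "continuous_on UNIV f" and cont_f': "continuous_on UNIV f'"
    using DERIV_isCont[OF f'] DERIV_isCont[OF f''] by (auto intro!: continuous_at_imp_continuous_on)
  have [measurable]: "f \<in> borel_measurable borel" "f' \<in> borel_measurable borel" "f'' \<in> borel_measurable borel"
    using cont_f cont_f' cont by (auto intro: borel_measurable_continuous_onI)
  have [measurable]: "Z \<in> borel_measurable P" "x s \<in> borel_measurable P" "x t \<in> borel_measurable P"
      "J s \<in> borel_measurable P" "J t \<in> borel_measurable P"
    using F_measurable_P[OF Z(1)] s t by (auto intro!: x_measurable J_meas)
  obtain cZ where cZ: "AE \<omega> in P. \<bar>Z \<omega>\<bar> \<le> cZ" using Z(2) by (auto simp: ae_bounded_def)
  have grid_in: "0 \<le> grid s t n i" "grid s t n i \<le> T" "s \<le> grid s t n i" if "i \<le> n" for n i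
    using that st grid_ge[of s t n i] grid_le[of s t i n] by auto
  have meas: "x (grid s t n i) \<in> borel_measurable P" "a (grid s t n i) \<in> borel_measurable P"
      "b (grid s t n i) \<in> borel_measurable P" "m (grid s t n i) \<in> borel_measurable P" if "i \<le> n" for n i
    using grid_in[OF that] by (auto intro!: x_measurable a_measurable b_measurable m_measurable)
  have bd: "ae_bounded (x (grid s t n i))" "ae_bounded (a (grid s t n i))"
      "ae_bounded (b (grid s t n i))" "ae_bounded (m (grid s t n i))" if "i \<le> n" for n i
    using grid_in[OF that] by (auto intro!: x_ae_bounded a_bounded b_bounded m_ae_bounded)
  define r where "r n i \<omega> = (let u = grid s t n i; v = grid s t n (Suc i) in
        f' (x u \<omega>) * (b v \<omega> - b u \<omega>) + f'' (x u \<omega>) / 2 * (a v \<omega> - a u \<omega>))" for n i \<omega>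
  define e where "e n \<omega> = (\<Sum>i<n. let u = grid s t n i; v = grid s t n (Suc i) in
    f (x v \<omega>) - f (x u \<omega>) - f' (x u \<omega>) * (x v \<omega> - x u \<omega>) - f'' (x u \<omega>) / 2 * (m v \<omega> - m u \<omega>)\<^sup>2)" for n \<omega>
  have e_lim: "(\<lambda>n. expectation (\<lambda>\<omega>. \<bar>e n \<omega>\<bar>)) \<longlonglongrightarrow> 0"
    using ito_remainder_tendsto[OF st f' f'' cont] unfolding e_def .
  have r_meas: "r n i \<in> borel_measurable P" if "i < n" for n i
  proof -
    have [measurable]: "x (grid s t n i) \<in> borel_measurable P" "a (grid s t n i) \<in> borel_measurable P"
      "b (grid s t n i) \<in> borel_measurable P"
      "a (grid s t n (Suc i)) \<in> borel_measurable P" "b (grid s t n (Suc i)) \<in> borel_measurable P"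
      using meas that by auto
    show ?thesis unfolding r_def Let_def by measurable
  qed
  have e_meas [measurable]: "e n \<in> borel_measurable P" for n
    unfolding e_def Let_def
  proof (intro borel_measurable_sum)
    fix i assume "i \<in> {..<n}"
    then have [measurable]: "x (grid s t n i) \<in> borel_measurable P" "m (grid s t n i) \<in> borel_measurable P"
       "x (grid s t n (Suc i)) \<in> borel_measurable P" "m (grid s t n (Suc i)) \<in> borel_measurable P"
      using meas by auto
    show "(\<lambda>\<omega>. f (x (grid s t n (Suc i)) \<omega>) - f (x (grid s t n i) \<omega>) -
           f' (x (grid s t n i) \<omega>) * (x (grid s t n (Suc i)) \<omega> - x (grid s t n i) \<omega>) -
           f'' (x (grid s t n i) \<omega>) / 2 * (m (grid s t n (Suc i)) \<omega> - m (grid s t n i) \<omega>)\<^sup>2) \<in> borel_measurable P"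
      by measurable
  qed
  have e_bd: "ae_bounded (e n)" for n
    using bd unfolding e_def Let_def
    by (auto intro!: ae_bounded_compose[OF _ cont_f'] ae_bounded_compose[OF _ cont] ae_bounded_compose[OF _ cont_f])
  have fx_bd: "ae_bounded (\<lambda>\<omega>. f (x t \<omega>))" "ae_bounded (\<lambda>\<omega>. f (x s \<omega>))"
    using s t by (auto intro!: ae_bounded_compose[OF _ cont_f] x_ae_bounded)
  have key: "expectation (\<lambda>\<omega>. Z \<omega> * (\<Sum>i<n. r n i \<omega>)) = expectation (\<lambda>\<omega>. Z \<omega> * (f (x t \<omega>) - f (x s \<omega>)))
      - expectation (\<lambda>\<omega>. Z \<omega> * e n \<omega>)" if n: "0 < n" for n
  proof -
    \<comment> \<open>\<open>y1\<close> and \<open>y2\<close> are the parts of the expansion with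
      expectation 0: their coefficients at the left end point, times \<open>Z\<close>, are
      admissible multipliers for \<open>m\<close> and for its compensated square.\<close>
    define y1 where "y1 i \<omega> = (Z \<omega> * f' (x (grid s t n i) \<omega>)) * (m (grid s t n (Suc i)) \<omega> - m (grid s t n i) \<omega>)" for i \<omega>
    define y2 where "y2 i \<omega> = (Z \<omega> * (f'' (x (grid s t n i) \<omega>) / 2)) * ((m (grid s t n (Suc i)) \<omega> - m (grid s t n i) \<omega>)\<^sup>2
      - (a (grid s t n (Suc i)) \<omega> - a (grid s t n i) \<omega>))" for i \<omega>
    have int_y: "integrable P (y1 i)" "integrable P (y2 i)" if "i < n" for i
    proof -
      have [measurable]: "x (grid s t n i) \<in> borel_measurable P" "m (grid s t n i) \<in> borel_measurable P" "a (grid s t n i) \<in> borel_measurable P"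
       "m (grid s t n (Suc i)) \<in> borel_measurable P" "a (grid s t n (Suc i)) \<in> borel_measurable P"
      using meas that by auto
      show "integrable P (y1 i)" "integrable P (y2 i)"
        unfolding y1_def y2_def using bd[of i n] bd[of "Suc i" n] Z(2) that
        by (auto intro!: ae_bounded_integrable ae_bounded_compose[OF _ cont_f'] ae_bounded_compose[OF _ cont])
    qed
    have "expectation (y1 i) = 0" "expectation (y2 i) = 0" if "i < n" for i
    proof -
      let ?u = "grid s t n i" and ?v = "grid s t n (Suc i)"
      have uv: "0 \<le> ?u" "?u \<le> ?v" "?v \<le> T" "?u \<le> T" "s \<le> ?u"
        using grid_in[of i n] grid_in[of "Suc i" n] grid_mono[of s t i "Suc i" n] st that by auto
      have [measurable]: "Z \<in> borel_measurable (F ?u)" "x ?u \<in> borel_measurable (F ?u)"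
        using uv s by (auto intro!: x_adapted F_measurable_mono[OF Z(1)])
      show "expectation (y1 i) = 0" unfolding y1_def
        using uv bd[of i n] that Z(2)
        by (intro centeredD[OF m_centered]) (auto intro!: ae_bounded_compose[OF _ cont_f'])
      show "expectation (y2 i) = 0" unfolding y2_def
        using uv bd[of i n] that Z(2)
        by (intro square_increment) (auto intro!: ae_bounded_compose[OF _ cont])
    qed
    then have E0: "expectation (\<lambda>\<omega>. \<Sum>i<n. y1 i \<omega> + y2 i \<omega>) = 0"
      using int_y by (subst Bochner_Integration.integral_sum) auto
    have int_sum: "integrable P (\<lambda>\<omega>. \<Sum>i<n. y1 i \<omega> + y2 i \<omega>)" using int_y by auto
    have ae: "AE \<omega> in P. Z \<omega> * (\<Sum>i<n. r n i \<omega>) = Z \<omega> * (f (x t \<omega>) - f (x s \<omega>)) - Z \<omega> * e n \<omega> - (\<Sum>i<n. y1 i \<omega> + y2 i \<omega>)"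
      using x_decomposition
    proof eventually_elim
      case (elim \<omega>)
      have "f (x t \<omega>) - f (x s \<omega>) = (\<Sum>i<n. f (x (grid s t n (Suc i)) \<omega>) - f (x (grid s t n i) \<omega>))"
        using sum_telescope_grid[OF n, of "\<lambda>t. f (x t \<omega>)" s t] by simp
      moreover have "(\<Sum>i<n. y1 i \<omega> + y2 i \<omega>) = Z \<omega> * (\<Sum>i<n. f (x (grid s t n (Suc i)) \<omega>) - f (x (grid s t n i) \<omega>))
         - Z \<omega> * e n \<omega> - Z \<omega> * (\<Sum>i<n. r n i \<omega>)"
        unfolding e_def sum_distrib_left sum_subtractf[symmetric]
      proof (intro sum.cong refl)
        fix i assume "i \<in> {..<n}"
        then have "m (grid s t n (Suc i)) \<omega> - m (grid s t n i) \<omega> = (x (grid s t n (Suc i)) \<omega> - x (grid s t n i) \<omega>)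
            - (b (grid s t n (Suc i)) \<omega> - b (grid s t n i) \<omega>)"
          using elim[rule_format, of "grid s t n i"] elim[rule_format, of "grid s t n (Suc i)"]
            grid_in[of i n] grid_in[of "Suc i" n] by simp
        then have y1: "y1 i \<omega> = Z \<omega> * f' (x (grid s t n i) \<omega>) * ((x (grid s t n (Suc i)) \<omega> - x (grid s t n i) \<omega>)
            - (b (grid s t n (Suc i)) \<omega> - b (grid s t n i) \<omega>))"
          by (simp add: y1_def)
        show "y1 i \<omega> + y2 i \<omega> = Z \<omega> * (f (x (grid s t n (Suc i)) \<omega>) - f (x (grid s t n i) \<omega>)) -
         Z \<omega> * (let u = grid s t n i; v = grid s t n (Suc i)
             in f (x v \<omega>) - f (x u \<omega>) - f' (x u \<omega>) * (x v \<omega> - x u \<omega>) - f'' (x u \<omega>) / 2 * (m v \<omega> - m u \<omega>)\<^sup>2) -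
         Z \<omega> * r n i \<omega>"
          unfolding y1 y2_def r_def Let_def by (simp add: field_simps)
      qed
      ultimately show ?case by simp
    qed
    have [measurable]: "(\<lambda>\<omega>. \<Sum>i<n. r n i \<omega>) \<in> borel_measurable P" using r_meas by auto
    have "expectation (\<lambda>\<omega>. Z \<omega> * (\<Sum>i<n. r n i \<omega>)) =
        expectation (\<lambda>\<omega>. Z \<omega> * (f (x t \<omega>) - f (x s \<omega>)) - Z \<omega> * e n \<omega> - (\<Sum>i<n. y1 i \<omega> + y2 i \<omega>))"
      using ae int_sum by (intro integral_cong_AE) auto
    also have "\<dots> = expectation (\<lambda>\<omega>. Z \<omega> * (f (x t \<omega>) - f (x s \<omega>))) - expectation (\<lambda>\<omega>. Z \<omega> * e n \<omega>) - expectation (\<lambda>\<omega>. \<Sum>i<n. y1 i \<omega> + y2 i \<omega>)"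
    proof -
      have "integrable P (\<lambda>\<omega>. Z \<omega> * (f (x t \<omega>) - f (x s \<omega>)))" "integrable P (\<lambda>\<omega>. Z \<omega> * e n \<omega>)"
        using Z(2) fx_bd e_bd by (auto intro!: ae_bounded_integrable)
      then show ?thesis using int_sum by simp
    qed
    finally show ?thesis using E0 by simp
  qed
  have Ze: "(\<lambda>n. expectation (\<lambda>\<omega>. Z \<omega> * e n \<omega>)) \<longlonglongrightarrow> 0"
  proof (rule Lim_null_comparison)
    show "(\<lambda>n. cZ * expectation (\<lambda>\<omega>. \<bar>e n \<omega>\<bar>)) \<longlonglongrightarrow> 0"
      using e_lim by (intro tendsto_mult_right_zero)
    have "norm (expectation (\<lambda>\<omega>. Z \<omega> * e n \<omega>)) \<le> cZ * expectation (\<lambda>\<omega>. \<bar>e n \<omega>\<bar>)" for n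
    proof -
      have "norm (expectation (\<lambda>\<omega>. Z \<omega> * e n \<omega>)) \<le> expectation (\<lambda>\<omega>. norm (Z \<omega> * e n \<omega>))"
        by (rule integral_norm_bound)
      also have "\<dots> \<le> expectation (\<lambda>\<omega>. cZ * \<bar>e n \<omega>\<bar>)"
        using Z(2) e_bd[of n] cZ
        by (intro integral_mono_AE ae_bounded_integrable) (auto elim!: eventually_mono simp: abs_mult intro!: mult_right_mono)
      finally show ?thesis by simp
    qed
    then show "\<forall>\<^sub>F n in sequentially. norm (expectation (\<lambda>\<omega>. Z \<omega> * e n \<omega>)) \<le> cZ * expectation (\<lambda>\<omega>. \<bar>e n \<omega>\<bar>)"
      by simp
  qed
  have "(\<lambda>n. expectation (\<lambda>\<omega>. Z \<omega> * (\<Sum>i<n. r n i \<omega>))) \<longlonglongrightarrow> expectation (\<lambda>\<omega>. Z \<omega> * (f (x t \<omega>) - f (x s \<omega>))) - 0"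
  proof (rule Lim_transform_eventually)
    show "(\<lambda>n. expectation (\<lambda>\<omega>. Z \<omega> * (f (x t \<omega>) - f (x s \<omega>))) - expectation (\<lambda>\<omega>. Z \<omega> * e n \<omega>))
        \<longlonglongrightarrow> expectation (\<lambda>\<omega>. Z \<omega> * (f (x t \<omega>) - f (x s \<omega>))) - 0"
      by (intro tendsto_diff tendsto_const Ze)
    show "\<forall>\<^sub>F n in sequentially. expectation (\<lambda>\<omega>. Z \<omega> * (f (x t \<omega>) - f (x s \<omega>))) - expectation (\<lambda>\<omega>. Z \<omega> * e n \<omega>)
        = expectation (\<lambda>\<omega>. Z \<omega> * (\<Sum>i<n. r n i \<omega>))"
      using eventually_gt_at_top[of 0] by eventually_elim (simp add: key)
  qed
  moreover
  have "compact (f' ` {-K..K})" "compact (f'' ` {-K..K})"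
    by (intro compact_continuous_image continuous_on_subset[OF cont] continuous_on_subset[OF cont_f']; auto)+
  then obtain D1 D2 where D12: "\<And>y. y \<in> {-K..K} \<Longrightarrow> \<bar>f' y\<bar> \<le> D1" "\<And>y. y \<in> {-K..K} \<Longrightarrow> \<bar>f'' y\<bar> \<le> D2"
    by (fastforce dest!: compact_imp_bounded simp: bounded_iff)
  \<comment> \<open>Bounds all Riemann sums at once, since the Lipschitz bounds of the
    \<open>n\<close> cells add up to \<open>C * (t - s)\<close>. It serves as dominating constant
    and, passed to the limit, bounds the increment of \<open>J\<close>.\<close>
  define B where "B = (D1 + D2 / 2) * (C * (t - s))"
  have r_le: "AE \<omega> in P. \<forall>n. \<bar>\<Sum>i<n. r n i \<omega>\<bar> \<le> B"
    using x_bounded a_lipschitz b_lipschitz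
  proof eventually_elim
    case (elim \<omega>)
    show ?case
    proof
      fix n :: nat
      have "\<bar>r n i \<omega>\<bar> \<le> (D1 + D2 / 2) * (C * ((t - s) / real n))" if "i < n" for i
      proof -
        let ?u = "grid s t n i" and ?v = "grid s t n (Suc i)"
        have uv: "0 \<le> ?u" "?u \<le> ?v" "?v \<le> T" "?u \<le> T" "s \<le> ?u"
          using grid_in[of i n] grid_in[of "Suc i" n] grid_mono[of s t i "Suc i" n] st that by auto
        have "\<bar>x ?u \<omega>\<bar> \<le> K" using elim(1) uv by auto
        then have 1: "\<bar>f' (x ?u \<omega>)\<bar> \<le> D1" "\<bar>f'' (x ?u \<omega>)\<bar> \<le> D2" using D12[of "x ?u \<omega>"] by (simp_all add: abs_le_iff)
        have 2: "\<bar>a ?v \<omega> - a ?u \<omega>\<bar> \<le> C * ((t - s) / real n)" "\<bar>b ?v \<omega> - b ?u \<omega>\<bar> \<le> C * ((t - s) / real n)"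
          using elim(2)[rule_format, of ?u ?v] elim(3)[rule_format, of ?u ?v] uv grid_step[of s t n i] by auto
        have "\<bar>r n i \<omega>\<bar> \<le> \<bar>f' (x ?u \<omega>)\<bar> * \<bar>b ?v \<omega> - b ?u \<omega>\<bar> + \<bar>f'' (x ?u \<omega>)\<bar> / 2 * \<bar>a ?v \<omega> - a ?u \<omega>\<bar>"
          unfolding r_def Let_def by (rule order_trans[OF abs_triangle_ineq]) (simp add: abs_mult)
        also have "\<dots> \<le> D1 * (C * ((t - s) / real n)) + D2 / 2 * (C * ((t - s) / real n))"
          using 1 2 by (intro add_mono mult_mono) auto
        finally show ?thesis by (simp only: distrib_right)
      qed
      then have "(\<Sum>i<n. \<bar>r n i \<omega>\<bar>) \<le> (\<Sum>i<n. (D1 + D2 / 2) * (C * ((t - s) / real n)))"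
        by (intro sum_mono) auto
      also have "\<dots> \<le> B"
      \<comment> \<open>The empty sum requires \<open>0 \<le> B\<close>; the signs of
        \<open>D1\<close> and \<open>D2\<close> are read off at the point 0 of the interval.\<close>
      proof (cases "n = 0")
        case True
        have "0 \<le> D1" "0 \<le> D2" using D12[of 0] nonneg by fastforce+
        then show ?thesis using True nonneg st by (simp add: B_def)
      qed (simp add: B_def)
      finally show "\<bar>\<Sum>i<n. r n i \<omega>\<bar> \<le> B" by (rule order_trans[OF sum_abs])
    qed
  qed
  have "(\<lambda>n. expectation (\<lambda>\<omega>. Z \<omega> * (\<Sum>i<n. r n i \<omega>))) \<longlonglongrightarrow> expectation (\<lambda>\<omega>. Z \<omega> * (J t \<omega> - J s \<omega>))"
  proof (rule integral_dominated_convergence[where w = "\<lambda>_. cZ * B"])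
    show "(\<lambda>\<omega>. Z \<omega> * (\<Sum>i<n. r n i \<omega>)) \<in> borel_measurable P" for n
      using r_meas by (intro borel_measurable_times borel_measurable_sum) auto
    show "AE \<omega> in P. (\<lambda>n. Z \<omega> * (\<Sum>i<n. r n i \<omega>)) \<longlonglongrightarrow> Z \<omega> * (J t \<omega> - J s \<omega>)"
      using J_lim[OF st] unfolding r_def by eventually_elim (intro tendsto_mult_left)
    show "AE \<omega> in P. norm (Z \<omega> * (\<Sum>i<n. r n i \<omega>)) \<le> cZ * B" for n
      using r_le cZ
    proof eventually_elim
      case (elim \<omega>)
      have "0 \<le> cZ" using elim(2) by (rule order_trans[OF abs_ge_zero])
      then show ?case using elim by (simp add: abs_mult mult_mono)
    qed
  qed auto
  ultimately have eq: "expectation (\<lambda>\<omega>. Z \<omega> * (J t \<omega> - J s \<omega>)) = expectation (\<lambda>\<omega>. Z \<omega> * (f (x t \<omega>) - f (x s \<omega>)))"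
    by (auto dest: LIMSEQ_unique)
  \<comment> \<open>The increment of \<open>J\<close> inherits its bound from the Riemann sums, and
    this is where its integrability comes from.\<close>
  have "AE \<omega> in P. \<bar>J t \<omega> - J s \<omega>\<bar> \<le> B"
    using J_lim[OF st] r_le
  proof eventually_elim
    case (elim \<omega>)
    then show ?case unfolding r_def by (intro LIMSEQ_le_const2[OF tendsto_rabs]) auto
  qed
  then have "ae_bounded (\<lambda>\<omega>. J t \<omega> - J s \<omega>)" by (rule ae_boundedI)
  then have int: "integrable P (\<lambda>\<omega>. Z \<omega> * (J t \<omega> - J s \<omega>))" "integrable P (\<lambda>\<omega>. Z \<omega> * (f (x t \<omega>) - f (x s \<omega>)))"
    using Z(2) fx_bd by (intro ae_bounded_integrable; auto)+
  have "expectation (\<lambda>\<omega>. Z \<omega> * (f (x t \<omega>) - J t \<omega> - (f (x s \<omega>) - J s \<omega>)))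
      = expectation (\<lambda>\<omega>. Z \<omega> * (f (x t \<omega>) - f (x s \<omega>)) - Z \<omega> * (J t \<omega> - J s \<omega>))"
    by (intro Bochner_Integration.integral_cong) (auto simp: algebra_simps)
  also have "\<dots> = 0" using int eq by simp
  finally show "expectation (\<lambda>\<omega>. Z \<omega> * (f (x t \<omega>) - J t \<omega> - (f (x s \<omega>) - J s \<omega>))) = 0" .
qed

end


lemma abs_minus_twice_le: "\<bar>p - 2 * q\<bar> \<le> \<bar>p\<bar> + 2 * \<bar>q\<bar>" for p q :: real
  by linarith

section \<open>Compensator of the squared martingale part, and martingales of finite
  variation\<close>

context filtered_prob
begin

text \<open>On one cell, with \<open>w = y - y 0 - J1\<close>, the square (dw)^2 equals d(y^2) - 2 y
  dy + (dJ1)^2 - 2 dy dJ1. Under the expectation d(y^2) may be replaced by dJ2, and dy in the second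
  term by dJ1, so the sums tend to the increment of \<open>J2 - 2 J3\<close>, where
  \<open>J3\<close> is the integral of \<open>y\<close> against \<open>J1\<close>. The last two
  terms vanish because \<open>J1\<close> is Lipschitz and \<open>y\<close> is continuous.\<close>

theorem bracket_centered:
  fixes y J1 J2 J3 :: "real \<Rightarrow> 'a \<Rightarrow> real"
  assumes y_adapted: "\<And>t. 0 \<le> t \<Longrightarrow> t \<le> T \<Longrightarrow> y t \<in> borel_measurable (F t)"
    and J1_adapted: "\<And>t. 0 \<le> t \<Longrightarrow> t \<le> T \<Longrightarrow> J1 t \<in> borel_measurable (F t)"
    and J2_meas: "\<And>t. 0 \<le> t \<Longrightarrow> t \<le> T \<Longrightarrow> J2 t \<in> borel_measurable P"
    and J3_meas: "\<And>t. 0 \<le> t \<Longrightarrow> t \<le> T \<Longrightarrow> J3 t \<in> borel_measurable P"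
    and y_bounded: "AE \<omega> in P. \<forall>t\<in>{0..T}. \<bar>y t \<omega>\<bar> \<le> K"
    and y_continuous: "AE \<omega> in P. continuous_on {0..T} (\<lambda>t. y t \<omega>)"
    and bd: "\<And>t. 0 \<le> t \<Longrightarrow> t \<le> T \<Longrightarrow> ae_bounded (J1 t)" "\<And>t. 0 \<le> t \<Longrightarrow> t \<le> T \<Longrightarrow> ae_bounded (J2 t)"
      "\<And>t. 0 \<le> t \<Longrightarrow> t \<le> T \<Longrightarrow> ae_bounded (J3 t)"
    and J1_lipschitz: "AE \<omega> in P. \<forall>s\<in>{0..T}. \<forall>t\<in>{s..T}. \<bar>J1 t \<omega> - J1 s \<omega>\<bar> \<le> C * (t - s)"
    and J3_lim: "\<And>s t. 0 \<le> s \<Longrightarrow> s \<le> t \<Longrightarrow> t \<le> T \<Longrightarrow> AE \<omega> in P.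
      (\<lambda>n. \<Sum>i<n. y (grid s t n i) \<omega> * (J1 (grid s t n (Suc i)) \<omega> - J1 (grid s t n i) \<omega>))
        \<longlonglongrightarrow> J3 t \<omega> - J3 s \<omega>"
    and cy: "centered (\<lambda>t \<omega>. y t \<omega> - J1 t \<omega>)"
    and cy2: "centered (\<lambda>t \<omega>. (y t \<omega>)\<^sup>2 - J2 t \<omega>)"
    and nonneg: "0 \<le> K" "0 \<le> C"
  shows "centered (\<lambda>t \<omega>. (y t \<omega> - y 0 \<omega> - J1 t \<omega>)\<^sup>2 - (J2 t \<omega> - 2 * J3 t \<omega>))"
  unfolding centered_def
proof safe
  fix s t :: real and Z :: "'a \<Rightarrow> real"
  assume st: "0 \<le> s" "s \<le> t" "t \<le> T" and Z: "Z \<in> borel_measurable (F s)" "ae_bounded Z"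
  have s: "0 \<le> s" "s \<le> T" and t: "0 \<le> t" "t \<le> T" and zero: "0 \<le> (0::real)" "0 \<le> T" using st by auto
  have y_bd: "ae_bounded (y u)" if "0 \<le> u" "u \<le> T" for u
    by (rule ae_boundedI[of _ K]) (use y_bounded that in \<open>auto elim!: eventually_mono\<close>)
  have y_meas: "y u \<in> borel_measurable P" and J1_meas: "J1 u \<in> borel_measurable P" if "0 \<le> u" "u \<le> T" for u
    using y_adapted J1_adapted F_measurable_P that by blast+
  define w where "w u \<omega> = y u \<omega> - y 0 \<omega> - J1 u \<omega>" for u \<omega>
  have w_adapted: "w u \<in> borel_measurable (F u)" if "0 \<le> u" "u \<le> T" for u
    unfolding w_def using that
    by (intro borel_measurable_diff y_adapted J1_adapted F_measurable_mono[OF y_adapted[OF zero]]) auto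
  have w_bd: "ae_bounded (w u)" if "0 \<le> u" "u \<le> T" for u
    unfolding w_def using that zero by (auto intro!: y_bd bd)
  have w_meas: "w u \<in> borel_measurable P" if "0 \<le> u" "u \<le> T" for u
    using w_adapted F_measurable_P that by blast
  have cw: "centered w"
  proof -
    have "w v \<omega> - w u \<omega> = (y v \<omega> - J1 v \<omega>) - (y u \<omega> - J1 u \<omega>)" for u v \<omega>
      by (simp add: w_def)
    with cy show ?thesis unfolding centered_def by simp
  qed
  obtain cZ where cZ: "AE \<omega> in P. \<bar>Z \<omega>\<bar> \<le> cZ" using Z(2) by (auto simp: ae_bounded_def)
  note Zm [measurable] = F_measurable_P[OF Z(1) s]
  have grid_in: "0 \<le> grid s t n i" "grid s t n i \<le> T" "s \<le> grid s t n i" if "i \<le> n" for n i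
    using that st grid_ge[of s t n i] grid_le[of s t i n] by auto
  define r where "r n \<omega> = (\<Sum>i<n. y (grid s t n i) \<omega> * (J1 (grid s t n (Suc i)) \<omega> - J1 (grid s t n i) \<omega>))" for n \<omega>
  \<comment> \<open>The error of the cellwise identity: quadratic variation of \<open>J1\<close>
    minus twice its covariation with \<open>y\<close>.\<close>
  define q where "q n \<omega> = (\<Sum>i<n. (J1 (grid s t n (Suc i)) \<omega> - J1 (grid s t n i) \<omega>)\<^sup>2
    - 2 * (y (grid s t n (Suc i)) \<omega> - y (grid s t n i) \<omega>) * (J1 (grid s t n (Suc i)) \<omega> - J1 (grid s t n i) \<omega>))" for n \<omega>
  have meas: "r n \<in> borel_measurable P" "q n \<in> borel_measurable P" for n
    unfolding r_def q_def
    by (intro borel_measurable_sum borel_measurable_diff borel_measurable_times borel_measurable_power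
        borel_measurable_const y_meas J1_meas grid_in; simp)+
  have key: "expectation (\<lambda>\<omega>. Z \<omega> * ((J2 t \<omega> - J2 s \<omega>) - 2 * r n \<omega> + q n \<omega>))
      = expectation (\<lambda>\<omega>. Z \<omega> * ((w t \<omega>)\<^sup>2 - (w s \<omega>)\<^sup>2))" if n: "0 < n" for n
  proof -
    define u where "u = grid s t n"
    have term_eq: "expectation (\<lambda>\<omega>. Z \<omega> * ((w (u (Suc i)) \<omega>)\<^sup>2 - (w (u i) \<omega>)\<^sup>2))
      = expectation (\<lambda>\<omega>. Z \<omega> * ((J2 (u (Suc i)) \<omega> - J2 (u i) \<omega>)
          - 2 * (y (u i) \<omega> * (J1 (u (Suc i)) \<omega> - J1 (u i) \<omega>))
          + ((J1 (u (Suc i)) \<omega> - J1 (u i) \<omega>)\<^sup>2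
            - 2 * (y (u (Suc i)) \<omega> - y (u i) \<omega>) * (J1 (u (Suc i)) \<omega> - J1 (u i) \<omega>))))"
      if i: "i < n" for i
    proof -
      have u1: "0 \<le> u i" "u i \<le> T" and u2: "0 \<le> u (Suc i)" "u (Suc i) \<le> T" and u12: "s \<le> u i" "u i \<le> u (Suc i)"
        using grid_in[of i n] grid_in[of "Suc i" n] grid_mono[of s t i "Suc i" n] st i by (auto simp: u_def)
      note [measurable] = y_meas[OF u1] y_meas[OF u2] J1_meas[OF u1] J1_meas[OF u2] J2_meas[OF u1] J2_meas[OF u2]
      note bds = y_bd[OF u1] y_bd[OF u2] bd(1)[OF u1] bd(1)[OF u2] bd(2)[OF u1] bd(2)[OF u2] Z(2)
      have Zu: "Z \<in> borel_measurable (F (u i))" using F_measurable_mono[OF Z(1)] u1 u12 s by auto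
      \<comment> \<open>The left-point value \<open>y (u i)\<close> is absorbed into the multiplier,
        so that the drift property of \<open>y\<close> applies to \<open>y dy\<close>.\<close>
      have "expectation (\<lambda>\<omega>. (Z \<omega> * y (u i) \<omega>) * ((y (u (Suc i)) \<omega> - J1 (u (Suc i)) \<omega>) - (y (u i) \<omega> - J1 (u i) \<omega>))) = 0"
        using u1 u2 u12 Zu y_adapted[OF u1] bds by (intro centeredD[OF cy]) auto
      moreover have "expectation (\<lambda>\<omega>. Z \<omega> * (((y (u (Suc i)) \<omega>)\<^sup>2 - J2 (u (Suc i)) \<omega>) - ((y (u i) \<omega>)\<^sup>2 - J2 (u i) \<omega>))) = 0"
        using u1 u2 u12 Zu Z(2) by (intro centeredD[OF cy2]) auto
      moreover have "integrable P (\<lambda>\<omega>. Z \<omega> * (((y (u (Suc i)) \<omega>)\<^sup>2 - J2 (u (Suc i)) \<omega>) - ((y (u i) \<omega>)\<^sup>2 - J2 (u i) \<omega>)))"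
          "integrable P (\<lambda>\<omega>. (Z \<omega> * y (u i) \<omega>) * ((y (u (Suc i)) \<omega> - J1 (u (Suc i)) \<omega>) - (y (u i) \<omega> - J1 (u i) \<omega>)))"
        using bds by (intro ae_bounded_integrable; auto)+
      ultimately have 0: "expectation (\<lambda>\<omega>. Z \<omega> * (((y (u (Suc i)) \<omega>)\<^sup>2 - J2 (u (Suc i)) \<omega>) - ((y (u i) \<omega>)\<^sup>2 - J2 (u i) \<omega>))
          - 2 * ((Z \<omega> * y (u i) \<omega>) * ((y (u (Suc i)) \<omega> - J1 (u (Suc i)) \<omega>) - (y (u i) \<omega> - J1 (u i) \<omega>)))) = 0"
        by simp
      have "expectation (\<lambda>\<omega>. Z \<omega> * ((w (u (Suc i)) \<omega>)\<^sup>2 - (w (u i) \<omega>)\<^sup>2))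
          = expectation (\<lambda>\<omega>. Z \<omega> * (w (u (Suc i)) \<omega> - w (u i) \<omega>)\<^sup>2)"
        using u1 u2 u12 Zu Z(2) w_adapted w_bd cw
        by (intro centered_square_increment[symmetric]) auto
      also have "\<dots> = expectation (\<lambda>\<omega>. (Z \<omega> * ((J2 (u (Suc i)) \<omega> - J2 (u i) \<omega>)
          - 2 * (y (u i) \<omega> * (J1 (u (Suc i)) \<omega> - J1 (u i) \<omega>))
          + ((J1 (u (Suc i)) \<omega> - J1 (u i) \<omega>)\<^sup>2
            - 2 * (y (u (Suc i)) \<omega> - y (u i) \<omega>) * (J1 (u (Suc i)) \<omega> - J1 (u i) \<omega>)))) +
          (Z \<omega> * (((y (u (Suc i)) \<omega>)\<^sup>2 - J2 (u (Suc i)) \<omega>) - ((y (u i) \<omega>)\<^sup>2 - J2 (u i) \<omega>))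
          - 2 * ((Z \<omega> * y (u i) \<omega>) * ((y (u (Suc i)) \<omega> - J1 (u (Suc i)) \<omega>) - (y (u i) \<omega> - J1 (u i) \<omega>)))))"
        by (intro Bochner_Integration.integral_cong) (auto simp: w_def power2_eq_square algebra_simps)
      also have "\<dots> = expectation (\<lambda>\<omega>. Z \<omega> * ((J2 (u (Suc i)) \<omega> - J2 (u i) \<omega>)
          - 2 * (y (u i) \<omega> * (J1 (u (Suc i)) \<omega> - J1 (u i) \<omega>))
          + ((J1 (u (Suc i)) \<omega> - J1 (u i) \<omega>)\<^sup>2
            - 2 * (y (u (Suc i)) \<omega> - y (u i) \<omega>) * (J1 (u (Suc i)) \<omega> - J1 (u i) \<omega>)))) + 0"
        unfolding 0[symmetric] using bds
        by (intro Bochner_Integration.integral_add) (intro ae_bounded_integrable; auto)+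
      finally show ?thesis by simp
    qed
    have int1: "integrable P (\<lambda>\<omega>. Z \<omega> * ((w (u (Suc i)) \<omega>)\<^sup>2 - (w (u i) \<omega>)\<^sup>2))" if i: "i < n" for i
      unfolding u_def using i grid_in[of i n] grid_in[of "Suc i" n] w_bd w_meas Z(2)
      by (intro ae_bounded_integrable) auto
    have int2: "integrable P (\<lambda>\<omega>. Z \<omega> * ((J2 (u (Suc i)) \<omega> - J2 (u i) \<omega>)
          - 2 * (y (u i) \<omega> * (J1 (u (Suc i)) \<omega> - J1 (u i) \<omega>))
          + ((J1 (u (Suc i)) \<omega> - J1 (u i) \<omega>)\<^sup>2
            - 2 * (y (u (Suc i)) \<omega> - y (u i) \<omega>) * (J1 (u (Suc i)) \<omega> - J1 (u i) \<omega>))))"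
      (is "integrable P (?g i)") if i: "i < n" for i
      unfolding u_def using i grid_in[of i n] grid_in[of "Suc i" n] y_bd bd y_meas J1_meas J2_meas Z(2)
      by (intro ae_bounded_integrable) auto
    have "expectation (\<lambda>\<omega>. Z \<omega> * ((w t \<omega>)\<^sup>2 - (w s \<omega>)\<^sup>2)) = expectation (\<lambda>\<omega>. \<Sum>i<n. Z \<omega> * ((w (u (Suc i)) \<omega>)\<^sup>2 - (w (u i) \<omega>)\<^sup>2))"
      unfolding sum_distrib_left[symmetric] u_def sum_telescope_grid[OF n, of "\<lambda>t. (w t _)\<^sup>2"] ..
    also have "\<dots> = (\<Sum>i<n. expectation (\<lambda>\<omega>. Z \<omega> * ((w (u (Suc i)) \<omega>)\<^sup>2 - (w (u i) \<omega>)\<^sup>2)))"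
      using int1 by (intro Bochner_Integration.integral_sum) auto
    also have "\<dots> = (\<Sum>i<n. expectation (?g i))" using term_eq by (intro sum.cong) auto
    also have "\<dots> = expectation (\<lambda>\<omega>. \<Sum>i<n. ?g i \<omega>)"
      using int2 by (intro Bochner_Integration.integral_sum[symmetric]) auto
    also have "(\<lambda>\<omega>. \<Sum>i<n. ?g i \<omega>) = (\<lambda>\<omega>. Z \<omega> * ((J2 t \<omega> - J2 s \<omega>) - 2 * r n \<omega> + q n \<omega>))"
    proof
      fix \<omega>
      have "(\<Sum>i<n. ?g i \<omega>) = Z \<omega> * ((\<Sum>i<n. J2 (u (Suc i)) \<omega> - J2 (u i) \<omega>) - 2 * r n \<omega> + q n \<omega>)"
        unfolding sum_distrib_left[symmetric] sum.distrib sum_subtractf r_def q_def u_def by simp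
      then show "(\<Sum>i<n. ?g i \<omega>) = Z \<omega> * ((J2 t \<omega> - J2 s \<omega>) - 2 * r n \<omega> + q n \<omega>)"
        unfolding u_def sum_telescope_grid[OF n, of "\<lambda>t. J2 t _"] .
    qed
    finally show ?thesis by simp
  qed
  have q_lim: "AE \<omega> in P. (\<lambda>n. q n \<omega>) \<longlonglongrightarrow> 0"
    using y_continuous J1_lipschitz
  proof eventually_elim
    case (elim \<omega>)
    show ?case
    proof (rule LIMSEQ_I)
      fix e :: real assume e: "e > 0"
      define L where "L = C * (t - s)"
      have L: "L \<ge> 0" using nonneg st by (simp add: L_def)
      \<comment> \<open>\<open>L + 1\<close> keeps the quotient meaningful for \<open>L = 0\<close>;
        the resulting bound \<open>2 * d * L\<close> lies below
        \<open>2 * d * (L + 1) = e\<close>.\<close>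
      define d where "d = (e / 2) / (L + 1)"
      have d: "d > 0" using e L by (simp add: d_def)
      have "\<forall>\<^sub>F n in sequentially. \<forall>i<n. \<bar>y (grid s t n (Suc i)) \<omega> - y (grid s t n i) \<omega>\<bar> < d / 2"
        using st d by (intro grid_osc_eventually_small continuous_on_subset[OF elim(1)]) auto
      moreover have "(\<lambda>n. L / real n) \<longlonglongrightarrow> 0" by real_asymp
      then have "\<forall>\<^sub>F n in sequentially. L / real n < d" using d by (rule order_tendstoD(2))
      ultimately have "\<forall>\<^sub>F n in sequentially. norm (q n \<omega> - 0) < e"
        using eventually_gt_at_top[of 0]
      proof eventually_elim
        case (elim n)
        have "norm (q n \<omega> - 0) \<le> (\<Sum>i<n. 2 * d * (L / real n))"
          unfolding q_def diff_0_right real_norm_def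
        proof (rule order_trans[OF sum_abs], rule sum_mono)
          fix i assume "i \<in> {..<n}"
          then have i: "i < n" by simp
          let ?u = "grid s t n i" and ?v = "grid s t n (Suc i)"
          have uv: "0 \<le> ?u" "?u \<le> ?v" "?v \<le> T" "?u \<le> T" "s \<le> ?u"
            using grid_in[of i n] grid_in[of "Suc i" n] grid_mono[of s t i "Suc i" n] st i by auto
          have dJ: "\<bar>J1 ?v \<omega> - J1 ?u \<omega>\<bar> \<le> L / real n"
            using \<open>\<forall>s\<in>{0..T}. \<forall>t\<in>{s..T}. _\<close>[rule_format, of ?u ?v] uv grid_step[of s t n i] by (simp add: L_def)
          have dy: "2 * \<bar>y ?v \<omega> - y ?u \<omega>\<bar> \<le> d" using elim(1) i by (auto simp: less_imp_le)
          have "\<bar>(J1 ?v \<omega> - J1 ?u \<omega>)\<^sup>2 - 2 * (y ?v \<omega> - y ?u \<omega>) * (J1 ?v \<omega> - J1 ?u \<omega>)\<bar>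
              = \<bar>(J1 ?v \<omega> - J1 ?u \<omega>) - 2 * (y ?v \<omega> - y ?u \<omega>)\<bar> * \<bar>J1 ?v \<omega> - J1 ?u \<omega>\<bar>"
            by (simp add: power2_eq_square algebra_simps flip: abs_mult)
          also have "\<dots> \<le> (2 * d) * (L / real n)"
          proof (rule mult_mono)
            have "\<bar>(J1 ?v \<omega> - J1 ?u \<omega>) - 2 * (y ?v \<omega> - y ?u \<omega>)\<bar> \<le> \<bar>J1 ?v \<omega> - J1 ?u \<omega>\<bar> + 2 * \<bar>y ?v \<omega> - y ?u \<omega>\<bar>"
              by (rule abs_minus_twice_le)
            then show "\<bar>(J1 ?v \<omega> - J1 ?u \<omega>) - 2 * (y ?v \<omega> - y ?u \<omega>)\<bar> \<le> 2 * d"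
              using dJ dy elim(2) by linarith
          qed (use dJ d in auto)
          finally show "\<bar>(J1 ?v \<omega> - J1 ?u \<omega>)\<^sup>2 - 2 * (y ?v \<omega> - y ?u \<omega>) * (J1 ?v \<omega> - J1 ?u \<omega>)\<bar> \<le> 2 * d * (L / real n)" .
        qed
        also have "\<dots> = 2 * d * L" using elim by simp
        also have "\<dots> < 2 * d * (L + 1)" using d by simp
        also have "\<dots> = 2 * (d * (L + 1))" by simp
        also have "d * (L + 1) = e / 2"
          unfolding d_def using L by (intro nonzero_eq_divide_eq[THEN iffD1, OF _ refl]) simp
        also have "2 * (e / 2) = e" by simp
        finally show ?case .
      qed
      then show "\<exists>no. \<forall>n\<ge>no. norm (q n \<omega> - 0) < e" by (simp add: eventually_sequentially)
    qed
  qed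
  define L where "L = C * (t - s)"
  have L: "L \<ge> 0" using nonneg st by (simp add: L_def)
  \<comment> \<open>\<open>4 * K\<close> bounds twice an increment of \<open>y\<close>, and a single
    increment of \<open>J1\<close> is at most \<open>L\<close>. Uniformity in \<open>n\<close> is
    what dominated convergence requires.\<close>
  have rq_bound: "AE \<omega> in P. \<forall>n. \<bar>r n \<omega>\<bar> \<le> K * L \<and> \<bar>q n \<omega>\<bar> \<le> (L + 4 * K) * L"
    using y_bounded J1_lipschitz
  proof eventually_elim
    case (elim \<omega>)
    show ?case
    proof
      fix n :: nat
      have dJ: "\<bar>J1 (grid s t n (Suc i)) \<omega> - J1 (grid s t n i) \<omega>\<bar> \<le> L / real n" if i: "i < n" for i
        using elim(2)[rule_format, of "grid s t n i" "grid s t n (Suc i)"] grid_in[of i n] grid_in[of "Suc i" n]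
          grid_mono[of s t i "Suc i" n] st i grid_step[of s t n i] by (simp add: L_def)
      have yK: "\<bar>y (grid s t n i) \<omega>\<bar> \<le> K" if "i \<le> n" for i
        using elim(1) grid_in[OF that] by auto
      have Ln: "L / real n \<le> L" if "0 < n"
        using that L by (simp add: divide_le_eq mult_le_cancel_left1)
      have "\<bar>r n \<omega>\<bar> \<le> (\<Sum>i<n. K * (L / real n))"
        unfolding r_def
        by (rule order_trans[OF sum_abs], rule sum_mono) (use dJ yK nonneg in \<open>auto simp: abs_mult simp del: times_divide_eq_right intro!: mult_mono\<close>)
      also have "\<dots> \<le> K * L" using nonneg L by (cases "n = 0") auto
      finally have 1: "\<bar>r n \<omega>\<bar> \<le> K * L" .
      have "\<bar>q n \<omega>\<bar> \<le> (\<Sum>i<n. (L + 4 * K) * (L / real n))"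
        unfolding q_def
      proof (rule order_trans[OF sum_abs], rule sum_mono)
        fix i assume "i \<in> {..<n}"
        then have i: "i < n" by simp
        let ?u = "grid s t n i" and ?v = "grid s t n (Suc i)"
        have "\<bar>(J1 ?v \<omega> - J1 ?u \<omega>)\<^sup>2 - 2 * (y ?v \<omega> - y ?u \<omega>) * (J1 ?v \<omega> - J1 ?u \<omega>)\<bar>
              = \<bar>(J1 ?v \<omega> - J1 ?u \<omega>) - 2 * (y ?v \<omega> - y ?u \<omega>)\<bar> * \<bar>J1 ?v \<omega> - J1 ?u \<omega>\<bar>"
          by (simp add: power2_eq_square algebra_simps flip: abs_mult)
        also have "\<dots> \<le> (L + 4 * K) * (L / real n)"
        proof (rule mult_mono)
          have "\<bar>(J1 ?v \<omega> - J1 ?u \<omega>) - 2 * (y ?v \<omega> - y ?u \<omega>)\<bar> \<le> \<bar>J1 ?v \<omega> - J1 ?u \<omega>\<bar> + 2 * (\<bar>y ?v \<omega>\<bar> + \<bar>y ?u \<omega>\<bar>)"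
            by (rule order_trans[OF abs_minus_twice_le]) (use abs_triangle_ineq4[of "y ?v \<omega>" "y ?u \<omega>"] in simp)
          then show "\<bar>(J1 ?v \<omega> - J1 ?u \<omega>) - 2 * (y ?v \<omega> - y ?u \<omega>)\<bar> \<le> L + 4 * K"
            using dJ[OF i] yK[of i] yK[of "Suc i"] Ln i by simp
        qed (use dJ[OF i] L nonneg in auto)
        finally show "\<bar>(J1 ?v \<omega> - J1 ?u \<omega>)\<^sup>2 - 2 * (y ?v \<omega> - y ?u \<omega>) * (J1 ?v \<omega> - J1 ?u \<omega>)\<bar> \<le> (L + 4 * K) * (L / real n)" .
      qed
      also have "\<dots> \<le> (L + 4 * K) * L" using nonneg L by (cases "n = 0") auto
      finally show "\<bar>r n \<omega>\<bar> \<le> K * L \<and> \<bar>q n \<omega>\<bar> \<le> (L + 4 * K) * L" using 1 by simp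
    qed
  qed
  obtain c2 where c2: "AE \<omega> in P. \<bar>J2 t \<omega> - J2 s \<omega>\<bar> \<le> c2"
    using ae_bounded_diff[OF bd(2)[OF t] bd(2)[OF s]] by (auto simp: ae_bounded_def)
  note [measurable] = J2_meas[OF s] J2_meas[OF t] J3_meas[OF s] J3_meas[OF t] meas w_meas[OF s] w_meas[OF t]
  have "(\<lambda>n. expectation (\<lambda>\<omega>. Z \<omega> * ((J2 t \<omega> - J2 s \<omega>) - 2 * r n \<omega> + q n \<omega>)))
      \<longlonglongrightarrow> expectation (\<lambda>\<omega>. Z \<omega> * ((J2 t \<omega> - J2 s \<omega>) - 2 * (J3 t \<omega> - J3 s \<omega>) + 0))"
  proof (rule integral_dominated_convergence[where w = "\<lambda>_. cZ * (c2 + 2 * (K * L) + (L + 4 * K) * L)"])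
    show "AE \<omega> in P. (\<lambda>n. Z \<omega> * ((J2 t \<omega> - J2 s \<omega>) - 2 * r n \<omega> + q n \<omega>))
        \<longlonglongrightarrow> Z \<omega> * ((J2 t \<omega> - J2 s \<omega>) - 2 * (J3 t \<omega> - J3 s \<omega>) + 0)"
      using J3_lim[OF st] q_lim unfolding r_def by eventually_elim (intro tendsto_intros)
    show "AE \<omega> in P. norm (Z \<omega> * ((J2 t \<omega> - J2 s \<omega>) - 2 * r n \<omega> + q n \<omega>)) \<le> cZ * (c2 + 2 * (K * L) + (L + 4 * K) * L)" for n
      using rq_bound c2 cZ
    proof eventually_elim
      case (elim \<omega>)
      have "0 \<le> cZ" using elim(3) by (rule order_trans[OF abs_ge_zero])
      moreover have "\<bar>(J2 t \<omega> - J2 s \<omega>) - 2 * r n \<omega> + q n \<omega>\<bar> \<le> c2 + 2 * (K * L) + (L + 4 * K) * L"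
        using elim(1)[rule_format, of n] elim(2) by linarith
      ultimately show ?case unfolding real_norm_def abs_mult using elim(3) by (intro mult_mono) auto
    qed
  qed auto
  moreover have "(\<lambda>n. expectation (\<lambda>\<omega>. Z \<omega> * ((J2 t \<omega> - J2 s \<omega>) - 2 * r n \<omega> + q n \<omega>)))
      \<longlonglongrightarrow> expectation (\<lambda>\<omega>. Z \<omega> * ((w t \<omega>)\<^sup>2 - (w s \<omega>)\<^sup>2))"
    by (rule tendsto_eventually, rule eventually_mono[OF eventually_gt_at_top[of 0]]) (rule key)
  ultimately have eq: "expectation (\<lambda>\<omega>. Z \<omega> * ((w t \<omega>)\<^sup>2 - (w s \<omega>)\<^sup>2))
      = expectation (\<lambda>\<omega>. Z \<omega> * ((J2 t \<omega> - J2 s \<omega>) - 2 * (J3 t \<omega> - J3 s \<omega>) + 0))"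
    by (rule LIMSEQ_unique[symmetric])
  have int: "integrable P (\<lambda>\<omega>. Z \<omega> * ((w t \<omega>)\<^sup>2 - (w s \<omega>)\<^sup>2))"
     "integrable P (\<lambda>\<omega>. Z \<omega> * ((J2 t \<omega> - J2 s \<omega>) - 2 * (J3 t \<omega> - J3 s \<omega>) + 0))"
    using Z(2) w_bd s t bd by (intro ae_bounded_integrable; auto)+
  have "expectation (\<lambda>\<omega>. Z \<omega> * ((w t \<omega>)\<^sup>2 - (J2 t \<omega> - 2 * J3 t \<omega>) - ((w s \<omega>)\<^sup>2 - (J2 s \<omega> - 2 * J3 s \<omega>))))
     = expectation (\<lambda>\<omega>. Z \<omega> * ((w t \<omega>)\<^sup>2 - (w s \<omega>)\<^sup>2) - Z \<omega> * ((J2 t \<omega> - J2 s \<omega>) - 2 * (J3 t \<omega> - J3 s \<omega>) + 0))"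
    by (intro Bochner_Integration.integral_cong) (auto simp: algebra_simps)
  also have "\<dots> = 0" using int eq by simp
  finally show "expectation (\<lambda>\<omega>. Z \<omega> * ((y t \<omega> - y 0 \<omega> - J1 t \<omega>)\<^sup>2 - (J2 t \<omega> - 2 * J3 t \<omega>)
      - ((y s \<omega> - y 0 \<omega> - J1 s \<omega>)\<^sup>2 - (J2 s \<omega> - 2 * J3 s \<omega>)))) = 0"
    unfolding w_def .
qed

text \<open>The sum of squared increments is at most the largest increment times the variation,
  while orthogonality identifies its mean with that of the squared total increment. The variation is
  finite but not bounded over all paths, so the sum is cut once the running variation exceeds a
  level \<open>c\<close>. The cut depends on the past alone, hence preserves orthogonality, and it
  is inactive on the event \<open>A c\<close>.\<close>

theorem centered_finite_variation_zero:
  fixes N :: "real \<Rightarrow> 'a \<Rightarrow> real"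
  assumes N_adapted: "\<And>t. 0 \<le> t \<Longrightarrow> t \<le> T \<Longrightarrow> N t \<in> borel_measurable (F t)"
    and N_bounded: "AE \<omega> in P. \<forall>t\<in>{0..T}. \<bar>N t \<omega>\<bar> \<le> K"
    and N_continuous: "AE \<omega> in P. continuous_on {0..T} (\<lambda>t. N t \<omega>)"
    and N_centered: "centered N"
    and N_variation: "AE \<omega> in P. \<exists>c. \<forall>n. (\<Sum>i<n. \<bar>N (grid 0 t n (Suc i)) \<omega> - N (grid 0 t n i) \<omega>\<bar>) \<le> c"
    and t: "0 \<le> t" "t \<le> T"
  shows "AE \<omega> in P. N t \<omega> = N 0 \<omega>"
proof -
  define d where "d n i \<omega> = N (grid 0 t n (Suc i)) \<omega> - N (grid 0 t n i) \<omega>" for n i \<omega>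
  define v where "v n k \<omega> = (\<Sum>i<k. \<bar>d n i \<omega>\<bar>)" for n k \<omega>
  have zero: "0 \<le> (0::real)" "0 \<le> T" using t by auto
  have grid_in: "0 \<le> grid 0 t n i" "grid 0 t n i \<le> T" if "i \<le> n" for n i
    using that t grid_ge[of 0 t n i] grid_le[of 0 t i n] by auto
  have N_bd: "ae_bounded (N u)" if "0 \<le> u" "u \<le> T" for u
    by (rule ae_boundedI[of _ K]) (use N_bounded that in \<open>auto elim!: eventually_mono\<close>)
  have N_meas: "N u \<in> borel_measurable P" if "0 \<le> u" "u \<le> T" for u
    using N_adapted F_measurable_P that by blast
  have d_meas: "d n i \<in> borel_measurable P" if "i < n" for n i
    unfolding d_def using that by (intro borel_measurable_diff N_meas grid_in) auto
  have d_bd: "ae_bounded (d n i)" if "i < n" for n i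
    unfolding d_def using that by (intro ae_bounded_diff N_bd grid_in) auto
  have v_meas [measurable]: "v n n \<in> borel_measurable P" for n
    unfolding v_def using d_meas by auto
  \<comment> \<open>The paths whose grid variations all stay below \<open>c\<close>. Integer levels
    exhaust almost every path.\<close>
  define A where "A c = {\<omega>\<in>space P. \<forall>n. v n n \<omega> \<le> c}" for c
  have A_meas [measurable]: "A c \<in> sets P" for c unfolding A_def by measurable
  have on_A: "AE \<omega> in P. \<omega> \<in> A (real k) \<longrightarrow> N t \<omega> = N 0 \<omega>" for k
  proof -
    define c where "c = real k"
    \<comment> \<open>Martingale transform of the increments: the indicator that the variation
      before cell \<open>i\<close> is at most \<open>c\<close> is known at the left end point of
      that cell.\<close>
    define R where "R n j \<omega> = (\<Sum>i<j. of_bool (v n i \<omega> \<le> c) * d n i \<omega>)" for n j \<omega>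
    define S where "S n \<omega> = (\<Sum>i<n. of_bool (v n i \<omega> \<le> c) * (d n i \<omega>)\<^sup>2)" for n \<omega>
    have d_ad: "d n i \<in> borel_measurable (F (grid 0 t n j))" if "i < j" "j \<le> n" for n i j
    proof -
      have "grid 0 t n (Suc i) \<le> grid 0 t n j" "grid 0 t n i \<le> grid 0 t n j"
        using t that by (auto intro!: grid_mono)
      then show ?thesis
        unfolding d_def using that grid_in[of i n] grid_in[of "Suc i" n] grid_in[of j n]
        by (intro borel_measurable_diff F_measurable_mono[OF N_adapted]) auto
    qed
    have v_ad: "v n i \<in> borel_measurable (F (grid 0 t n j))" if "i \<le> j" "j \<le> n" for n i j
      unfolding v_def using that by (intro borel_measurable_sum borel_measurable_abs d_ad) auto
    have b_ad: "(\<lambda>\<omega>. of_bool (v n i \<omega> \<le> c) :: real) \<in> borel_measurable (F (grid 0 t n j))" if "i \<le> j" "j \<le> n" for n i j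
    proof -
      note [measurable] = v_ad[OF that]
      show ?thesis unfolding of_bool_def by measurable
    qed
    have R_ad: "R n j \<in> borel_measurable (F (grid 0 t n j))" if "j \<le> n" for n j
      unfolding R_def using that by (intro borel_measurable_sum borel_measurable_times b_ad d_ad) auto
    have b_meas: "(\<lambda>\<omega>. of_bool (v n i \<omega> \<le> c) :: real) \<in> borel_measurable P" if "i \<le> n" for n i
      using b_ad[of i i n] that grid_in[of i n] F_measurable_P by auto
    have R_meas: "R n j \<in> borel_measurable P" if "j \<le> n" for n j
      using R_ad[OF that] grid_in[OF that] F_measurable_P by blast
    have S_meas [measurable]: "S n \<in> borel_measurable P" for n
      unfolding S_def by (intro borel_measurable_sum borel_measurable_times borel_measurable_power b_meas d_meas) auto
    have R_bd: "ae_bounded (R n j)" if "j \<le> n" for n j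
      unfolding R_def using that by (intro ae_bounded_sum ae_bounded_mult ae_bounded_of_bool d_bd) auto
    have ER: "expectation (\<lambda>\<omega>. (R n j \<omega>)\<^sup>2) = expectation (\<lambda>\<omega>. \<Sum>i<j. of_bool (v n i \<omega> \<le> c) * (d n i \<omega>)\<^sup>2)"
      if "j \<le> n" for n j
      using that
    proof (induction j)
      case 0
      then show ?case by (simp add: R_def)
    next
      case (Suc j)
      then have j: "j < n" "j \<le> n" by auto
      let ?b = "\<lambda>\<omega>. of_bool (v n j \<omega> \<le> c) :: real"
      have ms: "?b \<in> borel_measurable P" "R n j \<in> borel_measurable P" "d n j \<in> borel_measurable P"
        using b_meas R_meas d_meas j by auto
      have "grid 0 t n j \<le> grid 0 t n (Suc j)" using t by (auto intro: grid_mono)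
      then have 0: "expectation (\<lambda>\<omega>. (R n j \<omega> * ?b \<omega>) * d n j \<omega>) = 0"
        unfolding d_def using j grid_in[of j n] grid_in[of "Suc j" n] R_ad[of j n] b_ad[of j j n] R_bd[of j n]
        by (intro centeredD[OF N_centered]) auto
      have "expectation (\<lambda>\<omega>. (R n (Suc j) \<omega>)\<^sup>2)
        = expectation (\<lambda>\<omega>. (R n j \<omega>)\<^sup>2 + 2 * ((R n j \<omega> * ?b \<omega>) * d n j \<omega>) + ?b \<omega> * (d n j \<omega>)\<^sup>2)"
        by (intro Bochner_Integration.integral_cong) (auto simp: R_def power2_eq_square algebra_simps)
      also have "\<dots> = expectation (\<lambda>\<omega>. (R n j \<omega>)\<^sup>2) + expectation (\<lambda>\<omega>. ?b \<omega> * (d n j \<omega>)\<^sup>2)"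
      proof -
        have "integrable P (\<lambda>\<omega>. (R n j \<omega>)\<^sup>2)" "integrable P (\<lambda>\<omega>. (R n j \<omega> * ?b \<omega>) * d n j \<omega>)"
          "integrable P (\<lambda>\<omega>. ?b \<omega> * (d n j \<omega>)\<^sup>2)"
          using ms R_bd[OF j(2)] d_bd[OF j(1)] by (intro ae_bounded_integrable; auto)+
        then show ?thesis using 0 by simp
      qed
      also have "\<dots> = expectation (\<lambda>\<omega>. (\<Sum>i<j. of_bool (v n i \<omega> \<le> c) * (d n i \<omega>)\<^sup>2) + ?b \<omega> * (d n j \<omega>)\<^sup>2)"
      proof -
        have "integrable P (\<lambda>\<omega>. \<Sum>i<j. of_bool (v n i \<omega> \<le> c) * (d n i \<omega>)\<^sup>2)" "integrable P (\<lambda>\<omega>. ?b \<omega> * (d n j \<omega>)\<^sup>2)"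
          using j by (intro ae_bounded_integrable borel_measurable_sum borel_measurable_times borel_measurable_power
            b_meas d_meas ae_bounded_sum ae_bounded_mult ae_bounded_power ae_bounded_of_bool d_bd; simp)+
        then show ?thesis using Suc j by simp
      qed
      finally show ?case by simp
    qed
    \<comment> \<open>The increment that crosses the level is still retained, so the retained
      variation is at most \<open>c + e\<close> rather than \<open>c\<close>.\<close>
    have bound: "AE \<omega> in P. \<forall>n. \<forall>e\<ge>0. (\<forall>i<n. \<bar>d n i \<omega>\<bar> \<le> e) \<longrightarrow> \<bar>S n \<omega>\<bar> \<le> e * (c + e)"
    proof (rule AE_I2, safe)
      fix \<omega> n and e :: real assume e: "0 \<le> e" "\<forall>i<n. \<bar>d n i \<omega>\<bar> \<le> e"
      have 1: "(\<Sum>i<j. of_bool (v n i \<omega> \<le> c) * \<bar>d n i \<omega>\<bar>) \<le> v n j \<omega>" for j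
        unfolding v_def by (intro sum_mono) auto
      have 2: "(\<Sum>i<j. of_bool (v n i \<omega> \<le> c) * \<bar>d n i \<omega>\<bar>) \<le> c + e" if "j \<le> n" for j
        using that
      proof (induction j)
        case 0
        then show ?case using e by (simp add: c_def)
      next
        case (Suc j)
        show ?case
        proof (cases "v n j \<omega> \<le> c")
          case True
          have "\<bar>d n j \<omega>\<bar> \<le> e" using e Suc by auto
          then show ?thesis using 1[of j] True by simp
        qed (use Suc in simp)
      qed
      have "\<bar>S n \<omega>\<bar> = S n \<omega>" by (simp add: S_def sum_nonneg)
      also have "\<dots> \<le> (\<Sum>i<n. e * (of_bool (v n i \<omega> \<le> c) * \<bar>d n i \<omega>\<bar>))"
        unfolding S_def
      proof (rule sum_mono)
        fix i assume "i \<in> {..<n}"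
        then have "\<bar>d n i \<omega>\<bar> * \<bar>d n i \<omega>\<bar> \<le> e * \<bar>d n i \<omega>\<bar>" using e by (intro mult_right_mono) auto
        then show "of_bool (v n i \<omega> \<le> c) * (d n i \<omega>)\<^sup>2 \<le> e * (of_bool (v n i \<omega> \<le> c) * \<bar>d n i \<omega>\<bar>)"
          by (simp add: power2_eq_square)
      qed
      also have "\<dots> \<le> e * (c + e)"
        unfolding sum_distrib_left[symmetric] using e 2[of n] by (intro mult_left_mono) auto
      finally show "\<bar>S n \<omega>\<bar> \<le> e * (c + e)" .
    qed
    have "(\<lambda>n. expectation (S n)) \<longlonglongrightarrow> expectation (\<lambda>_. 0)"
    proof (rule integral_dominated_convergence[where w = "\<lambda>_. 2 * \<bar>K\<bar> * (c + 2 * \<bar>K\<bar>)"])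
      show "AE \<omega> in P. norm (S n \<omega>) \<le> 2 * \<bar>K\<bar> * (c + 2 * \<bar>K\<bar>)" for n
        using bound N_bounded
      proof eventually_elim
        case (elim \<omega>)
        have "\<bar>d n i \<omega>\<bar> \<le> 2 * \<bar>K\<bar>" if "i < n" for i
        proof -
          have "\<bar>N (grid 0 t n (Suc i)) \<omega>\<bar> \<le> K" "\<bar>N (grid 0 t n i) \<omega>\<bar> \<le> K"
            using elim(2) grid_in[of i n] grid_in[of "Suc i" n] that by auto
          then show ?thesis unfolding d_def by linarith
        qed
        then show ?case using elim(1)[rule_format, of "2 * \<bar>K\<bar>" n] by simp
      qed
      show "AE \<omega> in P. (\<lambda>n. S n \<omega>) \<longlonglongrightarrow> 0"
        using bound N_continuous
      proof eventually_elim
        case (elim \<omega>)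
        show ?case
        proof (rule LIMSEQ_I)
          fix \<epsilon> :: real assume "\<epsilon> > 0"
          \<comment> \<open>The cap at 1 gives \<open>c + e \<le> c + 1\<close>, and the second
            entry then makes \<open>e * (c + 1)\<close> at most
            \<open>\<epsilon> / 2\<close>.\<close>
          define e where "e = min 1 ((\<epsilon> / 2) / (c + 1))"
          have c: "c \<ge> 0" by (simp add: c_def)
          have e: "0 < e" "e \<le> 1" "e \<le> (\<epsilon> / 2) / (c + 1)" using \<open>\<epsilon> > 0\<close> c by (auto simp: e_def)
          have "\<forall>\<^sub>F n in sequentially. \<forall>i<n. \<bar>d n i \<omega>\<bar> < e"
            unfolding d_def using t e
            by (intro grid_osc_eventually_small continuous_on_subset[OF elim(2)]) auto
          then have "\<forall>\<^sub>F n in sequentially. norm (S n \<omega> - 0) < \<epsilon>"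
          proof eventually_elim
            case (elim n)
            then have "\<bar>S n \<omega>\<bar> \<le> e * (c + e)" using \<open>\<forall>n. \<forall>e\<ge>0. _\<close> e by (simp add: less_imp_le)
            also have "\<dots> \<le> e * (c + 1)" using e by simp
            also have "\<dots> \<le> (\<epsilon> / 2) / (c + 1) * (c + 1)" using e c by (intro mult_right_mono) auto
            also have "\<dots> = \<epsilon> / 2"
              using c by (intro nonzero_eq_divide_eq[THEN iffD1, OF _ refl]) simp
            also have "\<dots> < \<epsilon>" using \<open>\<epsilon> > 0\<close> by simp
            finally show ?case by simp
          qed
          then show "\<exists>no. \<forall>n\<ge>no. norm (S n \<omega> - 0) < \<epsilon>" by (simp add: eventually_sequentially)
        qed
      qed
    qed auto
    then have lim: "(\<lambda>n. expectation (S n)) \<longlonglongrightarrow> 0" by simp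
    note [measurable] = N_meas[OF t] N_meas[OF zero]
    define G where "G \<omega> = indicator (A c) \<omega> * (N t \<omega> - N 0 \<omega>)\<^sup>2" for \<omega>
    have G_int: "integrable P G"
      unfolding G_def using N_bd[OF t] N_bd[OF zero] by (intro ae_bounded_integrable) auto
    \<comment> \<open>On \<open>A c\<close> no increment is cut and the transform telescopes to the
      total increment; elsewhere \<open>G\<close> is 0.\<close>
    have "expectation G \<le> expectation (S n)" if n: "0 < n" for n
    proof -
      have "expectation G \<le> expectation (\<lambda>\<omega>. (R n n \<omega>)\<^sup>2)"
      proof (rule integral_mono)
        show "integrable P (\<lambda>\<omega>. (R n n \<omega>)\<^sup>2)"
          using R_meas[of n n] R_bd[of n n] by (intro ae_bounded_integrable) auto
        fix \<omega> assume "\<omega> \<in> space P"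
        show "G \<omega> \<le> (R n n \<omega>)\<^sup>2"
        proof (cases "\<omega> \<in> A c")
          case True
          have "v n i \<omega> \<le> c" if "i < n" for i
          proof -
            have "v n i \<omega> \<le> v n n \<omega>" unfolding v_def using that by (intro sum_mono2) auto
            then show ?thesis using True by (auto simp: A_def intro: order_trans)
          qed
          then have "R n n \<omega> = (\<Sum>i<n. d n i \<omega>)" unfolding R_def by (intro sum.cong) auto
          also have "\<dots> = N t \<omega> - N 0 \<omega>"
            unfolding d_def using sum_telescope_grid[OF n, of "\<lambda>t. N t \<omega>" 0 t] .
          finally show ?thesis by (simp add: G_def indicator_def)
        qed (simp add: G_def)
      qed (rule G_int)
      also have "\<dots> = expectation (S n)" unfolding S_def by (rule ER) simp
      finally show ?thesis .
    qed
    then have "expectation G \<le> 0"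
      by (intro LIMSEQ_le_const[OF lim]) (auto intro!: exI[of _ 1])
    then have "expectation G = 0" by (intro antisym integral_nonneg_AE) (auto simp: G_def)
    then have "AE \<omega> in P. G \<omega> = 0"
      using G_int by (subst (asm) integral_nonneg_eq_0_iff_AE) (auto simp: G_def)
    then show ?thesis
      by (auto simp: G_def c_def elim!: eventually_mono)
  qed
  have "AE \<omega> in P. \<forall>k. \<omega> \<in> A (real k) \<longrightarrow> N t \<omega> = N 0 \<omega>"
    unfolding AE_all_countable using on_A by blast
  with N_variation AE_space show ?thesis
  proof eventually_elim
    case (elim \<omega>)
    then obtain c where "\<forall>n. v n n \<omega> \<le> c" by (auto simp: v_def d_def)
    moreover obtain k where "c \<le> real k" using real_arch_simple by blast
    ultimately have "\<omega> \<in> A (real k)" using elim(2) by (auto simp: A_def intro: order_trans)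
    with elim(3) show ?case by blast
  qed
qed

end

section \<open>Optional stopping\<close>

lemma floor_approx_tendsto: "(\<lambda>k. real_of_int \<lfloor>real (Suc k) * y\<rfloor> / real (Suc k)) \<longlonglongrightarrow> y"
proof (rule tendsto_sandwich)
  show "\<forall>\<^sub>F k in sequentially. y - 1 / real (Suc k) \<le> real_of_int \<lfloor>real (Suc k) * y\<rfloor> / real (Suc k)"
  proof (rule always_eventually, rule allI)
    fix k
    have "real (Suc k) * y - 1 \<le> real_of_int \<lfloor>real (Suc k) * y\<rfloor>" by linarith
    then have "(real (Suc k) * y - 1) / real (Suc k) \<le> real_of_int \<lfloor>real (Suc k) * y\<rfloor> / real (Suc k)"
      by (intro divide_right_mono) auto
    then show "y - 1 / real (Suc k) \<le> real_of_int \<lfloor>real (Suc k) * y\<rfloor> / real (Suc k)"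
      by (simp add: diff_divide_distrib)
  qed
  show "\<forall>\<^sub>F k in sequentially. real_of_int \<lfloor>real (Suc k) * y\<rfloor> / real (Suc k) \<le> y"
  proof (rule always_eventually, rule allI)
    fix k
    have "real_of_int \<lfloor>real (Suc k) * y\<rfloor> / real (Suc k) \<le> (real (Suc k) * y) / real (Suc k)"
      by (intro divide_right_mono) auto
    then show "real_of_int \<lfloor>real (Suc k) * y\<rfloor> / real (Suc k) \<le> y" by simp
  qed
  have "(\<lambda>k. 1 / real (Suc k)) \<longlonglongrightarrow> 0" by (rule lim_1_over_n[THEN LIMSEQ_Suc])
  from tendsto_diff[OF tendsto_const this, of y]
  show "(\<lambda>k. y - 1 / real (Suc k)) \<longlonglongrightarrow> y" by simp
qed simp

text \<open>Rounding the random time down to multiples of 1/(k+1) leaves countably many values, so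
  measurability reduces to fixed times, and path continuity gives the limit. Rounding down also
  keeps the times below \<open>t\<close>, within the information available there.\<close>

lemma borel_measurable_at_random_time:
  fixes Y :: "real \<Rightarrow> 'a \<Rightarrow> real"
  assumes q: "q \<in> borel_measurable N" "\<And>\<omega>. \<omega> \<in> space N \<Longrightarrow> 0 \<le> q \<omega> \<and> q \<omega> \<le> t"
    and Y: "\<And>u. 0 \<le> u \<Longrightarrow> u \<le> t \<Longrightarrow> Y u \<in> borel_measurable N"
    and cont: "\<And>\<omega>. \<omega> \<in> space N \<Longrightarrow> continuous_on {0..t} (\<lambda>u. Y u \<omega>)"
  shows "(\<lambda>\<omega>. Y (q \<omega>) \<omega>) \<in> borel_measurable N"
proof (rule borel_measurable_LIMSEQ_real)
  define p where "p k \<omega> = \<lfloor>real (Suc k) * q \<omega>\<rfloor>" for k \<omega>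
  \<comment> \<open>The default 0 makes \<open>Y' k i\<close> measurable for every integer
    \<open>i\<close>. On \<open>space N\<close> the rounded time lies in \<open>[0, t]\<close>, so
    the default is never taken.\<close>
  define Y' where "Y' k i \<omega> = (let u = real_of_int i / real (Suc k) in if 0 \<le> u \<and> u \<le> t then Y u \<omega> else 0)" for k i \<omega>
  show "(\<lambda>\<omega>. Y' k (p k \<omega>) \<omega>) \<in> borel_measurable N" for k
  proof (rule measurable_compose_countable)
    show "Y' k i \<in> borel_measurable N" for i
      unfolding Y'_def Let_def by (cases "0 \<le> real_of_int i / real (Suc k) \<and> real_of_int i / real (Suc k) \<le> t") (auto intro: Y)
    note [measurable] = q(1)
    show "p k \<in> N \<rightarrow>\<^sub>M count_space UNIV" unfolding p_def by measurable
  qed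
  fix \<omega> assume \<omega>: "\<omega> \<in> space N"
  have lim: "(\<lambda>k. real_of_int (p k \<omega>) / real (Suc k)) \<longlonglongrightarrow> q \<omega>"
    unfolding p_def by (rule floor_approx_tendsto)
  have in_t: "0 \<le> real_of_int (p k \<omega>) / real (Suc k) \<and> real_of_int (p k \<omega>) / real (Suc k) \<le> t" for k
  proof
    show "0 \<le> real_of_int (p k \<omega>) / real (Suc k)" using q(2)[OF \<omega>] by (auto simp: p_def)
    have "real_of_int (p k \<omega>) / real (Suc k) \<le> (real (Suc k) * q \<omega>) / real (Suc k)"
      unfolding p_def by (intro divide_right_mono) auto
    also have "\<dots> = q \<omega>" by simp
    finally show "real_of_int (p k \<omega>) / real (Suc k) \<le> t" using q(2)[OF \<omega>] by simp
  qed
  have "(\<lambda>k. Y (real_of_int (p k \<omega>) / real (Suc k)) \<omega>) \<longlonglongrightarrow> Y (q \<omega>) \<omega>"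
    using in_t q(2)[OF \<omega>] by (intro continuous_on_tendsto_compose[OF cont[OF \<omega>] lim]) auto
  then show "(\<lambda>k. Y' k (p k \<omega>) \<omega>) \<longlonglongrightarrow> Y (q \<omega>) \<omega>"
    unfolding Y'_def Let_def using in_t by simp
qed

context filtered_prob
begin

lemma space_F: "0 \<le> t \<Longrightarrow> t \<le> T \<Longrightarrow> space (F t) = space P"
  using subalgebra_F by (auto simp: subalgebra_def)

text \<open>Only levels \<open>y\<close> in \<open>[0, t)\<close> carry information, and there the
  event is known at the earlier time \<open>y\<close>. Negative levels give the empty event, levels
  from \<open>t\<close> on the whole space.\<close>

lemma stopped_time_measurable:
  assumes \<sigma>: "\<And>u. 0 \<le> u \<Longrightarrow> u \<le> T \<Longrightarrow> Measurable.pred (F u) (\<lambda>\<omega>. \<sigma> \<omega> \<le> u)"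
      "\<And>\<omega>. \<omega> \<in> space P \<Longrightarrow> 0 \<le> \<sigma> \<omega>"
    and t: "0 \<le> t" "t \<le> T"
  shows "(\<lambda>\<omega>. min t (\<sigma> \<omega>)) \<in> borel_measurable (F t)"
proof (rule borel_measurableI_le)
  fix y
  show "{\<omega> \<in> space (F t). min t (\<sigma> \<omega>) \<le> y} \<in> sets (F t)"
  proof (cases "0 \<le> y \<and> y < t")
    case True
    then have "{\<omega> \<in> space (F t). min t (\<sigma> \<omega>) \<le> y} = {\<omega> \<in> space (F y). \<sigma> \<omega> \<le> y}"
      using t by (auto simp: space_F min_le_iff_disj)
    also have "\<dots> \<in> sets (F y)" using True t by (intro predE \<sigma>) auto
    finally show ?thesis using F_mono[of y t] True t by auto
  next
    case False
    have "{\<omega> \<in> space (F t). min t (\<sigma> \<omega>) \<le> y} = (if y < 0 then {} else space (F t))"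
    proof (cases "y < 0")
      case True
      then show ?thesis using \<sigma>(2) t by (fastforce simp: space_F)
    next
      case y: False
      then show ?thesis using False by (auto simp: min_le_iff_disj)
    qed
    then show ?thesis by auto
  qed
qed

lemma stopped_process_measurable:
  fixes N :: "real \<Rightarrow> 'a \<Rightarrow> real"
  assumes \<sigma>: "\<And>u. 0 \<le> u \<Longrightarrow> u \<le> T \<Longrightarrow> Measurable.pred (F u) (\<lambda>\<omega>. \<sigma> \<omega> \<le> u)"
      "\<And>\<omega>. \<omega> \<in> space P \<Longrightarrow> 0 \<le> \<sigma> \<omega>"
    and t: "0 \<le> t" "t \<le> T"
    and N: "\<And>u. 0 \<le> u \<Longrightarrow> u \<le> T \<Longrightarrow> N u \<in> borel_measurable (F u)"
    and cont: "\<And>\<omega>. \<omega> \<in> space P \<Longrightarrow> continuous_on {0..T} (\<lambda>u. N u \<omega>)"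
  shows "(\<lambda>\<omega>. N (min t (\<sigma> \<omega>)) \<omega>) \<in> borel_measurable (F t)"
proof (rule borel_measurable_at_random_time[where t = t and Y = N and q = "\<lambda>\<omega>. min t (\<sigma> \<omega>)"])
  show "(\<lambda>\<omega>. min t (\<sigma> \<omega>)) \<in> borel_measurable (F t)" by (rule stopped_time_measurable[OF \<sigma> t])
  show "0 \<le> min t (\<sigma> \<omega>) \<and> min t (\<sigma> \<omega>) \<le> t" if "\<omega> \<in> space (F t)" for \<omega>
    using \<sigma>(2) that t by (simp add: space_F)
  show "N u \<in> borel_measurable (F t)" if "0 \<le> u" "u \<le> t" for u
    using that t by (intro F_measurable_mono[OF N]) auto
  show "continuous_on {0..t} (\<lambda>u. N u \<omega>)" if "\<omega> \<in> space (F t)" for \<omega>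
    using that t by (intro continuous_on_subset[OF cont]) (auto simp: space_F)
qed

text \<open>The stopping time is approximated from above by grid times. Truncating the stopped values
  inside the multiplier makes both sides of the optional stopping identity converge dominatedly, so
  that no uniform integrability is needed.\<close>

theorem optional_stopping_bounded:
  fixes N :: "real \<Rightarrow> 'a \<Rightarrow> real"
  assumes N_adapted: "\<And>t. 0 \<le> t \<Longrightarrow> t \<le> T \<Longrightarrow> N t \<in> borel_measurable (F t)"
    and N_integrable: "\<And>t. 0 \<le> t \<Longrightarrow> t \<le> T \<Longrightarrow> integrable P (N t)"
    and N_continuous: "\<And>\<omega>. \<omega> \<in> space P \<Longrightarrow> continuous_on {0..T} (\<lambda>u. N u \<omega>)"
    and N_centered: "centered N"
    and \<sigma>: "\<And>u. 0 \<le> u \<Longrightarrow> u \<le> T \<Longrightarrow> Measurable.pred (F u) (\<lambda>\<omega>. \<sigma> \<omega> \<le> u)"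
      "\<And>\<omega>. \<omega> \<in> space P \<Longrightarrow> 0 \<le> \<sigma> \<omega>"
    and stopped_bounded: "AE \<omega> in P. \<forall>t\<in>{0..T}. \<bar>N (min t (\<sigma> \<omega>)) \<omega>\<bar> \<le> c"
  shows "centered (\<lambda>t \<omega>. N (min t (\<sigma> \<omega>)) \<omega>)"
  unfolding centered_def
proof safe
  fix s t :: real and Z :: "'a \<Rightarrow> real"
  assume st: "0 \<le> s" "s \<le> t" "t \<le> T" and Z: "Z \<in> borel_measurable (F s)" "ae_bounded Z"
  have s: "0 \<le> s" "s \<le> T" and t: "0 \<le> t" "t \<le> T" using st by auto
  obtain cZ where cZ: "AE \<omega> in P. \<bar>Z \<omega>\<bar> \<le> cZ" using Z(2) by (auto simp: ae_bounded_def)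
  have c_nonneg: "0 \<le> c"
  proof -
    have "AE \<omega> in P. 0 \<le> c"
      using stopped_bounded by eventually_elim (use s in \<open>auto intro: order_trans[OF abs_ge_zero]\<close>)
    then show ?thesis by simp
  qed
  have N_meas: "N u \<in> borel_measurable P" if "0 \<le> u" "u \<le> T" for u
    using N_adapted F_measurable_P that by blast
  define NS where "NS u \<omega> = N (min u (\<sigma> \<omega>)) \<omega>" for u \<omega>
  have NS_meas: "NS u \<in> borel_measurable P" if "0 \<le> u" "u \<le> T" for u
    unfolding NS_def using stopped_process_measurable[OF \<sigma> that N_adapted N_continuous] that F_measurable_P by blast
  \<comment> \<open>On \<open>\<sigma> \<le> s\<close> the stopped increment vanishes, so the
    multiplier may be restricted to \<open>s < \<sigma>\<close>, an event known at
    \<open>s\<close>.\<close>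
  define W where "W \<omega> = Z \<omega> * of_bool (s < \<sigma> \<omega>)" for \<omega>
  have not_le: "Measurable.pred (F u) (\<lambda>\<omega>. u < \<sigma> \<omega>)" if "0 \<le> u" "u \<le> T" for u
    unfolding not_le[symmetric] by (intro pred_intros_logic \<sigma> that)
  have W_ad: "W \<in> borel_measurable (F s)"
  proof -
    note [measurable] = not_le[OF s] Z(1)
    show ?thesis unfolding W_def of_bool_def by measurable
  qed
  have W_bd: "ae_bounded W" unfolding W_def using Z(2) by auto
  have W_cZ: "AE \<omega> in P. \<bar>W \<omega>\<bar> \<le> cZ"
    using cZ by eventually_elim (auto simp: W_def)
  have W_meas [measurable]: "W \<in> borel_measurable P" using W_ad F_measurable_P s by blast
  note [measurable] = N_meas[OF s] N_meas[OF t] NS_meas[OF s] NS_meas[OF t] F_measurable_P[OF Z(1) s]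
  define u where "u n i = grid s t n i" for n i
  have u_in: "0 \<le> u n i" "u n i \<le> T" "s \<le> u n i" "u n i \<le> t" if "i \<le> n" for n i
    using that st grid_ge[of s t n i] grid_le[of s t i n] by (auto simp: u_def)
  \<comment> \<open>Selects the cell that contains \<open>\<sigma>\<close>; the last cell also takes
    every \<open>\<sigma>\<close> beyond \<open>t\<close>. The event is known at the right end
    point, and that is where the process is sampled.\<close>
  define H where "H n i \<omega> \<longleftrightarrow> u n i < \<sigma> \<omega> \<and> (\<sigma> \<omega> \<le> u n (Suc i) \<or> Suc i = n)" for n i \<omega>
  have H_ad: "Measurable.pred (F (u n (Suc i))) (H n i)" if "i < n" for n i
  proof -
    have "u n i \<le> u n (Suc i)" unfolding u_def using st by (intro grid_mono) auto
    then have [measurable]: "Measurable.pred (F (u n (Suc i))) (\<lambda>\<omega>. u n i < \<sigma> \<omega>)"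
      using not_le[of "u n i"] u_in[of i n] u_in[of "Suc i" n] that F_mono[of "u n i" "u n (Suc i)"]
      by (auto simp: Measurable.pred_def space_F)
    have [measurable]: "Measurable.pred (F (u n (Suc i))) (\<lambda>\<omega>. \<sigma> \<omega> \<le> u n (Suc i))"
      using u_in[of "Suc i" n] that by (intro \<sigma>) auto
    show ?thesis unfolding H_def by measurable
  qed
  \<comment> \<open>The level \<open>c + 1\<close> leaves room above the bound \<open>c\<close> of
    the stopped value: once the sampled value is within 1 of it, the truncation is inactive.\<close>
  define V where "V n i \<omega> = (of_bool (H n i \<omega>) * of_bool (\<bar>N (u n (Suc i)) \<omega>\<bar> \<le> c + 1) :: real)" for n i \<omega>
  have V_ad: "V n i \<in> borel_measurable (F (u n (Suc i)))" if "i < n" for n i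
  proof -
    note [measurable] = H_ad[OF that]
    have [measurable]: "N (u n (Suc i)) \<in> borel_measurable (F (u n (Suc i)))"
      using u_in[of "Suc i" n] that by (intro N_adapted) auto
    show ?thesis unfolding V_def of_bool_def by measurable
  qed
  have V_meas: "V n i \<in> borel_measurable P" if "i < n" for n i
    using V_ad[OF that] u_in[of "Suc i" n] that F_measurable_P by (metis Suc_leI)
  have V_bd: "ae_bounded (V n i)" for n i unfolding V_def by auto
  define Zn where "Zn n \<omega> = (\<Sum>i<n. V n i \<omega>)" for n \<omega>
  define D where "D n \<omega> = (\<Sum>i<n. V n i \<omega> * N (u n (Suc i)) \<omega>)" for n \<omega>
  have Zn_meas [measurable]: "Zn n \<in> borel_measurable P" for n
    unfolding Zn_def using V_meas by auto
  have D_meas [measurable]: "D n \<in> borel_measurable P" for n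
    unfolding D_def using V_meas u_in by (auto intro!: borel_measurable_sum borel_measurable_times N_meas)
  have H_sum: "(\<Sum>i<n. of_bool (H n i \<omega>)) = (1 :: real)" if "0 < n" "s < \<sigma> \<omega>" for n \<omega>
  proof -
    \<comment> \<open>Excluding \<open>i = n\<close> forces \<open>g n = 0\<close>, which sends all
      remaining mass to the last cell, so the selectors telescope to 1.\<close>
    define g where "g i = (of_bool (u n i < \<sigma> \<omega> \<and> i \<noteq> n) :: real)" for i
    have "(\<Sum>i<n. of_bool (H n i \<omega>)) = (\<Sum>i<n. g i - g (Suc i))"
    proof (rule sum.cong[OF refl])
      fix i assume "i \<in> {..<n}"
      moreover have "u n i \<le> u n (Suc i)" unfolding u_def using st by (intro grid_mono) auto
      ultimately show "of_bool (H n i \<omega>) = g i - g (Suc i)" by (auto simp: H_def g_def)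
    qed
    also have "\<dots> = g 0 - g n" by (rule sum_lessThan_telescope')
    also have "\<dots> = 1" using that by (simp add: g_def u_def)
    finally show ?thesis .
  qed
  have H_close: "\<bar>u n (Suc i) - min t (\<sigma> \<omega>)\<bar> \<le> (t - s) / real n" if "i < n" "H n i \<omega>" for n i \<omega>
    using that u_in[of "Suc i" n] grid_step[of s t n i] st
    by (auto simp: H_def u_def min_def split: if_splits)
  have H_near: "\<forall>\<^sub>F n in sequentially. \<forall>i<n. H n i \<omega> \<longrightarrow> \<bar>N (u n (Suc i)) \<omega> - NS t \<omega>\<bar> < e"
    if \<omega>: "\<omega> \<in> space P" and e: "e > 0" for \<omega> e
  proof -
    have "0 \<le> min t (\<sigma> \<omega>)" "min t (\<sigma> \<omega>) \<le> T" using \<sigma>(2)[OF \<omega>] t by auto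
    then obtain d where d: "d > 0" "\<And>v. v \<in> {0..T} \<Longrightarrow> dist v (min t (\<sigma> \<omega>)) < d \<Longrightarrow> dist (N v \<omega>) (N (min t (\<sigma> \<omega>)) \<omega>) < e"
      using N_continuous[OF \<omega>] e unfolding continuous_on_iff by (metis atLeastAtMost_iff)
    have "(\<lambda>n. (t - s) / real n) \<longlonglongrightarrow> 0" by real_asymp
    then have "\<forall>\<^sub>F n in sequentially. (t - s) / real n < d" using d(1) by (rule order_tendstoD(2))
    then show ?thesis
    proof eventually_elim
      case (elim n)
      show ?case
      proof safe
        fix i assume i: "i < n" "H n i \<omega>"
        then have "dist (u n (Suc i)) (min t (\<sigma> \<omega>)) < d"
          using H_close[OF i] elim by (simp add: dist_real_def)
        then show "\<bar>N (u n (Suc i)) \<omega> - NS t \<omega>\<bar> < e"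
          using d(2)[of "u n (Suc i)"] u_in[of "Suc i" n] i by (simp add: dist_real_def NS_def)
      qed
    qed
  qed
  have V_sum_le: "(\<Sum>i<n. \<bar>V n i \<omega>\<bar>) \<le> 1" if "s < \<sigma> \<omega>" for n \<omega>
  proof (cases "n = 0")
    case False
    have "(\<Sum>i<n. \<bar>V n i \<omega>\<bar>) \<le> (\<Sum>i<n. of_bool (H n i \<omega>))" by (intro sum_mono) (auto simp: V_def)
    with H_sum[of n \<omega>] that False show ?thesis by simp
  qed simp
  \<comment> \<open>The multiplier \<open>W * V n i\<close> is known at the right end point of the
    cell, so the martingale property exchanges \<open>N t\<close> for the sampled value, with the
    same truncation on both sides.\<close>
  have key: "expectation (\<lambda>\<omega>. W \<omega> * Zn n \<omega> * N t \<omega>) = expectation (\<lambda>\<omega>. W \<omega> * D n \<omega>)" for n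
  proof -
    have 0: "expectation (\<lambda>\<omega>. (W \<omega> * V n i \<omega>) * (N t \<omega> - N (u n (Suc i)) \<omega>)) = 0" if "i < n" for i
      using that u_in[of "Suc i" n] V_bd[of n i] W_bd t s
      by (intro centeredD[OF N_centered] borel_measurable_times V_ad F_measurable_mono[OF W_ad]) auto
    have int: "integrable P (\<lambda>\<omega>. (W \<omega> * V n i \<omega>) * N v \<omega>)" if "i < n" "0 \<le> v" "v \<le> T" for i v
    proof -
      obtain b where b: "AE \<omega> in P. \<bar>W \<omega> * V n i \<omega>\<bar> \<le> b"
        using ae_bounded_mult[OF W_bd V_bd[of n i]] by (auto simp: ae_bounded_def)
      have [measurable]: "V n i \<in> borel_measurable P" "N v \<in> borel_measurable P"
        using that by (auto intro!: V_meas N_meas)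
      have "integrable P (\<lambda>\<omega>. b * \<bar>N v \<omega>\<bar>)" using N_integrable that by simp
      then show ?thesis
      proof (rule Bochner_Integration.integrable_bound)
        show "AE \<omega> in P. norm ((W \<omega> * V n i \<omega>) * N v \<omega>) \<le> norm (b * \<bar>N v \<omega>\<bar>)"
          using b
        proof eventually_elim
          case (elim \<omega>)
          have "\<bar>W \<omega> * V n i \<omega>\<bar> * \<bar>N v \<omega>\<bar> \<le> b * \<bar>N v \<omega>\<bar>" using elim by (rule mult_right_mono) simp
          also have "\<dots> \<le> \<bar>b * \<bar>N v \<omega>\<bar>\<bar>" by simp
          finally show ?case by (simp only: real_norm_def abs_mult)
        qed
      qed measurable
    qed
    have "expectation (\<lambda>\<omega>. W \<omega> * Zn n \<omega> * N t \<omega>) - expectation (\<lambda>\<omega>. W \<omega> * D n \<omega>)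
        = expectation (\<lambda>\<omega>. \<Sum>i<n. (W \<omega> * V n i \<omega>) * N t \<omega>) - expectation (\<lambda>\<omega>. \<Sum>i<n. (W \<omega> * V n i \<omega>) * N (u n (Suc i)) \<omega>)"
      by (simp add: Zn_def D_def sum_distrib_left sum_distrib_right mult.assoc)
    also have "\<dots> = (\<Sum>i<n. expectation (\<lambda>\<omega>. (W \<omega> * V n i \<omega>) * N t \<omega>)) - (\<Sum>i<n. expectation (\<lambda>\<omega>. (W \<omega> * V n i \<omega>) * N (u n (Suc i)) \<omega>))"
      using int t u_in by (subst (1 2) Bochner_Integration.integral_sum) auto
    also have "\<dots> = (\<Sum>i<n. expectation (\<lambda>\<omega>. (W \<omega> * V n i \<omega>) * (N t \<omega> - N (u n (Suc i)) \<omega>)))"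
      unfolding sum_subtractf[symmetric] right_diff_distrib
      using int t u_in by (intro sum.cong refl Bochner_Integration.integral_diff[symmetric]) auto
    also have "\<dots> = 0" using 0 by simp
    finally show ?thesis by simp
  qed
  have lim1: "(\<lambda>n. expectation (\<lambda>\<omega>. W \<omega> * Zn n \<omega> * N t \<omega>)) \<longlonglongrightarrow> expectation (\<lambda>\<omega>. W \<omega> * N t \<omega>)"
  proof (rule integral_dominated_convergence[where w = "\<lambda>\<omega>. cZ * \<bar>N t \<omega>\<bar>"])
    show "integrable P (\<lambda>\<omega>. cZ * \<bar>N t \<omega>\<bar>)" using N_integrable t by simp
    show "AE \<omega> in P. (\<lambda>n. W \<omega> * Zn n \<omega> * N t \<omega>) \<longlonglongrightarrow> W \<omega> * N t \<omega>"
      using stopped_bounded AE_space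
    proof eventually_elim
      case (elim \<omega>)
      show ?case
      proof (cases "s < \<sigma> \<omega>")
        case True
        have "\<forall>\<^sub>F n in sequentially. Zn n \<omega> = 1"
          using H_near[OF elim(2) zero_less_one] eventually_gt_at_top[of 0]
        proof eventually_elim
          case n: (elim n)
          have "\<bar>NS t \<omega>\<bar> \<le> c" using elim(1) t by (auto simp: NS_def)
          then have "V n i \<omega> = of_bool (H n i \<omega>)" if "i < n" for i
            using n(1)[rule_format, OF that] by (auto simp: V_def)
          then show ?case using H_sum[OF n(2) True] by (simp add: Zn_def)
        qed
        then have "(\<lambda>n. Zn n \<omega>) \<longlonglongrightarrow> 1" by (rule tendsto_eventually)
        then have "(\<lambda>n. W \<omega> * Zn n \<omega> * N t \<omega>) \<longlonglongrightarrow> W \<omega> * 1 * N t \<omega>" by (intro tendsto_intros)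
        then show ?thesis by simp
      qed (simp add: W_def)
    qed
    show "AE \<omega> in P. norm (W \<omega> * Zn n \<omega> * N t \<omega>) \<le> cZ * \<bar>N t \<omega>\<bar>" for n
      using W_cZ
    proof eventually_elim
      case (elim \<omega>)
      have "\<bar>W \<omega> * Zn n \<omega>\<bar> \<le> cZ"
      proof (cases "s < \<sigma> \<omega>")
        case True
        have "\<bar>Zn n \<omega>\<bar> \<le> 1" unfolding Zn_def by (rule order_trans[OF sum_abs V_sum_le[OF True]])
        then have "\<bar>W \<omega>\<bar> * \<bar>Zn n \<omega>\<bar> \<le> cZ * 1" using elim by (intro mult_mono) auto
        then show ?thesis by (simp add: abs_mult)
      qed (use elim in \<open>simp add: W_def\<close>)
      then show ?case unfolding real_norm_def abs_mult[of "W \<omega> * Zn n \<omega>"] by (rule mult_right_mono) simp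
    qed
  qed measurable
  have lim2: "(\<lambda>n. expectation (\<lambda>\<omega>. W \<omega> * D n \<omega>)) \<longlonglongrightarrow> expectation (\<lambda>\<omega>. W \<omega> * NS t \<omega>)"
  proof (rule integral_dominated_convergence[where w = "\<lambda>\<omega>. cZ * (c + 1)"])
    show "AE \<omega> in P. (\<lambda>n. W \<omega> * D n \<omega>) \<longlonglongrightarrow> W \<omega> * NS t \<omega>"
      using stopped_bounded AE_space
    proof eventually_elim
      case (elim \<omega>)
      show ?case
      proof (cases "s < \<sigma> \<omega>")
        case True
        have "(\<lambda>n. D n \<omega>) \<longlonglongrightarrow> NS t \<omega>"
        proof (rule LIMSEQ_I)
          fix e :: real assume e: "e > 0"
          define e' where "e' = min 1 (e / 2)"
          have e': "0 < e'" "e' \<le> 1" "e' < e" using e by (auto simp: e'_def)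
          have "\<forall>\<^sub>F n in sequentially. norm (D n \<omega> - NS t \<omega>) < e"
            using H_near[OF elim(2) e'(1)] eventually_gt_at_top[of 0]
          proof eventually_elim
            case n: (elim n)
            have "\<bar>NS t \<omega>\<bar> \<le> c" using elim(1) t by (auto simp: NS_def)
            then have V: "V n i \<omega> = of_bool (H n i \<omega>)" if "i < n" for i
              using n(1)[rule_format, OF that] e' by (auto simp: V_def)
            have "D n \<omega> - NS t \<omega> = (\<Sum>i<n. of_bool (H n i \<omega>) * N (u n (Suc i)) \<omega>) - (\<Sum>i<n. of_bool (H n i \<omega>)) * NS t \<omega>"
            proof -
              have "D n \<omega> = (\<Sum>i<n. of_bool (H n i \<omega>) * N (u n (Suc i)) \<omega>)"
                unfolding D_def by (intro sum.cong refl) (simp only: V lessThan_iff)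
              then show ?thesis unfolding H_sum[OF n(2) True] by simp
            qed
            also have "\<dots> = (\<Sum>i<n. of_bool (H n i \<omega>) * (N (u n (Suc i)) \<omega> - NS t \<omega>))"
              by (simp only: sum_distrib_right sum_subtractf right_diff_distrib)
            finally have "norm (D n \<omega> - NS t \<omega>) \<le> (\<Sum>i<n. norm (of_bool (H n i \<omega>) * (N (u n (Suc i)) \<omega> - NS t \<omega>)))"
              using norm_sum by metis
            also have "\<dots> \<le> (\<Sum>i<n. of_bool (H n i \<omega>) * e')"
            proof (rule sum_mono)
              fix i assume "i \<in> {..<n}"
              then show "norm (of_bool (H n i \<omega>) * (N (u n (Suc i)) \<omega> - NS t \<omega>)) \<le> of_bool (H n i \<omega>) * e'"
                using n(1)[rule_format, of i] by (cases "H n i \<omega>") auto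
            qed
            also have "\<dots> = e'" unfolding sum_distrib_right[symmetric] H_sum[OF n(2) True] by simp
            finally show ?case using e'(3) by simp
          qed
          then show "\<exists>no. \<forall>n\<ge>no. norm (D n \<omega> - NS t \<omega>) < e" by (simp add: eventually_sequentially)
        qed
        then show ?thesis by (intro tendsto_intros)
      qed (simp add: W_def)
    qed
    show "AE \<omega> in P. norm (W \<omega> * D n \<omega>) \<le> cZ * (c + 1)" for n
      using W_cZ
    proof eventually_elim
      case (elim \<omega>)
      have cZ0: "0 \<le> cZ" using elim by (rule order_trans[OF abs_ge_zero])
      show ?case
      proof (cases "s < \<sigma> \<omega>")
        case True
        have "\<bar>D n \<omega>\<bar> \<le> (\<Sum>i<n. \<bar>V n i \<omega>\<bar> * (c + 1))"
          unfolding D_def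
        proof (rule order_trans[OF sum_abs], rule sum_mono)
          fix i assume "i \<in> {..<n}"
          show "\<bar>V n i \<omega> * N (u n (Suc i)) \<omega>\<bar> \<le> \<bar>V n i \<omega>\<bar> * (c + 1)"
            using c_nonneg by (auto simp: V_def)
        qed
        also have "\<dots> = (\<Sum>i<n. \<bar>V n i \<omega>\<bar>) * (c + 1)" by (simp only: sum_distrib_right)
        also have "\<dots> \<le> 1 * (c + 1)" using V_sum_le[OF True] c_nonneg by (intro mult_right_mono) auto
        finally have "\<bar>D n \<omega>\<bar> \<le> c + 1" by simp
        then show ?thesis unfolding real_norm_def abs_mult using elim cZ0 by (intro mult_mono) auto
      qed (use cZ0 c_nonneg in \<open>simp add: W_def\<close>)
    qed
  qed auto
  \<comment> \<open>Optional stopping against \<open>W\<close>. The martingale property of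
    \<open>N\<close> then replaces \<open>N t\<close> by \<open>N s\<close>, which is the stopped
    value at \<open>s\<close> wherever \<open>s < \<sigma>\<close>.\<close>
  have "expectation (\<lambda>\<omega>. W \<omega> * N t \<omega>) = expectation (\<lambda>\<omega>. W \<omega> * NS t \<omega>)"
    using lim1 lim2 unfolding key by (rule LIMSEQ_unique)
  moreover have "expectation (\<lambda>\<omega>. W \<omega> * (N t \<omega> - N s \<omega>)) = 0"
    using st W_ad W_bd by (intro centeredD[OF N_centered])
  moreover have int_W: "integrable P (\<lambda>\<omega>. W \<omega> * N v \<omega>)" if "0 \<le> v" "v \<le> T" for v
  proof (rule Bochner_Integration.integrable_bound)
    show "integrable P (\<lambda>\<omega>. cZ * \<bar>N v \<omega>\<bar>)" using N_integrable that by simp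
    show "AE \<omega> in P. norm (W \<omega> * N v \<omega>) \<le> norm (cZ * \<bar>N v \<omega>\<bar>)"
      using W_cZ
    proof eventually_elim
      case (elim \<omega>)
      have "\<bar>W \<omega>\<bar> * \<bar>N v \<omega>\<bar> \<le> cZ * \<bar>N v \<omega>\<bar>" using elim by (rule mult_right_mono) simp
      also have "\<dots> \<le> \<bar>cZ * \<bar>N v \<omega>\<bar>\<bar>" by simp
      finally show ?case by (simp only: real_norm_def abs_mult)
    qed
    note [measurable] = N_meas[OF that]
    show "(\<lambda>\<omega>. W \<omega> * N v \<omega>) \<in> borel_measurable P" by measurable
  qed
  ultimately have E: "expectation (\<lambda>\<omega>. W \<omega> * NS t \<omega>) - expectation (\<lambda>\<omega>. W \<omega> * N s \<omega>) = 0"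
    using int_W[OF s] int_W[OF t] by (simp add: right_diff_distrib)
  have "ae_bounded (NS t)"
    by (rule ae_boundedI[of _ c]) (use stopped_bounded t in \<open>auto simp: NS_def elim!: eventually_mono\<close>)
  then have int_NS: "integrable P (\<lambda>\<omega>. W \<omega> * NS t \<omega>)"
    using W_bd by (intro ae_bounded_integrable) auto
  have "expectation (\<lambda>\<omega>. Z \<omega> * (NS t \<omega> - NS s \<omega>)) = expectation (\<lambda>\<omega>. W \<omega> * NS t \<omega> - W \<omega> * N s \<omega>)"
  proof (rule Bochner_Integration.integral_cong[OF refl])
    fix \<omega> assume "\<omega> \<in> space P"
    show "Z \<omega> * (NS t \<omega> - NS s \<omega>) = W \<omega> * NS t \<omega> - W \<omega> * N s \<omega>"
    proof (cases "s < \<sigma> \<omega>")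
      case False
      then have "min t (\<sigma> \<omega>) = \<sigma> \<omega>" "min s (\<sigma> \<omega>) = \<sigma> \<omega>" using st by auto
      then show ?thesis using False by (simp add: W_def NS_def)
    qed (simp add: W_def NS_def algebra_simps)
  qed
  also have "\<dots> = 0" using E int_NS int_W[OF s] by simp
  finally show "expectation (\<lambda>\<omega>. Z \<omega> * (N (min t (\<sigma> \<omega>)) \<omega> - N (min s (\<sigma> \<omega>)) \<omega>)) = 0"
    unfolding NS_def .
qed

text \<open>A bounded multiplier keeps the product integrable and can be pulled into the conditional
  expectation. With the converse below this links the definition of martingales to the tests by
  multipliers.\<close>

lemma real_cond_exp_imp_centered:
  assumes N: "\<And>t. 0 \<le> t \<Longrightarrow> t \<le> T \<Longrightarrow> N t \<in> borel_measurable (F t)"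
      "\<And>t. 0 \<le> t \<Longrightarrow> t \<le> T \<Longrightarrow> integrable P (N t)"
    and ce: "\<And>s t. 0 \<le> s \<Longrightarrow> s \<le> t \<Longrightarrow> t \<le> T \<Longrightarrow> AE \<omega> in P. real_cond_exp P (F s) (N t) \<omega> = N s \<omega>"
  shows "centered N"
  unfolding centered_def
proof safe
  fix s t :: real and Z :: "'a \<Rightarrow> real"
  assume st: "0 \<le> s" "s \<le> t" "t \<le> T" and Z: "Z \<in> borel_measurable (F s)" "ae_bounded Z"
  have s: "0 \<le> s" "s \<le> T" and t: "0 \<le> t" "t \<le> T" using st by auto
  interpret S: finite_measure_subalgebra P "F s"
    using subalgebra_F[OF s] by unfold_locales
  have [measurable]: "Z \<in> borel_measurable P" "N s \<in> borel_measurable P" "N t \<in> borel_measurable P"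
    using F_measurable_P Z N s t by blast+
  obtain cZ where cZ: "AE \<omega> in P. \<bar>Z \<omega>\<bar> \<le> cZ" using Z(2) by (auto simp: ae_bounded_def)
  have int: "integrable P (\<lambda>\<omega>. Z \<omega> * N v \<omega>)" if "0 \<le> v" "v \<le> T" for v
  proof (rule Bochner_Integration.integrable_bound)
    show "integrable P (\<lambda>\<omega>. cZ * \<bar>N v \<omega>\<bar>)" using N(2) that by simp
    show "AE \<omega> in P. norm (Z \<omega> * N v \<omega>) \<le> norm (cZ * \<bar>N v \<omega>\<bar>)"
      using cZ
    proof eventually_elim
      case (elim \<omega>)
      have "\<bar>Z \<omega>\<bar> * \<bar>N v \<omega>\<bar> \<le> cZ * \<bar>N v \<omega>\<bar>" using elim by (rule mult_right_mono) simp
      also have "\<dots> \<le> \<bar>cZ * \<bar>N v \<omega>\<bar>\<bar>" by simp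
      finally show ?case by (simp only: real_norm_def abs_mult)
    qed
    have [measurable]: "N v \<in> borel_measurable P" using F_measurable_P N that by blast
    show "(\<lambda>\<omega>. Z \<omega> * N v \<omega>) \<in> borel_measurable P" by measurable
  qed
  have "expectation (\<lambda>\<omega>. Z \<omega> * N t \<omega>) = expectation (\<lambda>\<omega>. Z \<omega> * real_cond_exp P (F s) (N t) \<omega>)"
    using int[OF t] Z(1) by (intro S.real_cond_exp_intg(2)[symmetric]) auto
  also have "\<dots> = expectation (\<lambda>\<omega>. Z \<omega> * N s \<omega>)"
    using ce[OF st] by (intro integral_cong_AE) (auto elim!: eventually_mono)
  finally show "expectation (\<lambda>\<omega>. Z \<omega> * (N t \<omega> - N s \<omega>)) = 0"
    using int[OF s] int[OF t] by (simp add: right_diff_distrib)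
qed

text \<open>Indicators of events known at \<open>s\<close> are bounded multipliers, and they
  characterize the conditional expectation.\<close>

lemma centered_imp_real_cond_exp:
  assumes N: "\<And>t. 0 \<le> t \<Longrightarrow> t \<le> T \<Longrightarrow> N t \<in> borel_measurable (F t)"
      "\<And>t. 0 \<le> t \<Longrightarrow> t \<le> T \<Longrightarrow> integrable P (N t)"
    and "centered N" and st: "0 \<le> s" "s \<le> t" "t \<le> T"
  shows "AE \<omega> in P. real_cond_exp P (F s) (N t) \<omega> = N s \<omega>"
proof -
  have s: "0 \<le> s" "s \<le> T" and t: "0 \<le> t" "t \<le> T" using st by auto
  interpret S: finite_measure_subalgebra P "F s"
    using subalgebra_F[OF s] by unfold_locales
  show ?thesis
  proof (rule S.real_cond_exp_charact)
    fix A assume A: "A \<in> sets (F s)"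
    then have A': "A \<in> sets P" using subalgebra_F[OF s] by (auto simp: subalgebra_def)
    have "expectation (\<lambda>\<omega>. indicator A \<omega> * (N t \<omega> - N s \<omega>)) = 0"
      using A st by (intro centeredD[OF \<open>centered N\<close>]) auto
    then show "(LINT \<omega>:A|P. N t \<omega>) = (LINT \<omega>:A|P. N s \<omega>)"
      using A' N(2)[OF s] N(2)[OF t]
      by (simp add: set_lebesgue_integral_def right_diff_distrib integrable_mult_indicator[where 'b = real, simplified])
  qed (use N s t in auto)
qed

end

section \<open>The path space\<close>

text \<open>The index is that of the grid point just below \<open>u\<close>. \<open>Suc n\<close>
  avoids the empty grid, and for \<open>t = 0\<close> the convention \<open>u / 0 = 0\<close> still
  gives the right point.\<close>

lemma grid_floor:
  assumes "0 \<le> u" "u \<le> t"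
  shows "nat \<lfloor>real (Suc n) * (u / t)\<rfloor> \<le> Suc n"
    and "(\<lambda>n. grid 0 t (Suc n) (nat \<lfloor>real (Suc n) * (u / t)\<rfloor>)) \<longlonglongrightarrow> u"
proof -
  have "u / t \<le> 1" using assms by (cases "t = 0") auto
  then have "real (Suc n) * (u / t) \<le> real (Suc n) * 1" by (intro mult_left_mono) auto
  then have "real (Suc n) * (u / t) \<le> real (Suc n)" by simp
  then show "nat \<lfloor>real (Suc n) * (u / t)\<rfloor> \<le> Suc n" by linarith
  have "(\<lambda>n. t * (real_of_int \<lfloor>real (Suc n) * (u / t)\<rfloor> / real (Suc n))) \<longlonglongrightarrow> u"
  proof (cases "t = 0")
    case False
    have "(\<lambda>n. t * (real_of_int \<lfloor>real (Suc n) * (u / t)\<rfloor> / real (Suc n))) \<longlonglongrightarrow> t * (u / t)"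
      by (intro tendsto_mult_left floor_approx_tendsto)
    then show ?thesis using False by simp
  qed (use assms in auto)
  then show "(\<lambda>n. grid 0 t (Suc n) (nat \<lfloor>real (Suc n) * (u / t)\<rfloor>)) \<longlonglongrightarrow> u"
    using assms by (simp add: grid_def)
qed

lemma path_continuous:
  assumes "\<omega> \<in> paths T"
  shows "continuous_on {0..T} \<omega>"
  using assms by (simp add: path_metric_def)

lemma space_path_borel: "space (path_borel T) = paths T"
  and sets_path_borel: "sets (path_borel T) = sigma_sets (paths T) {U. openin (mtopology_of (path_metric T)) U}"
proof -
  have "{U. openin (mtopology_of (path_metric T)) U} \<subseteq> Pow (paths T)"
    using openin_subset by fastforce
  then show "space (path_borel T) = paths T"
      "sets (path_borel T) = sigma_sets (paths T) {U. openin (mtopology_of (path_metric T)) U}"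
    by (simp_all add: path_borel_def)
qed

text \<open>Evaluation at a fixed time is 1-Lipschitz for the supremum metric, hence
  continuous.\<close>

lemma canonical_measurable_path_borel:
  assumes t: "t \<in> {0..T}"
  shows "canonical t \<in> borel_measurable (path_borel T)"
proof (rule borel_measurableI)
  fix S :: "real set" assume S: "open S"
  have "Lipschitz_continuous_map (path_metric T) euclidean_metric (canonical t)"
    unfolding Lipschitz_continuous_map_def
  proof (intro conjI exI[of _ 1] ballI)
    fix f g assume fg: "f \<in> paths T" "g \<in> paths T"
    show "mdist euclidean_metric (canonical t f) (canonical t g) \<le> 1 * mdist (path_metric T) f g"
      using mdist_cfunspace_imp_mdist_le[of f "top_of_set {0..T}" euclidean_metric g "mdist (path_metric T) f g" t]
        fg t by (simp add: path_metric_def canonical_def)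
  qed simp
  from Lipschitz_continuous_imp_continuous_map[OF this]
  have "continuous_map (mtopology_of (path_metric T)) euclidean (canonical t)" by simp
  then have "openin (mtopology_of (path_metric T)) {x \<in> paths T. canonical t x \<in> S}"
    using S by (simp add: continuous_map_def)
  moreover have "canonical t -` S \<inter> space (path_borel T) = {x \<in> paths T. canonical t x \<in> S}"
    by (auto simp: space_path_borel)
  ultimately show "canonical t -` S \<inter> space (path_borel T) \<in> sets (path_borel T)"
    by (auto simp: sets_path_borel)
qed

lemma raw_filtration_generators:
  "{canonical s -` A \<inter> paths T | s A. s \<in> {0..T} \<and> s \<le> t \<and> A \<in> sets borel} \<subseteq> Pow (paths T)"
  by auto

lemma space_raw_filtration [simp]: "space (raw_filtration T t) = paths T"
  unfolding raw_filtration_def by (rule space_measure_of[OF raw_filtration_generators])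

lemma sets_raw_filtration: "sets (raw_filtration T t) = sigma_sets (paths T)
    {canonical s -` A \<inter> paths T | s A. s \<in> {0..T} \<and> s \<le> t \<and> A \<in> sets borel}"
  unfolding raw_filtration_def by (rule sets_measure_of[OF raw_filtration_generators])

lemma raw_filtration_mono: "s \<le> t \<Longrightarrow> sets (raw_filtration T s) \<subseteq> sets (raw_filtration T t)"
  unfolding sets_raw_filtration by (intro sigma_sets_mono') fastforce

text \<open>Stopping times are tested at every real level; this settles the levels above
  \<open>T\<close>, where hitting times may also take a value.\<close>

lemma raw_filtration_beyond: "T \<le> t \<Longrightarrow> raw_filtration T t = raw_filtration T T"
  unfolding raw_filtration_def
  by (rule arg_cong[where f = "sigma (paths T)"]) fastforce

lemma raw_filtration_subset_path_borel: "sets (raw_filtration T t) \<subseteq> sets (path_borel T)"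
proof -
  have "canonical s -` A \<inter> paths T \<in> sets (path_borel T)" if "s \<in> {0..T}" "A \<in> sets borel" for s A
    using measurable_sets[OF canonical_measurable_path_borel[OF that(1)] that(2)] by (simp add: space_path_borel)
  then show ?thesis
    unfolding sets_raw_filtration space_path_borel[symmetric]
    by (intro sets.sigma_sets_subset) (auto simp: space_path_borel)
qed

lemma adapted_canonical: "adapted T canonical"
  unfolding adapted_def
proof (intro ballI measurableI)
  fix t A assume "t \<in> {0..T}" "A \<in> sets (borel :: real measure)"
  then show "canonical t -` A \<inter> space (raw_filtration T t) \<in> sets (raw_filtration T t)"
    unfolding sets_raw_filtration space_raw_filtration by (intro sigma_sets.Basic) auto
qed auto

lemma continuous_process_canonical: "continuous_process T canonical"
  unfolding continuous_process_def canonical_def using path_continuous by blast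

section \<open>The filtered path space: stopping, local martingales, hitting times\<close>

locale path_space =
  fixes T :: real and P :: "path measure"
  assumes T_pos: "0 < T" and path_law: "path_law T P"
begin

lemma sets_P: "sets P = sets (path_borel T)" and prob_space_P: "prob_space P"
  using path_law by (auto simp: path_law_def)

lemma space_P [simp]: "space P = paths T"
  using sets_eq_imp_space_eq[OF sets_P] by (simp add: space_path_borel)

sublocale filtered_prob P "raw_filtration T" T
proof -
  interpret prob_space P by (rule prob_space_P)
  show "filtered_prob P (raw_filtration T) T"
    using raw_filtration_subset_path_borel raw_filtration_mono
    by unfold_locales (auto simp: subalgebra_def sets_P)
qed

lemma adaptedD: "adapted T Y \<Longrightarrow> 0 \<le> t \<Longrightarrow> t \<le> T \<Longrightarrow> Y t \<in> borel_measurable (raw_filtration T t)"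
  by (simp add: adapted_def)

lemma continuous_processD: "continuous_process T Y \<Longrightarrow> \<omega> \<in> paths T \<Longrightarrow> continuous_on {0..T} (\<lambda>t. Y t \<omega>)"
  by (simp add: continuous_process_def)

lemma adapted_stopped:
  assumes "adapted T Y" "continuous_process T Y" "stopping_time (raw_filtration T) \<tau>" "\<And>\<omega>. \<omega> \<in> paths T \<Longrightarrow> 0 \<le> \<tau> \<omega>"
  shows "adapted T (\<lambda>t \<omega>. Y (min t (\<tau> \<omega>)) \<omega>)"
  unfolding adapted_def
proof
  fix t assume t: "t \<in> {0..T}"
  show "(\<lambda>\<omega>. Y (min t (\<tau> \<omega>)) \<omega>) \<in> borel_measurable (raw_filtration T t)"
  proof (rule stopped_process_measurable[where N = Y and \<sigma> = \<tau>])
    show "Measurable.pred (raw_filtration T u) (\<lambda>\<omega>. \<tau> \<omega> \<le> u)" for u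
      using assms(3) by (rule stopping_timeD)
    show "0 \<le> \<tau> \<omega>" if "\<omega> \<in> space P" for \<omega>
      using assms(4) that by simp
    show "Y u \<in> borel_measurable (raw_filtration T u)" if "0 \<le> u" "u \<le> T" for u
      by (rule adaptedD[OF assms(1) that])
    show "continuous_on {0..T} (\<lambda>u. Y u \<omega>)" if "\<omega> \<in> space P" for \<omega>
      using continuous_processD[OF assms(2)] that by simp
  qed (use t in auto)
qed

lemma continuous_process_stopped:
  assumes "continuous_process T Y" "\<And>\<omega>. \<omega> \<in> paths T \<Longrightarrow> 0 \<le> \<tau> \<omega>"
  shows "continuous_process T (\<lambda>t \<omega>. Y (min t (\<tau> \<omega>)) \<omega>)"
  unfolding continuous_process_def
proof
  fix \<omega> assume \<omega>: "\<omega> \<in> paths T"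
  show "continuous_on {0..T} (\<lambda>t. Y (min t (\<tau> \<omega>)) \<omega>)"
    using assms(2)[OF \<omega>] by (intro continuous_on_compose2[OF continuous_processD[OF assms(1) \<omega>]] continuous_intros) auto
qed

lemma martingale_centered: "is_martingale T P N \<Longrightarrow> centered N"
  unfolding is_martingale_def by (intro real_cond_exp_imp_centered) (auto simp: adapted_def)

text \<open>Stopping at \<open>\<rho> \<le> \<tau>\<close> amounts to stopping the
  \<open>\<tau>\<close>-stopped martingale once more, so bounded optional stopping applies. Thus a
  localizing sequence can be shortened until the stopped process is bounded.\<close>

lemma stopped_martingale_centered:
  assumes M: "continuous_process T M" and \<tau>: "is_martingale T P (\<lambda>t \<omega>. M (min t (\<tau> \<omega>)) \<omega>)" "\<And>\<omega>. \<omega> \<in> paths T \<Longrightarrow> 0 \<le> \<tau> \<omega>"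
    and \<rho>: "stopping_time (raw_filtration T) \<rho>" "\<And>\<omega>. \<omega> \<in> paths T \<Longrightarrow> 0 \<le> \<rho> \<omega> \<and> \<rho> \<omega> \<le> \<tau> \<omega>"
    and bd: "AE \<omega> in P. \<forall>t\<in>{0..T}. \<bar>M (min t (\<rho> \<omega>)) \<omega>\<bar> \<le> c"
  shows "centered (\<lambda>t \<omega>. M (min t (\<rho> \<omega>)) \<omega>)"
proof -
  let ?N = "\<lambda>t \<omega>. M (min t (\<tau> \<omega>)) \<omega>"
  have eq: "?N (min t (\<rho> \<omega>)) \<omega> = M (min t (\<rho> \<omega>)) \<omega>" if "\<omega> \<in> paths T" for t \<omega>
    using \<rho>(2)[OF that] by (simp add: min.assoc min.absorb1)
  have "centered (\<lambda>t \<omega>. ?N (min t (\<rho> \<omega>)) \<omega>)"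
  proof (rule optional_stopping_bounded)
    show "AE \<omega> in P. \<forall>t\<in>{0..T}. \<bar>?N (min t (\<rho> \<omega>)) \<omega>\<bar> \<le> c"
      using bd AE_space by eventually_elim (simp add: eq)
    show "continuous_on {0..T} (\<lambda>u. ?N u \<omega>)" if "\<omega> \<in> space P" for \<omega>
      using that by (intro continuous_processD[OF continuous_process_stopped[OF M \<tau>(2)]]) simp_all
    show "?N t \<in> borel_measurable (raw_filtration T t)" "integrable P (?N t)" if "0 \<le> t" "t \<le> T" for t
      using \<tau>(1) that by (simp_all add: is_martingale_def adapted_def)
    show "centered ?N" by (rule martingale_centered[OF \<tau>(1)])
    show "Measurable.pred (raw_filtration T u) (\<lambda>\<omega>. \<rho> \<omega> \<le> u)" for u
      using \<rho>(1) by (rule stopping_timeD)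
    show "0 \<le> \<rho> \<omega>" if "\<omega> \<in> space P" for \<omega>
      using \<rho>(2) that by simp
  qed
  moreover have "expectation (\<lambda>\<omega>. Z \<omega> * (?N (min t (\<rho> \<omega>)) \<omega> - ?N (min s (\<rho> \<omega>)) \<omega>))
      = expectation (\<lambda>\<omega>. Z \<omega> * (M (min t (\<rho> \<omega>)) \<omega> - M (min s (\<rho> \<omega>)) \<omega>))" for s t Z
    by (intro Bochner_Integration.integral_cong) (auto simp: eq)
  ultimately show ?thesis unfolding centered_def by simp
qed

text \<open>The way back from multiplier tests: boundedness at each time supplies integrability of
  the stopped process, and continuity of every path its adaptedness.\<close>

lemma is_local_martingaleI:
  assumes M: "adapted T M" "continuous_process T M"
    and \<rho>: "\<And>n. stopping_time (raw_filtration T) (\<rho> n)"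
      "\<And>n \<omega>. \<omega> \<in> paths T \<Longrightarrow> 0 \<le> \<rho> n \<omega> \<and> \<rho> n \<omega> \<le> \<rho> (Suc n) \<omega>"
      "AE \<omega> in P. \<exists>n. T \<le> \<rho> n \<omega>"
    and bd: "\<And>n t. 0 \<le> t \<Longrightarrow> t \<le> T \<Longrightarrow> ae_bounded (\<lambda>\<omega>. M (min t (\<rho> n \<omega>)) \<omega>)"
    and c: "\<And>n. centered (\<lambda>t \<omega>. M (min t (\<rho> n \<omega>)) \<omega>)"
  shows "is_local_martingale T P M"
proof -
  have "is_martingale T P (\<lambda>t \<omega>. M (min t (\<rho> n \<omega>)) \<omega>)" for n
  proof -
    let ?N = "\<lambda>t \<omega>. M (min t (\<rho> n \<omega>)) \<omega>"
    have ad: "adapted T ?N" using adapted_stopped[OF M \<rho>(1)] \<rho>(2) by blast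
    have int: "integrable P (?N t)" if "0 \<le> t" "t \<le> T" for t
      using adaptedD[OF ad that] that bd F_measurable_P by (intro ae_bounded_integrable) blast+
    have "AE \<omega> in P. real_cond_exp P (raw_filtration T s) (?N t) \<omega> = ?N s \<omega>" if "0 \<le> s" "s \<le> t" "t \<le> T" for s t
      using that by (intro centered_imp_real_cond_exp[OF adaptedD[OF ad] int c]) auto
    with ad int show ?thesis by (auto simp: is_martingale_def)
  qed
  with M \<rho> show ?thesis unfolding is_local_martingale_def by blast
qed

text \<open>\<open>T + 1\<close> stands for never. Lying strictly above \<open>T\<close>, it
  separates a level first reached at \<open>T\<close> from one never reached, and it counts as
  having passed the end point in a localizing sequence.\<close>

definition hitting_time :: "process \<Rightarrow> real \<Rightarrow> path \<Rightarrow> real" where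
  "hitting_time Y c \<omega> = (if \<exists>t\<in>{0..T}. c \<le> Y t \<omega> then Inf {t \<in> {0..T}. c \<le> Y t \<omega>} else T + 1)"

lemma hitting_time_nonneg: "0 \<le> hitting_time Y c \<omega>"
  using T_pos by (auto simp: hitting_time_def intro!: cInf_greatest)

lemma before_hitting_time:
  assumes "t \<in> {0..T}" "t < hitting_time Y c \<omega>"
  shows "Y t \<omega> < c"
proof (rule ccontr)
  assume "\<not> Y t \<omega> < c"
  then have "Inf {t \<in> {0..T}. c \<le> Y t \<omega>} \<le> t" "\<exists>t\<in>{0..T}. c \<le> Y t \<omega>"
    using assms(1) by (auto simp: not_less intro!: cInf_lower bdd_belowI[of _ 0])
  then have "hitting_time Y c \<omega> \<le> t" by (simp add: hitting_time_def)
  with assms show False by simp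
qed

lemma hitting_time_attained:
  assumes Y: "continuous_on {0..T} (\<lambda>t. Y t \<omega>)" and "hitting_time Y c \<omega> \<le> T"
  shows "c \<le> Y (hitting_time Y c \<omega>) \<omega>"
proof -
  have ex: "\<exists>t\<in>{0..T}. c \<le> Y t \<omega>" using assms(2) by (auto simp: hitting_time_def split: if_splits)
  let ?S = "{t \<in> {0..T}. c \<le> Y t \<omega>}"
  have "closed ?S" using continuous_closed_preimage[OF Y, of "{c..}"] by (simp add: vimage_def Int_def)
  moreover have "bdd_below ?S" by (rule bdd_belowI[of _ 0]) auto
  ultimately have "Inf ?S \<in> ?S" using ex by (intro closed_contains_Inf) auto
  then show ?thesis using ex by (simp add: hitting_time_def)
qed

text \<open>The level set of a continuous path is closed, so the infimum is attained and the event
  is decided by the path up to and including \<open>t\<close>. This fits the raw filtration, which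
  gives no look beyond \<open>t\<close>.\<close>

lemma hitting_time_le_iff:
  assumes Y: "continuous_on {0..T} (\<lambda>t. Y t \<omega>)" and "t \<in> {0..T}"
  shows "hitting_time Y c \<omega> \<le> t \<longleftrightarrow> (\<exists>u\<in>{0..t}. c \<le> Y u \<omega>)"
proof
  assume "hitting_time Y c \<omega> \<le> t"
  then show "\<exists>u\<in>{0..t}. c \<le> Y u \<omega>"
    using hitting_time_attained[where Y = Y and c = c, OF Y] hitting_time_nonneg[of Y c \<omega>] assms(2) by auto
next
  assume "\<exists>u\<in>{0..t}. c \<le> Y u \<omega>"
  then obtain u where u: "u \<in> {0..t}" "c \<le> Y u \<omega>" by blast
  with before_hitting_time[of u Y c \<omega>] assms(2) show "hitting_time Y c \<omega> \<le> t" by force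
qed

lemma hitting_time_mono: "c \<le> d \<Longrightarrow> hitting_time Y c \<omega> \<le> hitting_time Y d \<omega>"
proof (cases "\<exists>t\<in>{0..T}. d \<le> Y t \<omega>")
  case True
  assume "c \<le> d"
  with True show ?thesis
    unfolding hitting_time_def by (auto intro!: cInf_superset_mono bdd_belowI[of _ 0])
next
  case False
  have "hitting_time Y c \<omega> \<le> T + 1"
  proof (cases "\<exists>t\<in>{0..T}. c \<le> Y t \<omega>")
    case True
    then obtain t where "t \<in> {0..T}" "c \<le> Y t \<omega>" by blast
    then have "Inf {t \<in> {0..T}. c \<le> Y t \<omega>} \<le> t" by (intro cInf_lower bdd_belowI[of _ 0]) auto
    with True \<open>t \<in> {0..T}\<close> show ?thesis by (simp add: hitting_time_def)
  qed (simp add: hitting_time_def)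
  with False show ?thesis by (simp add: hitting_time_def)
qed

text \<open>The maximum covers paths that start above the level, for which the hitting time is 0.
  Otherwise the intermediate value theorem would produce a strictly earlier time at or above the
  level.\<close>

lemma process_le_until_hitting_time:
  assumes Y: "continuous_on {0..T} (\<lambda>t. Y t \<omega>)" and t: "t \<in> {0..T}" "t \<le> hitting_time Y c \<omega>"
  shows "Y t \<omega> \<le> max c (Y 0 \<omega>)"
proof (rule ccontr)
  assume *: "\<not> ?thesis"
  then have "t \<noteq> 0" by auto
  moreover have "continuous_on {0..t} (\<lambda>t. Y t \<omega>)" using Y t by (intro continuous_on_subset[OF Y]) auto
  ultimately obtain u where u: "0 \<le> u" "u \<le> t" "Y u \<omega> = max c (Y 0 \<omega>)"
    using IVT'[of "\<lambda>t. Y t \<omega>" 0 "max c (Y 0 \<omega>)" t] * t by (auto simp: not_le)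
  then have "u < t" using * by (cases "u = t") auto
  then show False using before_hitting_time[of u Y c \<omega>] u t by auto
qed

lemma hitting_time_eventually_beyond:
  assumes Y: "continuous_on {0..T} (\<lambda>t. Y t \<omega>)"
  shows "\<exists>n. T \<le> hitting_time Y (real n) \<omega>"
proof -
  have "compact ((\<lambda>t. Y t \<omega>) ` {0..T})" by (intro compact_continuous_image Y) auto
  then obtain b where b: "\<And>t. t \<in> {0..T} \<Longrightarrow> \<bar>Y t \<omega>\<bar> \<le> b"
    by (fastforce dest!: compact_imp_bounded simp: bounded_iff)
  obtain n where n: "b < real n" using reals_Archimedean2 by blast
  have "\<not> (\<exists>t\<in>{0..T}. real n \<le> Y t \<omega>)"
  proof
    assume "\<exists>t\<in>{0..T}. real n \<le> Y t \<omega>"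
    then obtain t where "t \<in> {0..T}" "real n \<le> Y t \<omega>" by blast
    with b[of t] n show False by auto
  qed
  then have "T \<le> hitting_time Y (real n) \<omega>" by (auto simp: hitting_time_def)
  then show ?thesis ..
qed

text \<open>A continuous path attains its supremum over \<open>[0, t]\<close>, so reaching
  \<open>c\<close> means exceeding \<open>c - 1 / (k + 1)\<close> at some grid point, for every
  \<open>k\<close>. This is a countable combination of events known at \<open>t\<close>.\<close>

lemma stopping_time_hitting_time:
  assumes Y: "adapted T Y" "continuous_process T Y"
  shows "stopping_time (raw_filtration T) (hitting_time Y c)"
proof
  fix t
  have main: "Measurable.pred (raw_filtration T t) (\<lambda>\<omega>. hitting_time Y c \<omega> \<le> t)" if t: "t \<in> {0..T}" for t
  proof -
    have iff: "hitting_time Y c \<omega> \<le> t \<longleftrightarrow>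
        (\<forall>k. \<exists>n. \<exists>i\<in>{..Suc n}. c - 1 / real (Suc k) < Y (grid 0 t (Suc n) i) \<omega>)" if \<omega>: "\<omega> \<in> paths T" for \<omega>
    proof -
      have cont: "continuous_on {0..t} (\<lambda>t. Y t \<omega>)"
        using t by (intro continuous_on_subset[OF continuous_processD[OF Y(2) \<omega>]]) auto
      have grid_in: "grid 0 t (Suc n) i \<in> {0..t}" if "i \<le> Suc n" for n i
        using grid_ge[of 0 t "Suc n" i] grid_le[of 0 t i "Suc n"] t that by auto
      have "(\<exists>u\<in>{0..t}. c \<le> Y u \<omega>) \<longleftrightarrow> (\<forall>k. \<exists>n. \<exists>i\<in>{..Suc n}. c - 1 / real (Suc k) < Y (grid 0 t (Suc n) i) \<omega>)"
      proof safe
        fix u and k :: nat assume u: "u \<in> {0..t}" "c \<le> Y u \<omega>"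
        have le: "nat \<lfloor>real (Suc n) * (u / t)\<rfloor> \<le> Suc n" for n
          using u by (intro grid_floor) auto
        have lim: "(\<lambda>n. grid 0 t (Suc n) (nat \<lfloor>real (Suc n) * (u / t)\<rfloor>)) \<longlonglongrightarrow> u"
          using u by (intro grid_floor) auto
        have "(\<lambda>n. Y (grid 0 t (Suc n) (nat \<lfloor>real (Suc n) * (u / t)\<rfloor>)) \<omega>) \<longlonglongrightarrow> Y u \<omega>"
          using lim u(1) grid_in[OF le] by (intro continuous_on_tendsto_compose[OF cont]) auto
        moreover have "c - 1 / real (Suc k) < Y u \<omega>" using u(2) by (smt (verit) divide_pos_pos of_nat_0_less_iff zero_less_Suc)
        ultimately have "\<forall>\<^sub>F n in sequentially. c - 1 / real (Suc k) < Y (grid 0 t (Suc n) (nat \<lfloor>real (Suc n) * (u / t)\<rfloor>)) \<omega>"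
          by (rule order_tendstoD(1))
        then obtain n where "c - 1 / real (Suc k) < Y (grid 0 t (Suc n) (nat \<lfloor>real (Suc n) * (u / t)\<rfloor>)) \<omega>"
          using eventually_happens trivial_limit_sequentially by blast
        then show "\<exists>n. \<exists>i\<in>{..Suc n}. c - 1 / real (Suc k) < Y (grid 0 t (Suc n) i) \<omega>" using le by blast
      next
        assume *: "\<forall>k. \<exists>n. \<exists>i\<in>{..Suc n}. c - 1 / real (Suc k) < Y (grid 0 t (Suc n) i) \<omega>"
        obtain u where u: "u \<in> {0..t}" "\<And>v. v \<in> {0..t} \<Longrightarrow> Y v \<omega> \<le> Y u \<omega>"
          using continuous_attains_sup[OF _ _ cont] t by auto
        have "c - 1 / real (Suc k) \<le> Y u \<omega>" for k
        proof -
          obtain n i where "i \<in> {..Suc n}" "c - 1 / real (Suc k) < Y (grid 0 t (Suc n) i) \<omega>" using * by blast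
          then show ?thesis using u(2)[OF grid_in[of i n]] by auto
        qed
        moreover have "(\<lambda>k. c - 1 / real (Suc k)) \<longlonglongrightarrow> c - 0"
          by (intro tendsto_diff tendsto_const lim_1_over_n[THEN LIMSEQ_Suc])
        ultimately have "c - 0 \<le> Y u \<omega>" by (intro LIMSEQ_le_const2) auto
        then show "\<exists>u\<in>{0..t}. c \<le> Y u \<omega>" using u(1) by auto
      qed
      then show ?thesis using hitting_time_le_iff[where Y = Y and c = c, OF continuous_processD[OF Y(2) \<omega>] t] by simp
    qed
    have Ym: "Y (grid 0 t (Suc n) i) \<in> borel_measurable (raw_filtration T t)" if "i \<le> Suc n" for n i
      using grid_ge[of 0 t "Suc n" i] grid_le[of 0 t i "Suc n"] t that
      by (intro F_measurable_mono[OF adaptedD[OF Y(1)]]) auto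
    have "Measurable.pred (raw_filtration T t) (\<lambda>\<omega>. \<exists>i\<in>{..Suc n}. c - 1 / real (Suc k) < Y (grid 0 t (Suc n) i) \<omega>)" for n k
    proof (intro pred_intros_finite)
      fix i assume "i \<in> {..Suc n}"
      then have [measurable]: "Y (grid 0 t (Suc n) i) \<in> borel_measurable (raw_filtration T t)" using Ym by simp
      show "Measurable.pred (raw_filtration T t) (\<lambda>\<omega>. c - 1 / real (Suc k) < Y (grid 0 t (Suc n) i) \<omega>)" by measurable
    qed simp
    then have "Measurable.pred (raw_filtration T t) (\<lambda>\<omega>. \<forall>k. \<exists>n. \<exists>i\<in>{..Suc n}. c - 1 / real (Suc k) < Y (grid 0 t (Suc n) i) \<omega>)"
      by (intro pred_intros_countable)
    then show ?thesis by (rule measurable_cong[THEN iffD1, rotated]) (simp add: iff)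
  qed
  \<comment> \<open>The hitting time lies in \<open>[0, T]\<close> or equals \<open>T + 1\<close>:
    between these values the event is that of level \<open>T\<close>, and from \<open>T + 1\<close>
    on it is certain.\<close>
  consider "t < 0" | "t \<in> {0..T}" | "T < t" "t < T + 1" | "T + 1 \<le> t" by force
  then show "Measurable.pred (raw_filtration T t) (\<lambda>\<omega>. hitting_time Y c \<omega> \<le> t)"
  proof cases
    case 1
    then have "\<not> hitting_time Y c \<omega> \<le> t" for \<omega>
      using hitting_time_nonneg[of Y c \<omega>] by linarith
    then show ?thesis by simp
  next
    case 2
    then show ?thesis by (rule main)
  next
    case 3
    have "(hitting_time Y c \<omega> \<le> t) = (hitting_time Y c \<omega> \<le> T)" for \<omega>
    proof (cases "\<exists>t\<in>{0..T}. c \<le> Y t \<omega>")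
      case True
      then obtain u where "u \<in> {0..T}" "c \<le> Y u \<omega>" by blast
      then have "hitting_time Y c \<omega> \<le> T" using before_hitting_time[of u Y c \<omega>] by force
      then show ?thesis using 3 by simp
    qed (use 3 in \<open>simp add: hitting_time_def\<close>)
    then show ?thesis using main[of T] T_pos 3 raw_filtration_beyond[of T t] by simp
  next
    case 4
    have "hitting_time Y c \<omega> \<le> t" for \<omega>
    proof (cases "\<exists>t\<in>{0..T}. c \<le> Y t \<omega>")
      case True
      then obtain u where "u \<in> {0..T}" "c \<le> Y u \<omega>" by blast
      then show ?thesis using before_hitting_time[of u Y c \<omega>] 4 by force
    qed (use 4 in \<open>simp add: hitting_time_def\<close>)
    then show ?thesis by simp
  qed
qed

end

section \<open>Time integrals\<close>

text \<open>Half-lines generate the Borel sets and are stable under intersection, so by a Dynkin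
  argument all integrals of \<open>h\<close> over Borel sets vanish, and \<open>h\<close> is a
  density of the zero measure.\<close>

lemma zero_integrals_imp_AE_zero:
  fixes h :: "real \<Rightarrow> real"
  assumes h: "integrable lborel h" and zero: "\<And>a. (LINT x:{..a}|lborel. h x) = 0"
  shows "AE x in lborel. h x = 0"
proof (rule density_unique_real)
  show "integrable lborel (\<lambda>_ :: real. 0 :: real)" by simp
  have h_set: "set_integrable lborel A h" if "A \<in> sets borel" for A
    using h that unfolding set_integrable_def by (intro integrable_mult_indicator) auto
  \<comment> \<open>The total integral is a limit along half-lines; the complement case of the
    induction depends on it.\<close>
  have "(LINT x:UNIV|lborel. h x) = 0"
  proof -
    have "(\<lambda>n. LINT x:{..real n}|lborel. h x) \<longlonglongrightarrow> (LINT x:(\<Union>n. {..real n})|lborel. h x)"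
      using h_set by (intro set_integral_cont_up) (auto simp: incseq_def)
    moreover have "(\<Union>n. {..real n}) = (UNIV :: real set)" using real_arch_simple by auto
    ultimately show ?thesis by (simp add: zero LIMSEQ_const_iff)
  qed
  note all = this
  fix A :: "real set" assume "A \<in> sets lborel"
  then have "A \<in> sigma_sets UNIV (range atMost)" by (simp add: borel_eq_atMost)
  moreover have "Int_stable (range (atMost :: real \<Rightarrow> _))" by (auto simp: Int_stable_def)
  moreover have borel: "sigma_sets UNIV (range (atMost :: real \<Rightarrow> _)) = sets borel" by (simp add: borel_eq_atMost)
  moreover have "range (atMost :: real \<Rightarrow> _) \<subseteq> Pow UNIV" by simp
  ultimately have "Int_stable (range (atMost :: real \<Rightarrow> _))" "range (atMost :: real \<Rightarrow> _) \<subseteq> Pow UNIV"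
    "A \<in> sigma_sets UNIV (range atMost)" by blast+
  then have "(LINT x:A|lborel. h x) = 0"
  proof (induction rule: sigma_sets_induct_disjoint)
    case (basic A)
    then show ?case using zero by auto
  next
    case (compl A)
    then have A: "A \<in> sets borel" using borel by simp
    have "(LINT x:(A \<union> (UNIV - A))|lborel. h x) = (LINT x:A|lborel. h x) + (LINT x:(UNIV - A)|lborel. h x)"
      using A by (intro set_integral_Un h_set) auto
    with compl all show ?case by simp
  next
    case (union A)
    then have A: "A i \<in> sets borel" for i using borel by auto
    have "(LINT x:(\<Union>i. A i)|lborel. h x) = (\<Sum>i. LINT x:A i|lborel. h x)"
      using A union(1) by (intro lebesgue_integral_countable_add h_set) (auto simp: disjoint_family_on_def)
    with union show ?case by simp
  qed (simp add: set_lebesgue_integral_def)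
  then show "(LINT x:A|lborel. h x) = (LINT x:A|lborel. 0)" by simp
qed fact

definition time_integral :: "(real \<Rightarrow> real) \<Rightarrow> real \<Rightarrow> real" where
  "time_integral g t = (LINT s:{0..t}|lborel. g s)"


lemma time_integral_0 [simp]: "time_integral g 0 = 0"
  unfolding time_integral_def set_lebesgue_integral_def
  using AE_lborel_singleton[of "0::real"] by (intro integral_eq_zero_AE) (auto elim!: eventually_mono)

lemma bounded_set_integrable:
  assumes "set_borel_measurable lborel {0..T} g" "\<And>r. r \<in> {0..T} \<Longrightarrow> \<bar>g r\<bar> \<le> c"
  shows "set_integrable lborel {0..T} (g :: real \<Rightarrow> real)"
  using assms unfolding set_integrable_def set_borel_measurable_def
  by (intro integrableI_bounded_set[where A = "{0..T}" and B = c]) (auto simp: emeasure_lborel_Icc_eq)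

lemma time_integral_diff:
  assumes "set_integrable lborel {0..T} g" "set_integrable lborel {0..T} h" "t \<le> T"
  shows "time_integral (\<lambda>r. g r - h r) t = time_integral g t - time_integral h t"
  unfolding time_integral_def using assms by (intro set_integral_diff set_integrable_subset[OF assms(1)] set_integrable_subset[OF assms(2)]) auto

lemma time_integral_add:
  assumes "set_integrable lborel {0..T} g" "set_integrable lborel {0..T} h" "t \<le> T"
  shows "time_integral (\<lambda>r. g r + h r) t = time_integral g t + time_integral h t"
  unfolding time_integral_def using assms by (intro set_integral_add set_integrable_subset[OF assms(1)] set_integrable_subset[OF assms(2)]) auto

lemma time_integral_mult: "time_integral (\<lambda>r. c * g r) t = c * time_integral g t"
  unfolding time_integral_def by simp

lemma time_integral_increment:
  assumes g: "set_integrable lborel {0..T} g" and st: "0 \<le> s" "s \<le> t" "t \<le> T"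
  shows "time_integral g t - time_integral g s = (LINT r:{s<..t}|lborel. g r)"
proof -
  have int: "set_integrable lborel {s<..t} g" "set_integrable lborel {0..s} g"
    using st by (auto intro: set_integrable_subset[OF g])
  have "{0..t} = {0..s} \<union> {s<..t}" using st by auto
  then show ?thesis
    unfolding time_integral_def using set_integral_Un[OF _ int(2,1)] by (simp add: ivl_disj_int)
qed

lemma time_integral_mono_on:
  assumes g: "set_integrable lborel {0..T} g" and nonneg: "\<And>r. r \<in> {0..T} \<Longrightarrow> 0 \<le> g r"
  shows "mono_on {0..T} (time_integral g)"
proof (rule mono_onI)
  fix s t assume st: "s \<in> {0..T}" "t \<in> {0..T}" "s \<le> t"
  then have "0 \<le> (LINT r:{s<..t}|lborel. g r)"
    unfolding set_lebesgue_integral_def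
    by (intro Bochner_Integration.integral_nonneg) (auto simp: indicator_def intro!: nonneg)
  with st show "time_integral g s \<le> time_integral g t"
    using time_integral_increment[OF g, of s t] by auto
qed

lemma time_integral_increment_le:
  assumes g: "set_integrable lborel {0..T} g" and st: "0 \<le> s" "s \<le> t" "t \<le> T"
    and c: "\<And>r. s \<le> r \<Longrightarrow> r \<le> t \<Longrightarrow> \<bar>g r\<bar> \<le> c"
  shows "\<bar>time_integral g t - time_integral g s\<bar> \<le> c * (t - s)"
proof -
  have int: "set_integrable lborel {s<..t} g"
    using st by (auto intro: set_integrable_subset[OF g])
  note eq = time_integral_increment[OF g st]
  have const: "set_integrable lborel {s<..t} (\<lambda>_. d)" "(LINT r:{s<..t}|lborel. d) = d * (t - s)" for d :: real
    using st by (auto simp: set_integrable_def set_integral_const)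
  have c': "- c \<le> g r" "g r \<le> c" if "s \<le> r" "r \<le> t" for r
    using c[OF that] by linarith+
  have "(LINT r:{s<..t}|lborel. g r) \<le> (LINT r:{s<..t}|lborel. c)"
    using c' by (intro set_integral_mono int const) auto
  moreover have "(LINT r:{s<..t}|lborel. - c) \<le> (LINT r:{s<..t}|lborel. g r)"
    using c' by (intro set_integral_mono int const) auto
  ultimately show ?thesis unfolding eq const by (simp add: abs_le_iff)
qed

text \<open>On each cell the error is the integral of
  \<open>(\<phi> (v i) - \<phi> r) * g r\<close>, which uniform continuity makes small relative to
  the cell length. Capping the grid at \<open>\<rho>\<close> does not lengthen cells, so stopped
  processes are covered.\<close>

lemma riemann_sum_time_integral:
  assumes g: "set_borel_measurable lborel {0..T} g" "\<And>r. r \<in> {0..T} \<Longrightarrow> \<bar>g r\<bar> \<le> c"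
    and \<phi>: "continuous_on {0..T} \<phi>" and st: "0 \<le> s" "s \<le> t" "t \<le> T" and \<rho>: "0 \<le> \<rho>"
  shows "(\<lambda>n. \<Sum>i<n. \<phi> (min (grid s t n i) \<rho>)
      * (time_integral g (min (grid s t n (Suc i)) \<rho>) - time_integral g (min (grid s t n i) \<rho>)))
    \<longlonglongrightarrow> time_integral (\<lambda>r. \<phi> r * g r) (min t \<rho>) - time_integral (\<lambda>r. \<phi> r * g r) (min s \<rho>)"
proof (rule LIMSEQ_I)
  fix e :: real assume e: "e > 0"
  have g_int: "set_integrable lborel {0..T} g" by (rule bounded_set_integrable[OF g])
  have "compact (\<phi> ` {0..T})" by (intro compact_continuous_image \<phi>) auto
  then obtain b where b: "\<And>r. r \<in> {0..T} \<Longrightarrow> \<bar>\<phi> r\<bar> \<le> b"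
    by (fastforce dest!: compact_imp_bounded simp: bounded_iff)
  have \<phi>g_int: "set_integrable lborel {0..T} (\<lambda>r. \<phi> r * g r)"
  proof (rule bounded_set_integrable)
    have "set_borel_measurable borel {0..T} \<phi>"
      using borel_measurable_continuous_on_indicator[OF _ \<phi>] by (simp add: set_borel_measurable_def)
    then have "(\<lambda>x. (indicator {0..T} x *\<^sub>R \<phi> x) * (indicator {0..T} x *\<^sub>R g x)) \<in> borel_measurable lborel"
      using g(1) unfolding set_borel_measurable_def by (intro borel_measurable_times) simp_all
    then show "set_borel_measurable lborel {0..T} (\<lambda>r. \<phi> r * g r)"
      unfolding set_borel_measurable_def by (rule measurable_cong[THEN iffD1, rotated]) (simp add: indicator_def)
    show "\<bar>\<phi> r * g r\<bar> \<le> b * c" if "r \<in> {0..T}" for r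
      unfolding abs_mult using b[OF that] g(2)[OF that] by (intro mult_mono) auto
  qed
  define L where "L = \<bar>c\<bar> * (t - s)"
  have L: "L \<ge> 0" using st by (simp add: L_def)
  define d where "d = e / (L + 1)"
  have d: "d > 0" using e L by (simp add: d_def)
  have "uniformly_continuous_on {0..T} \<phi>"
    by (intro compact_uniformly_continuous \<phi>) auto
  then obtain \<delta> where \<delta>: "\<delta> > 0" "\<And>u v. u \<in> {0..T} \<Longrightarrow> v \<in> {0..T} \<Longrightarrow> dist v u < \<delta> \<Longrightarrow> dist (\<phi> v) (\<phi> u) < d"
    using d unfolding uniformly_continuous_on_def by metis
  have "(\<lambda>n. (t - s) / real n) \<longlonglongrightarrow> 0" by real_asymp
  then have "\<forall>\<^sub>F n in sequentially. (t - s) / real n < \<delta>" using \<delta>(1) by (rule order_tendstoD(2))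
  then have "\<forall>\<^sub>F n in sequentially. norm ((\<Sum>i<n. \<phi> (min (grid s t n i) \<rho>)
      * (time_integral g (min (grid s t n (Suc i)) \<rho>) - time_integral g (min (grid s t n i) \<rho>)))
    - (time_integral (\<lambda>r. \<phi> r * g r) (min t \<rho>) - time_integral (\<lambda>r. \<phi> r * g r) (min s \<rho>))) < e"
    using eventually_gt_at_top[of 0]
  proof eventually_elim
    case (elim n)
    define v where "v i = min (grid s t n i) \<rho>" for i
    have tel: "time_integral (\<lambda>r. \<phi> r * g r) (min t \<rho>) - time_integral (\<lambda>r. \<phi> r * g r) (min s \<rho>)
        = (\<Sum>i<n. time_integral (\<lambda>r. \<phi> r * g r) (v (Suc i)) - time_integral (\<lambda>r. \<phi> r * g r) (v i))"
      unfolding v_def using sum_telescope_grid[OF elim(2), of "\<lambda>t. time_integral (\<lambda>r. \<phi> r * g r) (min t \<rho>)" s t] by simp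
    have "\<bar>\<phi> (v i) * (time_integral g (v (Suc i)) - time_integral g (v i))
        - (time_integral (\<lambda>r. \<phi> r * g r) (v (Suc i)) - time_integral (\<lambda>r. \<phi> r * g r) (v i))\<bar> \<le> d * \<bar>c\<bar> * ((t - s) / real n)"
      if i: "i < n" for i
    proof -
      have v_in: "0 \<le> v i" "v i \<le> v (Suc i)" "v (Suc i) \<le> T" "v (Suc i) - v i \<le> (t - s) / real n"
        using grid_ge[of s t n i] grid_le[of s t "Suc i" n] grid_mono[of s t i "Suc i" n] grid_step[of s t n i] st i \<rho>
        by (auto simp: v_def min_def)
      define k where "k r = \<phi> (v i) * g r - \<phi> r * g r" for r
      have \<phi>vg: "set_integrable lborel {0..T} (\<lambda>r. \<phi> (v i) * g r)"
        using set_integrable_mult_right[of "\<phi> (v i)" lborel "{0..T}" g] g_int by (cases "\<phi> (v i) = 0") (simp_all add: set_integrable_def)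
      have k_int: "set_integrable lborel {0..T} k"
        unfolding k_def by (intro set_integral_diff \<phi>vg \<phi>g_int)
      have "\<phi> (v i) * (time_integral g (v (Suc i)) - time_integral g (v i))
        - (time_integral (\<lambda>r. \<phi> r * g r) (v (Suc i)) - time_integral (\<lambda>r. \<phi> r * g r) (v i))
        = time_integral k (v (Suc i)) - time_integral k (v i)"
        unfolding k_def using v_in
        by (simp add: time_integral_diff[OF \<phi>vg \<phi>g_int] time_integral_mult right_diff_distrib)
      moreover have "\<bar>time_integral k (v (Suc i)) - time_integral k (v i)\<bar> \<le> d * \<bar>c\<bar> * (v (Suc i) - v i)"
      proof (rule time_integral_increment_le[OF k_int])
        fix r assume r: "v i \<le> r" "r \<le> v (Suc i)"
        have rT: "r \<in> {0..T}" using r v_in by auto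
        have "dist (\<phi> r) (\<phi> (v i)) < d" using r v_in elim(1) by (intro \<delta>(2)) (auto simp: dist_real_def)
        then have "\<bar>\<phi> (v i) - \<phi> r\<bar> \<le> d" by (simp add: dist_real_def abs_minus_commute)
        then have "\<bar>\<phi> (v i) - \<phi> r\<bar> * \<bar>g r\<bar> \<le> d * \<bar>c\<bar>" using g(2)[OF rT] by (intro mult_mono) auto
        then show "\<bar>k r\<bar> \<le> d * \<bar>c\<bar>" unfolding k_def left_diff_distrib[symmetric] abs_mult .
      qed (use v_in in auto)
      moreover have "d * \<bar>c\<bar> * (v (Suc i) - v i) \<le> d * \<bar>c\<bar> * ((t - s) / real n)"
        using v_in d by (intro mult_left_mono) auto
      ultimately show ?thesis by linarith
    qed
    then have "norm ((\<Sum>i<n. \<phi> (v i) * (time_integral g (v (Suc i)) - time_integral g (v i)))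
      - (time_integral (\<lambda>r. \<phi> r * g r) (min t \<rho>) - time_integral (\<lambda>r. \<phi> r * g r) (min s \<rho>))) \<le> (\<Sum>i<n. d * \<bar>c\<bar> * ((t - s) / real n))"
      unfolding tel sum_subtractf[symmetric] real_norm_def by (intro order_trans[OF sum_abs] sum_mono) auto
    also have "\<dots> = d * L" using elim(2) by (simp add: L_def)
    also have "\<dots> < d * (L + 1)" using d by simp
    also have "\<dots> = e" using L by (simp add: d_def)
    finally show ?case unfolding v_def .
  qed
  then show "\<exists>no. \<forall>n\<ge>no. norm ((\<Sum>i<n. \<phi> (min (grid s t n i) \<rho>)
      * (time_integral g (min (grid s t n (Suc i)) \<rho>) - time_integral g (min (grid s t n i) \<rho>)))
    - (time_integral (\<lambda>r. \<phi> r * g r) (min t \<rho>) - time_integral (\<lambda>r. \<phi> r * g r) (min s \<rho>))) < e"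
    by (simp add: eventually_sequentially)
qed

section \<open>Functions of finite variation\<close>

lemma lipschitz_finite_variation:
  assumes "\<And>s t. 0 \<le> s \<Longrightarrow> s \<le> t \<Longrightarrow> t \<le> T \<Longrightarrow> \<bar>f t - f s\<bar> \<le> c * (t - s)" "0 \<le> c"
  shows "finite_variation_on T f"
  unfolding finite_variation_on_def
proof (intro exI allI impI)
  fix n :: nat and u :: "nat \<Rightarrow> real" assume u: "mono u" "range u \<subseteq> {0..T}"
  have uT: "0 \<le> u i" "u i \<le> T" for i using u(2) by (auto dest: range_subsetD[of u _ i])
  have "(\<Sum>i<n. \<bar>f (u (Suc i)) - f (u i)\<bar>) \<le> (\<Sum>i<n. c * (u (Suc i) - u i))"
    using u uT by (intro sum_mono assms) (auto simp: mono_def)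
  also have "\<dots> = c * (u n - u 0)" by (simp only: sum_distrib_left[symmetric] sum_lessThan_telescope)
  also have "\<dots> \<le> c * T" using uT[of n] uT[of 0] assms(2) by (intro mult_left_mono) auto
  finally show "(\<Sum>i<n. \<bar>f (u (Suc i)) - f (u i)\<bar>) \<le> c * T" .
qed

lemma mono_finite_variation:
  assumes "mono_on {0..T} f" 
  shows "finite_variation_on T f"
  unfolding finite_variation_on_def
proof (intro exI allI impI)
  fix n :: nat and u :: "nat \<Rightarrow> real" assume u: "mono u" "range u \<subseteq> {0..T}"
  have uT: "0 \<le> u i" "u i \<le> T" for i using u(2) by (auto dest: range_subsetD[of u _ i])
  have "(\<Sum>i<n. \<bar>f (u (Suc i)) - f (u i)\<bar>) = (\<Sum>i<n. f (u (Suc i)) - f (u i))"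
  proof (rule sum.cong[OF refl])
    fix i
    have "f (u i) \<le> f (u (Suc i))" using u uT by (intro mono_onD[OF assms]) (auto simp: mono_def)
    then show "\<bar>f (u (Suc i)) - f (u i)\<bar> = f (u (Suc i)) - f (u i)" by simp
  qed
  also have "\<dots> = f (u n) - f (u 0)"
    using sum_lessThan_telescope[of "\<lambda>i. f (u i)" n] by simp
  also have "\<dots> \<le> f T - f 0"
    using uT[of n] uT[of 0] by (intro diff_mono mono_onD[OF assms]) auto
  finally show "(\<Sum>i<n. \<bar>f (u (Suc i)) - f (u i)\<bar>) \<le> f T - f 0" .
qed

lemma finite_variation_diff:
  assumes "finite_variation_on T f" "finite_variation_on T g"
  shows "finite_variation_on T (\<lambda>t. f t - g t)"
proof -
  obtain c d where c: "\<And>n u. mono u \<Longrightarrow> range u \<subseteq> {0..T} \<Longrightarrow> (\<Sum>i<n. \<bar>f (u (Suc i)) - f (u i)\<bar>) \<le> c"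
    and d: "\<And>n u. mono u \<Longrightarrow> range u \<subseteq> {0..T} \<Longrightarrow> (\<Sum>i<n. \<bar>g (u (Suc i)) - g (u i)\<bar>) \<le> d"
    using assms unfolding finite_variation_on_def by blast
  show ?thesis
    unfolding finite_variation_on_def
  proof (intro exI allI impI)
    fix n :: nat and u :: "nat \<Rightarrow> real" assume u: "mono u" "range u \<subseteq> {0..T}"
    have "(\<Sum>i<n. \<bar>(f (u (Suc i)) - g (u (Suc i))) - (f (u i) - g (u i))\<bar>)
        \<le> (\<Sum>i<n. \<bar>f (u (Suc i)) - f (u i)\<bar> + \<bar>g (u (Suc i)) - g (u i)\<bar>)"
      by (intro sum_mono) linarith
    also have "\<dots> \<le> c + d" using c[OF u, of n] d[OF u, of n] by (simp add: sum.distrib)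
    finally show "(\<Sum>i<n. \<bar>(f (u (Suc i)) - g (u (Suc i))) - (f (u i) - g (u i))\<bar>) \<le> c + d" .
  qed
qed

section \<open>Predictable processes\<close>

text \<open>The preimage of \<open>C\<close> is a rectangle over \<open>I\<close>, joined by
  everything off the strip when 0 lies in \<open>C\<close>. Such functions are the building blocks
  of left-continuous step processes.\<close>

lemma rectangle_measurable:
  fixes Z :: "'a \<Rightarrow> real"
  assumes space: "space Q = space N \<times> S" and I: "I \<subseteq> S"
    and rect: "\<And>A. A \<in> sets N \<Longrightarrow> A \<times> I \<in> sets Q"
    and Z: "Z \<in> borel_measurable N"
  shows "(\<lambda>(\<omega>, s). of_bool (s \<in> I) * Z \<omega>) \<in> borel_measurable Q"
proof (rule measurableI)
  fix C :: "real set" assume C: "C \<in> sets borel"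
  have eq: "(\<lambda>(\<omega>, s). of_bool (s \<in> I) * Z \<omega>) -` C \<inter> space Q =
    (Z -` C \<inter> space N) \<times> I \<union> (if 0 \<in> C then space Q - space N \<times> I else {})"
    using I by (auto simp: space of_bool_def split: if_splits)
  show "(\<lambda>(\<omega>, s). of_bool (s \<in> I) * Z \<omega>) -` C \<inter> space Q \<in> sets Q"
    unfolding eq using rect[OF measurable_sets[OF Z C]] rect[OF sets.top[of N]] by auto
qed simp

lemma predictable_algebra_generators:
  "{A \<times> {0} | A. A \<in> sets (raw_filtration T 0)} \<union>
    {A \<times> {s<..t} | A s t. 0 \<le> s \<and> s \<le> t \<and> t \<le> T \<and> A \<in> sets (raw_filtration T s)} \<subseteq> Pow (paths T \<times> {0..T})"
  if "0 \<le> T"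
  using that sets.sets_into_space[of _ "raw_filtration T _"] by fastforce

context path_space
begin

lemma space_predictable_algebra [simp]: "space (predictable_algebra T) = paths T \<times> {0..T}"
  unfolding predictable_algebra_def using predictable_algebra_generators T_pos by (intro space_measure_of) simp

lemma sets_predictable_algebra: "sets (predictable_algebra T) = sigma_sets (paths T \<times> {0..T})
     ({A \<times> {0} | A. A \<in> sets (raw_filtration T 0)} \<union>
      {A \<times> {s<..t} | A s t. 0 \<le> s \<and> s \<le> t \<and> t \<le> T \<and> A \<in> sets (raw_filtration T s)})"
  unfolding predictable_algebra_def using predictable_algebra_generators T_pos by (intro sets_measure_of) simp

text \<open>It suffices to cut the generators at \<open>t\<close>: a rectangle starting at
  \<open>s \<le> t\<close> has a base known at \<open>t\<close>, and one starting later leaves no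
  trace. Joint measurability with information up to \<open>t\<close> is what makes time integrals
  adapted.\<close>

lemma predictable_progressive:
  assumes "predictable T Y" "t \<in> {0..T}"
  shows "(\<lambda>(\<omega>, s). Y s \<omega>) \<in> borel_measurable (raw_filtration T t \<Otimes>\<^sub>M restrict_space borel {0..t})"
proof -
  let ?R = "raw_filtration T t \<Otimes>\<^sub>M restrict_space borel {0..t}"
  have space: "space ?R = paths T \<times> {0..t}" by (simp add: space_pair_measure space_restrict_space)
  have borel: "B \<inter> {0..t} \<in> sets (restrict_space borel {0..t})" if "B \<in> sets borel" for B :: "real set"
    using that by (auto simp: sets_restrict_space_iff)
  have "(\<lambda>x. x) \<in> ?R \<rightarrow>\<^sub>M predictable_algebra T"
    unfolding predictable_algebra_def
  proof (rule measurable_measure_of)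
    show "{A \<times> {0} | A. A \<in> sets (raw_filtration T 0)} \<union>
      {A \<times> {s<..t} | A s t. 0 \<le> s \<and> s \<le> t \<and> t \<le> T \<and> A \<in> sets (raw_filtration T s)} \<subseteq> Pow (paths T \<times> {0..T})"
      using predictable_algebra_generators T_pos by simp
    show "(\<lambda>x. x) \<in> space ?R \<rightarrow> paths T \<times> {0..T}" using assms(2) by (auto simp: space)
    fix E assume "E \<in> {A \<times> {0} | A. A \<in> sets (raw_filtration T 0)} \<union>
      {A \<times> {s<..t} | A s t. 0 \<le> s \<and> s \<le> t \<and> t \<le> T \<and> A \<in> sets (raw_filtration T s)}"
    then consider A where "E = A \<times> {0}" "A \<in> sets (raw_filtration T 0)"
      | A s u where "E = A \<times> {s<..u}" "0 \<le> s" "s \<le> u" "u \<le> T" "A \<in> sets (raw_filtration T s)"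
      by blast
    then show "(\<lambda>x. x) -` E \<inter> space ?R \<in> sets ?R"
    proof cases
      case 1
      have A: "A \<in> sets (raw_filtration T t)" using 1(2) raw_filtration_mono[of 0 t] assms(2) by auto
      have "(\<lambda>x. x) -` E \<inter> space ?R = A \<times> ({0} \<inter> {0..t})"
        using sets.sets_into_space[OF A] 1 by (auto simp: space)
      with A borel[of "{0}"] show ?thesis by simp
    next
      case 2
      show ?thesis
      proof (cases "s \<le> t")
        case True
        have A: "A \<in> sets (raw_filtration T t)" using 2(5) raw_filtration_mono[OF True] by auto
        have "(\<lambda>x. x) -` E \<inter> space ?R = A \<times> ({s<..u} \<inter> {0..t})"
          using sets.sets_into_space[OF A] 2 by (auto simp: space)
        with A borel[of "{s<..u}"] show ?thesis by simp
      next
        case False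
        then have "(\<lambda>x. x) -` E \<inter> space ?R = {}" using 2 by (auto simp: space)
        then show ?thesis by simp
      qed
    qed
  qed
  from measurable_compose[OF this assms(1)[unfolded predictable_def]] show ?thesis .
qed

lemma predictable_path_measurable:
  assumes Y: "predictable T Y" and \<omega>: "\<omega> \<in> paths T"
  shows "set_borel_measurable lborel {0..T} (\<lambda>s. Y s \<omega>)"
proof -
  have "(\<lambda>s. (\<lambda>(\<omega>, s). Y s \<omega>) (\<omega>, s)) \<in> borel_measurable (restrict_space borel {0..T})"
    using \<omega> T_pos by (intro measurable_compose_Pair1[OF _ predictable_progressive[OF Y]]) auto
  then show ?thesis by (simp add: set_borel_measurable_def borel_measurable_restrict_space_iff)
qed

text \<open>Connects predictability with the product measure in which domination and uniqueness are
  stated, through progressive measurability at \<open>T\<close>.\<close>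

lemma predictable_product_measurable:
  assumes "predictable T Y"
  shows "(\<lambda>(\<omega>, s). Y s \<omega>) \<in> borel_measurable (P \<Otimes>\<^sub>M restrict_space lborel {0<..T})"
proof -
  let ?R = "restrict_space lborel {0<..T} :: real measure"
  have "fst \<in> P \<Otimes>\<^sub>M ?R \<rightarrow>\<^sub>M raw_filtration T T"
    using subalgebra_F[of T] T_pos
    by (intro measurable_compose[OF measurable_fst]) (auto simp: measurable_def subalgebra_def)
  moreover have "snd \<in> P \<Otimes>\<^sub>M ?R \<rightarrow>\<^sub>M restrict_space borel {0..T}"
  proof (rule measurable_restrict_space2)
    show "snd \<in> space (P \<Otimes>\<^sub>M ?R) \<rightarrow> {0..T}" by (auto simp: space_pair_measure space_restrict_space)
    have id: "(\<lambda>x. x) \<in> ?R \<rightarrow>\<^sub>M borel" by (intro measurable_restrict_space1) simp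
    show "snd \<in> P \<Otimes>\<^sub>M ?R \<rightarrow>\<^sub>M borel" by (rule measurable_compose[OF measurable_snd id])
  qed
  ultimately have "(\<lambda>x. (fst x, snd x)) \<in> P \<Otimes>\<^sub>M ?R \<rightarrow>\<^sub>M raw_filtration T T \<Otimes>\<^sub>M restrict_space borel {0..T}"
    by (rule measurable_Pair)
  from measurable_compose[OF this predictable_progressive[OF assms]] T_pos show ?thesis
    by (simp add: case_prod_beta')
qed

text \<open>Continuity makes the process a limit of steps that hold the left grid value on half-open
  cells, and such steps are predictable.\<close>

lemma predictable_canonical: "predictable T canonical"
  unfolding predictable_def
proof (rule borel_measurable_LIMSEQ_real)
  define g where "g k i = grid 0 T (Suc k) i" for k i
  have g_in: "0 \<le> g k i" "g k i \<le> T" if "i \<le> Suc k" for k i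
    unfolding g_def using that T_pos by (auto intro: grid_ge grid_le)
  have g_mono: "g k i \<le> g k (Suc i)" for k i
    unfolding g_def using T_pos by (intro grid_mono) auto
  \<comment> \<open>Time 0 lies in none of the half-open cells and gets a term of its own.\<close>
  define X where "X k = (\<lambda>x. (case x of (\<omega>, s) \<Rightarrow> of_bool (s \<in> {0}) * canonical 0 \<omega>)
    + (\<Sum>i<Suc k. case x of (\<omega>, s) \<Rightarrow> of_bool (s \<in> {g k i<..g k (Suc i)}) * canonical (g k i) \<omega>))" for k
  show "X k \<in> borel_measurable (predictable_algebra T)" for k
    unfolding X_def
  proof (intro borel_measurable_add borel_measurable_sum)
    show "(\<lambda>(\<omega>, s). of_bool (s \<in> {0}) * canonical 0 \<omega>) \<in> borel_measurable (predictable_algebra T)"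
      using T_pos adaptedD[OF adapted_canonical, of 0]
      by (intro rectangle_measurable[where N = "raw_filtration T 0" and S = "{0..T}"])
        (auto simp: sets_predictable_algebra intro!: sigma_sets.Basic)
    fix i assume "i \<in> {..<Suc k}"
    then have i: "0 \<le> g k i" "g k i \<le> g k (Suc i)" "g k (Suc i) \<le> T"
      using g_in[of i k] g_in[of "Suc i" k] g_mono by auto
    show "(\<lambda>(\<omega>, s). of_bool (s \<in> {g k i<..g k (Suc i)}) * canonical (g k i) \<omega>) \<in> borel_measurable (predictable_algebra T)"
    proof (rule rectangle_measurable[where N = "raw_filtration T (g k i)" and S = "{0..T}"])
      show "A \<times> {g k i<..g k (Suc i)} \<in> sets (predictable_algebra T)" if "A \<in> sets (raw_filtration T (g k i))" for A
        unfolding sets_predictable_algebra using that i by (intro sigma_sets.Basic) blast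
    qed (use i adaptedD[OF adapted_canonical, of "g k i"] in auto)
  qed
  fix x assume "x \<in> space (predictable_algebra T)"
  then obtain \<omega> s where x: "x = (\<omega>, s)" and \<omega>: "\<omega> \<in> paths T" and s: "0 \<le> s" "s \<le> T" by auto
  show "(\<lambda>k. X k x) \<longlonglongrightarrow> (case x of (\<omega>, s) \<Rightarrow> canonical s \<omega>)"
  proof (cases "s = 0")
    case True
    have "\<not> g k i < 0" if "i < Suc k" for k i using g_in[of i k] that by auto
    then have "X k x = canonical s \<omega>" for k
      unfolding x X_def True by (auto intro!: sum.neutral)
    then show ?thesis by (simp add: x)
  next
    case False
    show ?thesis
    proof (rule LIMSEQ_I)
      fix e :: real assume e: "e > 0"
      \<comment> \<open>A positive time lies in exactly one cell, seen by telescoping the indicators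
        of \<open>g k i < s\<close>.\<close>
      have sum1: "(\<Sum>i<Suc k. of_bool (s \<in> {g k i<..g k (Suc i)})) = (1 :: real)" for k
      proof -
        have "(\<Sum>i<Suc k. of_bool (s \<in> {g k i<..g k (Suc i)}))
            = (\<Sum>i<Suc k. of_bool (g k i < s) - of_bool (g k (Suc i) < s) :: real)"
        proof (rule sum.cong[OF refl])
          fix i show "of_bool (s \<in> {g k i<..g k (Suc i)}) = (of_bool (g k i < s) - of_bool (g k (Suc i) < s) :: real)"
            using g_mono[of k i] by auto
        qed
        also have "\<dots> = of_bool (g k 0 < s) - of_bool (g k (Suc k) < s)" by (rule sum_lessThan_telescope')
        also have "\<dots> = 1" using False s by (simp add: g_def)
        finally show ?thesis .
      qed
      have "uniformly_continuous_on {0..T} \<omega>"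
        by (intro compact_uniformly_continuous path_continuous \<omega>) auto
      then obtain \<delta> where \<delta>: "\<delta> > 0" "\<And>u v. u \<in> {0..T} \<Longrightarrow> v \<in> {0..T} \<Longrightarrow> dist v u < \<delta> \<Longrightarrow> dist (\<omega> v) (\<omega> u) < e / 2"
        using e unfolding uniformly_continuous_on_def by (metis half_gt_zero)
      have "(\<lambda>k. T / real (Suc k)) \<longlonglongrightarrow> 0" by real_asymp
      then have "\<forall>\<^sub>F k in sequentially. T / real (Suc k) < \<delta>" using \<delta>(1) by (rule order_tendstoD(2))
      then have "\<forall>\<^sub>F k in sequentially. norm (X k x - (case x of (\<omega>, s) \<Rightarrow> canonical s \<omega>)) < e"
      proof eventually_elim
        case (elim k)
        have "X k x - \<omega> s = (\<Sum>i<Suc k. of_bool (s \<in> {g k i<..g k (Suc i)}) * \<omega> (g k i))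
           - (\<Sum>i<Suc k. of_bool (s \<in> {g k i<..g k (Suc i)})) * \<omega> s"
          unfolding sum1 using False by (simp add: X_def x canonical_def)
        also have "\<dots> = (\<Sum>i<Suc k. of_bool (s \<in> {g k i<..g k (Suc i)}) * (\<omega> (g k i) - \<omega> s))"
          by (simp only: sum_distrib_right sum_subtractf right_diff_distrib)
        finally have "\<bar>X k x - \<omega> s\<bar> \<le> (\<Sum>i<Suc k. \<bar>of_bool (s \<in> {g k i<..g k (Suc i)}) * (\<omega> (g k i) - \<omega> s)\<bar>)"
          by (simp only: sum_abs)
        also have "\<dots> \<le> (\<Sum>i<Suc k. of_bool (s \<in> {g k i<..g k (Suc i)}) * (e / 2))"
        proof (rule sum_mono)
          fix i assume "i \<in> {..<Suc k}"
          then have i: "i \<le> Suc k" by simp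
          show "\<bar>of_bool (s \<in> {g k i<..g k (Suc i)}) * (\<omega> (g k i) - \<omega> s)\<bar> \<le> of_bool (s \<in> {g k i<..g k (Suc i)}) * (e / 2)"
          proof (cases "s \<in> {g k i<..g k (Suc i)}")
            case True
            have "g k (Suc i) - g k i = T / real (Suc k)" unfolding g_def using grid_step[of 0 T "Suc k" i] by simp
            then have "dist (g k i) s < \<delta>" using True elim by (simp add: dist_real_def)
            then have "dist (\<omega> (g k i)) (\<omega> s) < e / 2" using g_in[OF i] s by (intro \<delta>(2)) auto
            then show ?thesis using True by (simp add: dist_real_def)
          qed auto
        qed
        also have "\<dots> = e / 2" unfolding sum_distrib_right[symmetric] sum1 by simp
        finally show ?case using e by (simp add: x canonical_def)
      qed
      then show "\<exists>no. \<forall>k\<ge>no. norm (X k x - (case x of (\<omega>, s) \<Rightarrow> canonical s \<omega>)) < e"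
        by (simp add: eventually_sequentially)
    qed
  qed
qed

text \<open>The bound may depend on the path but has to exist for every path, since the continuity
  of the resulting time integral is demanded everywhere and not just almost surely.\<close>

definition path_bounded :: "process \<Rightarrow> bool" where
  "path_bounded g \<longleftrightarrow> (\<forall>\<omega>\<in>paths T. \<exists>c. \<forall>s\<in>{0..T}. \<bar>g s \<omega>\<bar> \<le> c)"

lemma path_bounded_integrable:
  assumes "predictable T g" "path_bounded g" "\<omega> \<in> paths T"
  shows "set_integrable lborel {0..T} (\<lambda>s. g s \<omega>)"
proof -
  obtain c where "\<And>s. s \<in> {0..T} \<Longrightarrow> \<bar>g s \<omega>\<bar> \<le> c" using assms(2,3) unfolding path_bounded_def by blast
  then show ?thesis by (rule bounded_set_integrable[OF predictable_path_measurable[OF assms(1,3)]])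
qed

text \<open>Fubini-type measurability of the integral over \<open>[0, t]\<close>, with the
  information at \<open>t\<close> as first factor of the product.\<close>

lemma adapted_time_integral:
  assumes g: "predictable T g"
  shows "adapted T (\<lambda>t \<omega>. time_integral (\<lambda>s. g s \<omega>) t)"
  unfolding adapted_def
proof
  fix t assume t: "t \<in> {0..T}"
  interpret sigma_finite_measure "restrict_space lborel {0..t} :: real measure"
    by (intro sigma_finite_measure_restrict_space sigma_finite_lborel) simp
  have "(\<lambda>(\<omega>, s). g s \<omega>) \<in> borel_measurable (raw_filtration T t \<Otimes>\<^sub>M restrict_space lborel {0..t})"
    using predictable_progressive[OF g t]
    by (rule measurable_cong_sets[THEN equalityD1, THEN subsetD, rotated 2])
      (auto intro!: sets_pair_measure_cong sets_restrict_space_cong)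
  then have "(\<lambda>\<omega>. LINT s|restrict_space lborel {0..t}. g s \<omega>) \<in> borel_measurable (raw_filtration T t)"
    by (rule borel_measurable_lebesgue_integral)
  then show "(\<lambda>\<omega>. time_integral (\<lambda>s. g s \<omega>) t) \<in> borel_measurable (raw_filtration T t)"
    by (simp add: integral_restrict_space time_integral_def set_lebesgue_integral_def)
qed

text \<open>A bounded integrand makes the time integral Lipschitz along the path; continuity and
  finite variation both follow from this.\<close>

lemma path_bounded_time_integral:
  assumes g: "predictable T g" "path_bounded g"
  shows "continuous_process T (\<lambda>t \<omega>. time_integral (\<lambda>s. g s \<omega>) t)"
    and "\<And>\<omega>. \<omega> \<in> paths T \<Longrightarrow> finite_variation_on T (\<lambda>t. time_integral (\<lambda>s. g s \<omega>) t)"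
    and "is_time_integral T P (\<lambda>t \<omega>. time_integral (\<lambda>s. g s \<omega>) t) g"
proof -
  have *: "\<exists>c\<ge>0. \<forall>s t. 0 \<le> s \<longrightarrow> s \<le> t \<longrightarrow> t \<le> T \<longrightarrow>
      \<bar>time_integral (\<lambda>s. g s \<omega>) t - time_integral (\<lambda>s. g s \<omega>) s\<bar> \<le> c * (t - s)" if \<omega>: "\<omega> \<in> paths T" for \<omega>
  proof -
    obtain c where c: "\<And>s. s \<in> {0..T} \<Longrightarrow> \<bar>g s \<omega>\<bar> \<le> c" using g(2) \<omega> unfolding path_bounded_def by blast
    have "\<bar>time_integral (\<lambda>s. g s \<omega>) t - time_integral (\<lambda>s. g s \<omega>) s\<bar> \<le> c * (t - s)" if "0 \<le> s" "s \<le> t" "t \<le> T" for s t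
      using that c by (intro time_integral_increment_le[OF path_bounded_integrable[OF g \<omega>]]) auto
    moreover have "0 \<le> c" using c[of 0] T_pos by (simp add: order_trans[OF abs_ge_zero])
    ultimately show ?thesis by blast
  qed
  show "finite_variation_on T (\<lambda>t. time_integral (\<lambda>s. g s \<omega>) t)" if "\<omega> \<in> paths T" for \<omega>
    using *[OF that] by (auto intro: lipschitz_finite_variation)
  show "continuous_process T (\<lambda>t \<omega>. time_integral (\<lambda>s. g s \<omega>) t)"
    unfolding continuous_process_def
  proof
    fix \<omega> assume "\<omega> \<in> paths T"
    then obtain c where c: "0 \<le> c" "\<And>s t. 0 \<le> s \<Longrightarrow> s \<le> t \<Longrightarrow> t \<le> T \<Longrightarrow>
      \<bar>time_integral (\<lambda>s. g s \<omega>) t - time_integral (\<lambda>s. g s \<omega>) s\<bar> \<le> c * (t - s)" using * by blast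
    have "c-lipschitz_on {0..T} (time_integral (\<lambda>s. g s \<omega>))"
    proof (rule lipschitz_onI)
      fix s t assume "s \<in> {0..T}" "t \<in> {0..T}"
      then show "dist (time_integral (\<lambda>s. g s \<omega>) s) (time_integral (\<lambda>s. g s \<omega>) t) \<le> c * dist s t"
        using c(2)[of s t] c(2)[of t s] by (cases "s \<le> t") (auto simp: dist_real_def abs_minus_commute)
    qed fact
    then show "continuous_on {0..T} (\<lambda>t. time_integral (\<lambda>s. g s \<omega>) t)"
      by (rule lipschitz_on_continuous_on)
  qed
  show "is_time_integral T P (\<lambda>t \<omega>. time_integral (\<lambda>s. g s \<omega>) t) g"
    unfolding is_time_integral_def
    by (rule AE_I2) (simp add: path_bounded_integrable[OF g] time_integral_def)
qed

text \<open>The difference of the integrands, set to 0 outside \<open>[0, T]\<close>, has vanishing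
  integrals over all half-lines.\<close>

lemma time_integral_determines_integrand:
  assumes int: "set_integrable lborel {0..T} g" "set_integrable lborel {0..T} h"
    and eq: "\<And>t. t \<in> {0..T} \<Longrightarrow> time_integral g t = time_integral h t"
  shows "AE s in restrict_space lborel {0<..T}. g s = h s"
proof -
  define k where "k s = indicator {0..T} s *\<^sub>R (g s - h s)" for s
  have "AE s in lborel. k s = 0"
  proof (rule zero_integrals_imp_AE_zero)
    show "integrable lborel k" unfolding k_def using set_integral_diff(1)[OF int] by (simp add: set_integrable_def)
    fix a
    consider "a < 0" | "a \<in> {0..T}" | "T < a" by force
    then show "(LINT s:{..a}|lborel. k s) = 0"
    proof cases
      case 1
      then have "indicator {..a} s *\<^sub>R k s = 0" for s by (auto simp: k_def indicator_def)
      then show ?thesis unfolding set_lebesgue_integral_def by (simp only: Bochner_Integration.integral_zero)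
    next
      case 2
      then have "indicator {..a} s *\<^sub>R k s = indicator {0..a} s *\<^sub>R (g s - h s)" for s by (auto simp: k_def indicator_def)
      then have "(LINT s:{..a}|lborel. k s) = time_integral (\<lambda>s. g s - h s) a"
        by (simp add: set_lebesgue_integral_def time_integral_def)
      then show ?thesis using 2 eq[OF 2] by (simp add: time_integral_diff[OF int])
    next
      case 3
      then have "indicator {..a} s *\<^sub>R k s = indicator {0..T} s *\<^sub>R (g s - h s)" for s by (auto simp: k_def indicator_def)
      then have "(LINT s:{..a}|lborel. k s) = time_integral (\<lambda>s. g s - h s) T"
        by (simp add: set_lebesgue_integral_def time_integral_def)
      then show ?thesis using eq[of T] T_pos by (simp add: time_integral_diff[OF int])
    qed
  qed
  then show ?thesis
    by (subst AE_restrict_space_iff) (auto simp: k_def elim!: eventually_mono)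
qed

end

section \<open>Uniqueness of the characteristics\<close>

lemma (in filtered_prob) centered_diff:
  assumes "centered N" "centered N'"
    and meas: "\<And>t. 0 \<le> t \<Longrightarrow> t \<le> T \<Longrightarrow> N t \<in> borel_measurable P" "\<And>t. 0 \<le> t \<Longrightarrow> t \<le> T \<Longrightarrow> N' t \<in> borel_measurable P"
    and bd: "\<And>t. 0 \<le> t \<Longrightarrow> t \<le> T \<Longrightarrow> ae_bounded (N t)" "\<And>t. 0 \<le> t \<Longrightarrow> t \<le> T \<Longrightarrow> ae_bounded (N' t)"
  shows "centered (\<lambda>t \<omega>. N t \<omega> - N' t \<omega>)"
  unfolding centered_def
proof safe
  fix s t :: real and Z :: "'a \<Rightarrow> real"
  assume st: "0 \<le> s" "s \<le> t" "t \<le> T" and Z: "Z \<in> borel_measurable (F s)" "ae_bounded Z"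
  have s: "0 \<le> s" "s \<le> T" and t: "0 \<le> t" "t \<le> T" using st by auto
  note [measurable] = F_measurable_P[OF Z(1) s] meas(1)[OF s] meas(1)[OF t] meas(2)[OF s] meas(2)[OF t]
  note b = bd(1)[OF s] bd(1)[OF t] bd(2)[OF s] bd(2)[OF t] Z(2)
  have int: "integrable P (\<lambda>\<omega>. Z \<omega> * (N t \<omega> - N s \<omega>))" "integrable P (\<lambda>\<omega>. Z \<omega> * (N' t \<omega> - N' s \<omega>))"
    using b by (intro ae_bounded_integrable; auto)+
  have "expectation (\<lambda>\<omega>. Z \<omega> * (N t \<omega> - N' t \<omega> - (N s \<omega> - N' s \<omega>)))
      = expectation (\<lambda>\<omega>. Z \<omega> * (N t \<omega> - N s \<omega>) - Z \<omega> * (N' t \<omega> - N' s \<omega>))"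
    by (intro Bochner_Integration.integral_cong) (auto simp: algebra_simps)
  also have "\<dots> = 0" using int centeredD[OF assms(1) st Z] centeredD[OF assms(2) st Z] by simp
  finally show "expectation (\<lambda>\<omega>. Z \<omega> * (N t \<omega> - N' t \<omega> - (N s \<omega> - N' s \<omega>))) = 0" .
qed

context path_space
begin

lemma is_local_martingale_localization:
  assumes "is_local_martingale T P M"
  shows "\<exists>\<tau>. (\<forall>n. stopping_time (raw_filtration T) (\<tau> n)) \<and> (\<forall>n. \<forall>\<omega>\<in>paths T. 0 \<le> \<tau> n \<omega>) \<and>
    (\<forall>n m. \<forall>\<omega>\<in>paths T. n \<le> m \<longrightarrow> \<tau> n \<omega> \<le> \<tau> m \<omega>) \<and> (AE \<omega> in P. \<exists>n :: nat. T \<le> \<tau> n \<omega>) \<and>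
    (\<forall>n. is_martingale T P (\<lambda>t \<omega>. M (min t (\<tau> n \<omega>)) \<omega>))"
proof -
  note D = assms[unfolded is_local_martingale_def]
  obtain \<tau> where \<tau>: "(\<forall>n. stopping_time (raw_filtration T) (\<tau> n)) \<and>
        (\<forall>n. \<forall>\<omega>\<in>paths T. 0 \<le> \<tau> n \<omega> \<and> \<tau> n \<omega> \<le> \<tau> (Suc n) \<omega>) \<and>
        (AE \<omega> in P. \<exists>n. T \<le> \<tau> n \<omega>) \<and>
        (\<forall>n. is_martingale T P (\<lambda>t \<omega>. M (min t (\<tau> n \<omega>)) \<omega>))"
    using D[THEN conjunct2] by (rule exE)
  have "\<tau> n \<omega> \<le> \<tau> m \<omega>" if "\<omega> \<in> paths T" "n \<le> m" for n m \<omega>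
    using lift_Suc_mono_le[of "\<lambda>n. \<tau> n \<omega>" n m] \<tau> that by simp
  with \<tau> show ?thesis by (intro exI[of _ \<tau>]) simp
qed

text \<open>Takes the minimum of both localizing sequences and the hitting times of
  \<open>Y\<close>. Both processes are bounded up to such a time, so optional stopping makes each of
  them centered along the same sequence. \<open>bounds\<close> ranges over all times below a hitting
  time because the minimum is formed inside the proof.\<close>

lemma common_localization:
  fixes N1 N2 Y :: process
  assumes N1: "continuous_process T N1" "is_local_martingale T P N1"
    and N2: "continuous_process T N2" "is_local_martingale T P N2"
    and Y: "adapted T Y" "continuous_process T Y"
    and bounds: "\<And>n \<rho>. (\<And>\<omega>. \<omega> \<in> paths T \<Longrightarrow> 0 \<le> \<rho> \<omega> \<and> \<rho> \<omega> \<le> hitting_time Y (real n) \<omega>) \<Longrightarrow>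
      \<exists>c. AE \<omega> in P. \<forall>t\<in>{0..T}. \<bar>N1 (min t (\<rho> \<omega>)) \<omega>\<bar> \<le> c \<and> \<bar>N2 (min t (\<rho> \<omega>)) \<omega>\<bar> \<le> c"
  obtains \<rho> where "\<And>n. stopping_time (raw_filtration T) (\<rho> n)"
    "\<And>n \<omega>. \<omega> \<in> paths T \<Longrightarrow> 0 \<le> \<rho> n \<omega> \<and> \<rho> n \<omega> \<le> \<rho> (Suc n) \<omega>"
    "AE \<omega> in P. \<exists>n. T \<le> \<rho> n \<omega>"
    "\<And>n \<omega>. \<omega> \<in> paths T \<Longrightarrow> \<rho> n \<omega> \<le> hitting_time Y (real n) \<omega>"
    "\<And>n. centered (\<lambda>t \<omega>. N1 (min t (\<rho> n \<omega>)) \<omega>)" "\<And>n. centered (\<lambda>t \<omega>. N2 (min t (\<rho> n \<omega>)) \<omega>)"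
    "\<And>n. \<exists>c. AE \<omega> in P. \<forall>t\<in>{0..T}. \<bar>N1 (min t (\<rho> n \<omega>)) \<omega>\<bar> \<le> c \<and> \<bar>N2 (min t (\<rho> n \<omega>)) \<omega>\<bar> \<le> c"
proof -
  obtain \<tau> where \<tau>: "\<forall>n. stopping_time (raw_filtration T) (\<tau> n)" "\<forall>n. \<forall>\<omega>\<in>paths T. 0 \<le> \<tau> n \<omega>"
      "\<forall>n m. \<forall>\<omega>\<in>paths T. n \<le> m \<longrightarrow> \<tau> n \<omega> \<le> \<tau> m \<omega>" "AE \<omega> in P. \<exists>n :: nat. T \<le> \<tau> n \<omega>"
      "\<forall>n. is_martingale T P (\<lambda>t \<omega>. N1 (min t (\<tau> n \<omega>)) \<omega>)"
    using is_local_martingale_localization[OF N1(2)] by (elim exE conjE) (rule that)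
  note \<tau> = \<tau>[rule_format]
  obtain \<tau>' where \<tau>': "\<forall>n. stopping_time (raw_filtration T) (\<tau>' n)" "\<forall>n. \<forall>\<omega>\<in>paths T. 0 \<le> \<tau>' n \<omega>"
      "\<forall>n m. \<forall>\<omega>\<in>paths T. n \<le> m \<longrightarrow> \<tau>' n \<omega> \<le> \<tau>' m \<omega>" "AE \<omega> in P. \<exists>n :: nat. T \<le> \<tau>' n \<omega>"
      "\<forall>n. is_martingale T P (\<lambda>t \<omega>. N2 (min t (\<tau>' n \<omega>)) \<omega>)"
    using is_local_martingale_localization[OF N2(2)] by (elim exE conjE) (rule that)
  note \<tau>' = \<tau>'[rule_format]
  define \<rho> where "\<rho> n \<omega> = min (min (\<tau> n \<omega>) (\<tau>' n \<omega>)) (hitting_time Y (real n) \<omega>)" for n \<omega>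
  have stop: "stopping_time (raw_filtration T) (\<rho> n)" for n
    unfolding \<rho>_def by (intro stopping_time_min \<tau> \<tau>' stopping_time_hitting_time Y)
  have nn: "0 \<le> \<rho> n \<omega>" if "\<omega> \<in> paths T" for n \<omega>
    using \<tau>(2)[OF that] \<tau>'(2)[OF that] hitting_time_nonneg by (simp add: \<rho>_def)
  have mono: "\<rho> n \<omega> \<le> \<rho> m \<omega>" if "\<omega> \<in> paths T" "n \<le> m" for n m \<omega>
    unfolding \<rho>_def using \<tau>(3)[OF that] \<tau>'(3)[OF that] that(2)
    by (intro min.mono hitting_time_mono) auto
  have "AE \<omega> in P. \<exists>n. T \<le> \<rho> n \<omega>"
    using \<tau>(4) \<tau>'(4) AE_space
  proof eventually_elim
    case (elim \<omega>)
    then have \<omega>: "\<omega> \<in> paths T" by simp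
    obtain n m k where "T \<le> \<tau> n \<omega>" "T \<le> \<tau>' m \<omega>" "T \<le> hitting_time Y (real k) \<omega>"
      using elim hitting_time_eventually_beyond[where Y = Y, OF continuous_processD[OF Y(2) \<omega>]] by blast
    \<comment> \<open>All three sequences increase with the index, so the largest of the three
      indices brings each of them beyond \<open>T\<close>.\<close>
    moreover define l where "l = max n (max m k)"
    ultimately have "T \<le> \<rho> l \<omega>"
      using \<tau>(3)[OF \<omega>, of n l] \<tau>'(3)[OF \<omega>, of m l] hitting_time_mono[of "real k" "real l" Y \<omega>]
      by (auto simp: \<rho>_def intro: order_trans)
    then show ?case ..
  qed
  moreover have bd: "\<exists>c. AE \<omega> in P. \<forall>t\<in>{0..T}. \<bar>N1 (min t (\<rho> n \<omega>)) \<omega>\<bar> \<le> c \<and> \<bar>N2 (min t (\<rho> n \<omega>)) \<omega>\<bar> \<le> c" for n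
    using nn by (intro bounds[of _ n]) (auto simp: \<rho>_def)
  moreover have "centered (\<lambda>t \<omega>. N1 (min t (\<rho> n \<omega>)) \<omega>)" "centered (\<lambda>t \<omega>. N2 (min t (\<rho> n \<omega>)) \<omega>)" for n
  proof -
    obtain c where c: "AE \<omega> in P. \<forall>t\<in>{0..T}. \<bar>N1 (min t (\<rho> n \<omega>)) \<omega>\<bar> \<le> c \<and> \<bar>N2 (min t (\<rho> n \<omega>)) \<omega>\<bar> \<le> c"
      using bd by blast
    show "centered (\<lambda>t \<omega>. N1 (min t (\<rho> n \<omega>)) \<omega>)"
    proof (rule stopped_martingale_centered[OF N1(1) \<tau>(5)[of n] _ stop])
      show "AE \<omega> in P. \<forall>t\<in>{0..T}. \<bar>N1 (min t (\<rho> n \<omega>)) \<omega>\<bar> \<le> c" using c by eventually_elim blast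
      show "0 \<le> \<rho> n \<omega> \<and> \<rho> n \<omega> \<le> \<tau> n \<omega>" if "\<omega> \<in> paths T" for \<omega>
        using nn[OF that] by (simp add: \<rho>_def)
    qed (rule \<tau>(2))
    show "centered (\<lambda>t \<omega>. N2 (min t (\<rho> n \<omega>)) \<omega>)"
    proof (rule stopped_martingale_centered[OF N2(1) \<tau>'(5)[of n] _ stop])
      show "AE \<omega> in P. \<forall>t\<in>{0..T}. \<bar>N2 (min t (\<rho> n \<omega>)) \<omega>\<bar> \<le> c" using c by eventually_elim blast
      show "0 \<le> \<rho> n \<omega> \<and> \<rho> n \<omega> \<le> \<tau>' n \<omega>" if "\<omega> \<in> paths T" for \<omega>
        using nn[OF that] by (simp add: \<rho>_def)
    qed (rule \<tau>'(2))
  qed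
  moreover have "\<rho> n \<omega> \<le> hitting_time Y (real n) \<omega>" for n \<omega> by (simp add: \<rho>_def)
  moreover have "0 \<le> \<rho> n \<omega> \<and> \<rho> n \<omega> \<le> \<rho> (Suc n) \<omega>" if "\<omega> \<in> paths T" for n \<omega>
    using nn[OF that] mono[OF that, of n "Suc n"] by simp
  ultimately show ?thesis by (intro that[of \<rho>] stop)
qed

text \<open>The difference is a continuous local martingale of finite variation that starts at 0.
  The two processes are localized jointly, with the sum of their absolute values as control, and
  subtracted only after stopping, when both are bounded.\<close>

lemma local_martingales_fv_difference_eq:
  assumes N1: "continuous_process T N1" "is_local_martingale T P N1"
    and N2: "continuous_process T N2" "is_local_martingale T P N2"
    and zero: "AE \<omega> in P. N1 0 \<omega> = 0 \<and> N2 0 \<omega> = 0"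
    and fv: "AE \<omega> in P. finite_variation_on T (\<lambda>t. N1 t \<omega> - N2 t \<omega>)"
  shows "AE \<omega> in P. \<forall>t\<in>{0..T}. N1 t \<omega> = N2 t \<omega>"
proof -
  have ad: "adapted T N1" "adapted T N2" using N1(2) N2(2) by (auto simp: is_local_martingale_def)
  define Y where "Y t \<omega> = \<bar>N1 t \<omega>\<bar> + \<bar>N2 t \<omega>\<bar>" for t \<omega>
  have Y: "adapted T Y" "continuous_process T Y"
    using ad N1(1) N2(1) unfolding Y_def adapted_def continuous_process_def
    by (auto intro!: continuous_intros borel_measurable_add borel_measurable_abs)
  have abs_sum_le: "\<bar>p\<bar> + \<bar>q\<bar> \<le> r \<Longrightarrow> \<bar>p\<bar> \<le> r \<and> \<bar>q\<bar> \<le> r" for p q r :: real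
    by auto
  have bnd: "\<exists>c. AE \<omega> in P. \<forall>t\<in>{0..T}. \<bar>N1 (min t (\<rho> \<omega>)) \<omega>\<bar> \<le> c \<and> \<bar>N2 (min t (\<rho> \<omega>)) \<omega>\<bar> \<le> c"
    if \<rho>: "\<And>\<omega>. \<omega> \<in> paths T \<Longrightarrow> 0 \<le> \<rho> \<omega> \<and> \<rho> \<omega> \<le> hitting_time Y (real n) \<omega>" for n \<rho>
  proof
    show "AE \<omega> in P. \<forall>t\<in>{0..T}. \<bar>N1 (min t (\<rho> \<omega>)) \<omega>\<bar> \<le> real n \<and> \<bar>N2 (min t (\<rho> \<omega>)) \<omega>\<bar> \<le> real n"
      using zero AE_space
    proof eventually_elim
      case (elim \<omega>)
      show ?case
      proof
        fix t assume t: "t \<in> {0..T}"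
        have "\<omega> \<in> paths T" using elim by simp
        note \<omega> = this \<rho>[OF this]
        have "Y (min t (\<rho> \<omega>)) \<omega> \<le> max (real n) (Y 0 \<omega>)"
          using t \<omega>(2)
          by (intro process_le_until_hitting_time[where Y = Y, OF continuous_processD[OF Y(2) \<omega>(1)]]) auto
        then have "Y (min t (\<rho> \<omega>)) \<omega> \<le> real n" using elim by (simp add: Y_def)
        then show "\<bar>N1 (min t (\<rho> \<omega>)) \<omega>\<bar> \<le> real n \<and> \<bar>N2 (min t (\<rho> \<omega>)) \<omega>\<bar> \<le> real n"
          unfolding Y_def by (rule abs_sum_le)
      qed
    qed
  qed
  show ?thesis
  proof (rule common_localization[OF N1 N2 Y bnd])
  fix \<rho> assume \<rho>: "\<And>n. stopping_time (raw_filtration T) (\<rho> n)"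
    "\<And>n \<omega>. \<omega> \<in> paths T \<Longrightarrow> 0 \<le> \<rho> n \<omega> \<and> \<rho> n \<omega> \<le> \<rho> (Suc n) \<omega>"
    "AE \<omega> in P. \<exists>n. T \<le> \<rho> n \<omega>"
    "\<And>n \<omega>. \<omega> \<in> paths T \<Longrightarrow> \<rho> n \<omega> \<le> hitting_time Y (real n) \<omega>"
    "\<And>n. centered (\<lambda>t \<omega>. N1 (min t (\<rho> n \<omega>)) \<omega>)" "\<And>n. centered (\<lambda>t \<omega>. N2 (min t (\<rho> n \<omega>)) \<omega>)"
    "\<And>n. \<exists>c. AE \<omega> in P. \<forall>t\<in>{0..T}. \<bar>N1 (min t (\<rho> n \<omega>)) \<omega>\<bar> \<le> c \<and> \<bar>N2 (min t (\<rho> n \<omega>)) \<omega>\<bar> \<le> c"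
  have stopped_zero: "AE \<omega> in P. N1 (min t (\<rho> n \<omega>)) \<omega> - N2 (min t (\<rho> n \<omega>)) \<omega> = 0" if t: "0 \<le> t" "t \<le> T" for n t
  proof -
    obtain c where c: "AE \<omega> in P. \<forall>t\<in>{0..T}. \<bar>N1 (min t (\<rho> n \<omega>)) \<omega>\<bar> \<le> c \<and> \<bar>N2 (min t (\<rho> n \<omega>)) \<omega>\<bar> \<le> c"
      using \<rho>(7) by blast
    let ?N = "\<lambda>t \<omega>. N1 (min t (\<rho> n \<omega>)) \<omega> - N2 (min t (\<rho> n \<omega>)) \<omega>"
    have nn: "0 \<le> \<rho> n \<omega>" if "\<omega> \<in> paths T" for \<omega> using \<rho>(2)[OF that] by blast
    have ads: "adapted T (\<lambda>t \<omega>. N1 (min t (\<rho> n \<omega>)) \<omega>)" "adapted T (\<lambda>t \<omega>. N2 (min t (\<rho> n \<omega>)) \<omega>)"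
      by (rule adapted_stopped[OF ad(1) N1(1) \<rho>(1) nn] adapted_stopped[OF ad(2) N2(1) \<rho>(1) nn]; assumption)+
    have conts: "continuous_process T (\<lambda>t \<omega>. N1 (min t (\<rho> n \<omega>)) \<omega>)" "continuous_process T (\<lambda>t \<omega>. N2 (min t (\<rho> n \<omega>)) \<omega>)"
      by (rule continuous_process_stopped[OF N1(1) nn] continuous_process_stopped[OF N2(1) nn]; assumption)+
    have bd: "ae_bounded (\<lambda>\<omega>. N1 (min u (\<rho> n \<omega>)) \<omega>)" "ae_bounded (\<lambda>\<omega>. N2 (min u (\<rho> n \<omega>)) \<omega>)" if "0 \<le> u" "u \<le> T" for u
      by (rule ae_boundedI[of _ c], use c in eventually_elim, use that in auto)+
    have "AE \<omega> in P. ?N t \<omega> = ?N 0 \<omega>"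
    proof (rule centered_finite_variation_zero[where N = ?N and K = "2 * c"])
      show "?N u \<in> borel_measurable (raw_filtration T u)" if "0 \<le> u" "u \<le> T" for u
        by (intro borel_measurable_diff adaptedD[OF ads(1) that] adaptedD[OF ads(2) that])
      show "AE \<omega> in P. \<forall>t\<in>{0..T}. \<bar>?N t \<omega>\<bar> \<le> 2 * c"
        using c
      proof eventually_elim
        case (elim \<omega>)
        show ?case
        proof
          fix t assume "t \<in> {0..T}"
          with elim have "\<bar>N1 (min t (\<rho> n \<omega>)) \<omega>\<bar> \<le> c" "\<bar>N2 (min t (\<rho> n \<omega>)) \<omega>\<bar> \<le> c" by auto
          then show "\<bar>?N t \<omega>\<bar> \<le> 2 * c" by linarith
        qed
      qed
      show "AE \<omega> in P. continuous_on {0..T} (\<lambda>t. ?N t \<omega>)"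
      proof (rule AE_I2)
        fix \<omega> assume "\<omega> \<in> space P"
        then have \<omega>: "\<omega> \<in> paths T" by simp
        show "continuous_on {0..T} (\<lambda>t. ?N t \<omega>)"
          by (intro continuous_on_diff continuous_processD[OF conts(1) \<omega>] continuous_processD[OF conts(2) \<omega>])
      qed
      show "centered ?N"
        using adaptedD[OF ads(1)] adaptedD[OF ads(2)] bd
        by (intro centered_diff \<rho>(5,6)) (auto intro: F_measurable_P)
      show "AE \<omega> in P. \<exists>c. \<forall>m. (\<Sum>i<m. \<bar>?N (grid 0 t m (Suc i)) \<omega> - ?N (grid 0 t m i) \<omega>\<bar>) \<le> c"
        using fv AE_space
      proof eventually_elim
        case (elim \<omega>)
        have \<omega>: "0 \<le> \<rho> n \<omega>" using elim nn by simp
        obtain C where C: "\<And>m u. mono u \<Longrightarrow> range u \<subseteq> {0..T} \<Longrightarrow>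
            (\<Sum>i<m. \<bar>(N1 (u (Suc i)) \<omega> - N2 (u (Suc i)) \<omega>) - (N1 (u i) \<omega> - N2 (u i) \<omega>)\<bar>) \<le> C"
          using elim unfolding finite_variation_on_def by blast
        have "(\<Sum>i<m. \<bar>?N (grid 0 t m (Suc i)) \<omega> - ?N (grid 0 t m i) \<omega>\<bar>) \<le> C" for m
        proof -
          \<comment> \<open>The grid is frozen after index \<open>m\<close>, to be monotone on all
            naturals, and capped at \<open>\<rho> n\<close>, so that the variation of the stopped
            difference is one of the sums bounded by \<open>C\<close>.\<close>
          define u where "u i = min (grid 0 t m (min i m)) (\<rho> n \<omega>)" for i
          have "mono u"
          proof (rule monoI)
            fix i j :: nat assume "i \<le> j"
            then have "min i m \<le> min j m" by simp
            then show "u i \<le> u j" unfolding u_def by (rule min.mono[OF grid_mono[OF t(1)] order_refl])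
          qed
          moreover have "range u \<subseteq> {0..T}"
          proof -
            have "0 \<le> u i" "u i \<le> T" for i
              using t \<omega> grid_ge[of 0 t m "min i m"] grid_le[of 0 t "min i m" m] by (auto simp: u_def min.coboundedI1)
            then show ?thesis by auto
          qed
          ultimately have "(\<Sum>i<m. \<bar>(N1 (u (Suc i)) \<omega> - N2 (u (Suc i)) \<omega>) - (N1 (u i) \<omega> - N2 (u i) \<omega>)\<bar>) \<le> C"
            by (rule C)
          moreover have "(\<Sum>i<m. \<bar>(N1 (u (Suc i)) \<omega> - N2 (u (Suc i)) \<omega>) - (N1 (u i) \<omega> - N2 (u i) \<omega>)\<bar>)
              = (\<Sum>i<m. \<bar>?N (grid 0 t m (Suc i)) \<omega> - ?N (grid 0 t m i) \<omega>\<bar>)"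
            by (intro sum.cong refl) (simp add: u_def)
          ultimately show ?thesis by simp
        qed
        then show ?case by blast
      qed
    qed (use t in auto)
    with zero AE_space show ?thesis
    proof eventually_elim
      case (elim \<omega>)
      then have "min 0 (\<rho> n \<omega>) = 0" using nn by simp
      with elim show ?case by simp
    qed
  qed
  \<comment> \<open>The exceptional set found so far depends on the time. Countably many grid points
    share one null set, and path continuity extends the equality to all times.\<close>
  have "AE \<omega> in P. \<forall>n k i. i \<le> Suc k \<longrightarrow> N1 (min (grid 0 T (Suc k) i) (\<rho> n \<omega>)) \<omega> - N2 (min (grid 0 T (Suc k) i) (\<rho> n \<omega>)) \<omega> = 0"
    unfolding AE_all_countable
  proof (intro allI)
    fix n k i
    show "AE \<omega> in P. i \<le> Suc k \<longrightarrow> N1 (min (grid 0 T (Suc k) i) (\<rho> n \<omega>)) \<omega> - N2 (min (grid 0 T (Suc k) i) (\<rho> n \<omega>)) \<omega> = 0"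
    proof (cases "i \<le> Suc k")
      case True
      have "0 \<le> grid 0 T (Suc k) i" "grid 0 T (Suc k) i \<le> T"
        using True T_pos by (auto intro: grid_ge grid_le)
      from stopped_zero[OF this, of n] show ?thesis by eventually_elim simp
    qed simp
  qed
  with \<rho>(3) AE_space show ?thesis
  proof eventually_elim
    case (elim \<omega>)
    then have \<omega>: "\<omega> \<in> paths T" by simp
    obtain n where n: "T \<le> \<rho> n \<omega>" using elim by blast
    have grid_zero: "N1 (grid 0 T (Suc k) i) \<omega> - N2 (grid 0 T (Suc k) i) \<omega> = 0" if "i \<le> Suc k" for k i
    proof -
      have "grid 0 T (Suc k) i \<le> \<rho> n \<omega>" using n T_pos grid_le[of 0 T i "Suc k"] that by simp
      with elim(3) that show ?thesis by (metis min.absorb1)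
    qed
    show ?case
    proof
      fix t assume t: "t \<in> {0..T}"
      have cont: "continuous_on {0..T} (\<lambda>t. N1 t \<omega> - N2 t \<omega>)"
        by (intro continuous_on_diff continuous_processD[OF N1(1) \<omega>] continuous_processD[OF N2(1) \<omega>])
      have t': "0 \<le> t" "t \<le> T" using t by auto
      note gf = grid_floor[OF t']
      have "(\<lambda>k. N1 (grid 0 T (Suc k) (nat \<lfloor>real (Suc k) * (t / T)\<rfloor>)) \<omega> - N2 (grid 0 T (Suc k) (nat \<lfloor>real (Suc k) * (t / T)\<rfloor>)) \<omega>)
          \<longlonglongrightarrow> N1 t \<omega> - N2 t \<omega>"
        using gf(1) T_pos t by (intro continuous_on_tendsto_compose[OF cont gf(2)]) (auto intro!: always_eventually grid_ge grid_le)
      then have "(\<lambda>k. 0) \<longlonglongrightarrow> N1 t \<omega> - N2 t \<omega>" using grid_zero[OF gf(1)] by simp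
      then show "N1 t \<omega> = N2 t \<omega>" by (simp add: LIMSEQ_const_iff)
    qed
  qed
  qed
qed

text \<open>\<open>M - M' = B' - B\<close> has finite variation, so \<open>M = M'\<close> and
  \<open>B = B'\<close>. The two compensated squares then differ by \<open>A' - A\<close>, a
  difference of monotone functions, so \<open>A = A'\<close>. Integrands with equal time integrals
  agree at almost every time, path by path, and Fubini gives the product statement.\<close>

theorem differential_characteristics_unique:
  assumes "differential_characteristics T P Y \<beta> \<alpha>" "differential_characteristics T P Y \<beta>' \<alpha>'"
  shows "ae_path_time T P (\<lambda>\<omega> s. \<beta> s \<omega> = \<beta>' s \<omega> \<and> \<alpha> s \<omega> = \<alpha>' s \<omega>)"
proof -
  from assms(1) obtain B M A where 1: "semimartingale_decomposition T P Y B M" "angle_bracket T P M A"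
      "is_time_integral T P B \<beta>" "is_time_integral T P A \<alpha>"
    and p: "predictable T \<beta>" "predictable T \<alpha>"
    unfolding differential_characteristics_def by blast
  from assms(2) obtain B' M' A' where 2: "semimartingale_decomposition T P Y B' M'" "angle_bracket T P M' A'"
      "is_time_integral T P B' \<beta>'" "is_time_integral T P A' \<alpha>'"
    and p': "predictable T \<beta>'" "predictable T \<alpha>'"
    unfolding differential_characteristics_def by blast
  note d = 1(1)[unfolded semimartingale_decomposition_def] 2(1)[unfolded semimartingale_decomposition_def]
  note br = 1(2)[unfolded angle_bracket_def] 2(2)[unfolded angle_bracket_def]
  have dec: "AE \<omega> in P. \<forall>t\<in>{0..T}. Y t \<omega> = Y 0 \<omega> + B t \<omega> + M t \<omega>" "AE \<omega> in P. \<forall>t\<in>{0..T}. Y t \<omega> = Y 0 \<omega> + B' t \<omega> + M' t \<omega>"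
    and fv: "AE \<omega> in P. finite_variation_on T (\<lambda>t. B t \<omega>)" "AE \<omega> in P. finite_variation_on T (\<lambda>t. B' t \<omega>)"
    and z: "AE \<omega> in P. B 0 \<omega> = 0 \<and> M 0 \<omega> = 0" "AE \<omega> in P. B' 0 \<omega> = 0 \<and> M' 0 \<omega> = 0"
    and cM: "continuous_process T M" "continuous_process T M'"
    and lM: "is_local_martingale T P M" "is_local_martingale T P M'"
    and zA: "AE \<omega> in P. A 0 \<omega> = 0 \<and> mono_on {0..T} (\<lambda>t. A t \<omega>)" "AE \<omega> in P. A' 0 \<omega> = 0 \<and> mono_on {0..T} (\<lambda>t. A' t \<omega>)"
    and cA: "continuous_process T A" "continuous_process T A'"
    and lA: "is_local_martingale T P (\<lambda>t \<omega>. (M t \<omega>)\<^sup>2 - A t \<omega>)" "is_local_martingale T P (\<lambda>t \<omega>. (M' t \<omega>)\<^sup>2 - A' t \<omega>)"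
    using d br by auto
  have fv_cong: "finite_variation_on T f \<longleftrightarrow> finite_variation_on T g" if "\<And>t. t \<in> {0..T} \<Longrightarrow> f t = g t" for f g
  proof -
    have "\<bar>f (u (Suc i)) - f (u i)\<bar> = \<bar>g (u (Suc i)) - g (u i)\<bar>" if "range u \<subseteq> {0..T}" for u :: "nat \<Rightarrow> real" and i
      using \<open>\<And>t. t \<in> {0..T} \<Longrightarrow> f t = g t\<close>[OF range_subsetD[OF that, of i]]
        \<open>\<And>t. t \<in> {0..T} \<Longrightarrow> f t = g t\<close>[OF range_subsetD[OF that, of "Suc i"]] by simp
    then show ?thesis unfolding finite_variation_on_def by (metis (no_types, lifting) sum.cong)
  qed
  have MM: "AE \<omega> in P. \<forall>t\<in>{0..T}. M t \<omega> = M' t \<omega>"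
  proof (rule local_martingales_fv_difference_eq[OF cM(1) lM(1) cM(2) lM(2)])
    show "AE \<omega> in P. M 0 \<omega> = 0 \<and> M' 0 \<omega> = 0" using z by eventually_elim simp
    show "AE \<omega> in P. finite_variation_on T (\<lambda>t. M t \<omega> - M' t \<omega>)"
      using dec fv
    proof eventually_elim
      case (elim \<omega>)
      have FV: "finite_variation_on T (\<lambda>t. B' t \<omega> - B t \<omega>)" using elim by (intro finite_variation_diff)
      have eq: "M t \<omega> - M' t \<omega> = B' t \<omega> - B t \<omega>" if "t \<in> {0..T}" for t
        using elim(1)[rule_format, OF that] elim(2)[rule_format, OF that] by linarith
      show ?case
        using FV fv_cong[of "\<lambda>t. M t \<omega> - M' t \<omega>" "\<lambda>t. B' t \<omega> - B t \<omega>", OF eq] by simp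
    qed
  qed
  have AA: "AE \<omega> in P. \<forall>t\<in>{0..T}. (M t \<omega>)\<^sup>2 - A t \<omega> = (M' t \<omega>)\<^sup>2 - A' t \<omega>"
  proof (rule local_martingales_fv_difference_eq[OF _ lA(1) _ lA(2)])
    show "continuous_process T (\<lambda>t \<omega>. (M t \<omega>)\<^sup>2 - A t \<omega>)" "continuous_process T (\<lambda>t \<omega>. (M' t \<omega>)\<^sup>2 - A' t \<omega>)"
      using cM cA by (auto simp: continuous_process_def intro!: continuous_intros)
    show "AE \<omega> in P. (M 0 \<omega>)\<^sup>2 - A 0 \<omega> = 0 \<and> (M' 0 \<omega>)\<^sup>2 - A' 0 \<omega> = 0" using z zA by eventually_elim simp
    show "AE \<omega> in P. finite_variation_on T (\<lambda>t. (M t \<omega>)\<^sup>2 - A t \<omega> - ((M' t \<omega>)\<^sup>2 - A' t \<omega>))"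
      using MM zA
    proof eventually_elim
      case (elim \<omega>)
      have FV: "finite_variation_on T (\<lambda>t. A' t \<omega> - A t \<omega>)"
        using elim by (intro finite_variation_diff mono_finite_variation) auto
      have eq: "(M t \<omega>)\<^sup>2 - A t \<omega> - ((M' t \<omega>)\<^sup>2 - A' t \<omega>) = A' t \<omega> - A t \<omega>" if "t \<in> {0..T}" for t
        using elim(1) that by simp
      show ?case
        using FV fv_cong[of "\<lambda>t. (M t \<omega>)\<^sup>2 - A t \<omega> - ((M' t \<omega>)\<^sup>2 - A' t \<omega>)" "\<lambda>t. A' t \<omega> - A t \<omega>", OF eq] by simp
    qed
  qed
  let ?R = "restrict_space lborel {0<..T} :: real measure"
  interpret R: sigma_finite_measure ?R
    by (intro sigma_finite_measure_restrict_space sigma_finite_lborel) simp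
  interpret pair_sigma_finite P ?R ..
  note [measurable] = predictable_product_measurable[OF p(1)] predictable_product_measurable[OF p(2)]
    predictable_product_measurable[OF p'(1)] predictable_product_measurable[OF p'(2)]
  have "AE x in P \<Otimes>\<^sub>M ?R. (case x of (\<omega>, s) \<Rightarrow> \<beta> s \<omega>) = (case x of (\<omega>, s) \<Rightarrow> \<beta>' s \<omega>) \<and>
      (case x of (\<omega>, s) \<Rightarrow> \<alpha> s \<omega>) = (case x of (\<omega>, s) \<Rightarrow> \<alpha>' s \<omega>)"
  \<comment> \<open>Passing from iterated null sets to the product measure requires the set of
    agreement to be measurable, which predictability provides.\<close>
  proof (rule AE_pair_measure)
    show "{x \<in> space (P \<Otimes>\<^sub>M ?R). (case x of (\<omega>, s) \<Rightarrow> \<beta> s \<omega>) = (case x of (\<omega>, s) \<Rightarrow> \<beta>' s \<omega>) \<and>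
      (case x of (\<omega>, s) \<Rightarrow> \<alpha> s \<omega>) = (case x of (\<omega>, s) \<Rightarrow> \<alpha>' s \<omega>)} \<in> sets (P \<Otimes>\<^sub>M ?R)"
      by measurable
    show "AE \<omega> in P. AE s in ?R. (case (\<omega>, s) of (\<omega>, s) \<Rightarrow> \<beta> s \<omega>) = (case (\<omega>, s) of (\<omega>, s) \<Rightarrow> \<beta>' s \<omega>) \<and>
      (case (\<omega>, s) of (\<omega>, s) \<Rightarrow> \<alpha> s \<omega>) = (case (\<omega>, s) of (\<omega>, s) \<Rightarrow> \<alpha>' s \<omega>)"
      using MM AA dec 1(3,4)[unfolded is_time_integral_def] 2(3,4)[unfolded is_time_integral_def]
    proof eventually_elim
      case (elim \<omega>)
      have "AE s in ?R. \<beta> s \<omega> = \<beta>' s \<omega>"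
      proof (rule time_integral_determines_integrand)
        fix t assume t: "t \<in> {0..T}"
        have "B t \<omega> = B' t \<omega>"
          using elim(1)[rule_format, OF t] elim(3)[rule_format, OF t] elim(4)[rule_format, OF t] by linarith
        then show "time_integral (\<lambda>s. \<beta> s \<omega>) t = time_integral (\<lambda>s. \<beta>' s \<omega>) t"
          using elim(5,7) t by (simp add: time_integral_def)
      qed (rule elim(5)[THEN conjunct1] elim(7)[THEN conjunct1])+
      moreover have "AE s in ?R. \<alpha> s \<omega> = \<alpha>' s \<omega>"
      proof (rule time_integral_determines_integrand)
        fix t assume t: "t \<in> {0..T}"
        have "A t \<omega> = A' t \<omega>"
          using elim(1)[rule_format, OF t] elim(2)[rule_format, OF t] by simp
        then show "time_integral (\<lambda>s. \<alpha> s \<omega>) t = time_integral (\<lambda>s. \<alpha>' s \<omega>) t"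
          using elim(6,8) t by (simp add: time_integral_def)
      qed (rule elim(6)[THEN conjunct1] elim(8)[THEN conjunct1])+
      ultimately show ?case by eventually_elim simp
    qed
  qed
  then show ?thesis unfolding ae_path_time_def by eventually_elim auto
qed

end

section \<open>Integrands that are bounded along every path\<close>

text \<open>For surjectivity hold the slope at the value with the smallest product and raise the
  intercept; values beyond the reach of \<open>h0\<close> are obtained by fixing the intercept at
  \<open>h0\<close> and moving the slope.\<close>

lemma affine_range_interval:
  fixes y :: real
  assumes "l0 \<le> h0" "l1 \<le> h1"
  shows "{b0 + b1 * y | b0 b1. b0 \<in> {l0..h0} \<and> b1 \<in> {l1..h1}}
    = {l0 + min (l1 * y) (h1 * y)..h0 + max (l1 * y) (h1 * y)}"
proof (intro equalityI subsetI)
  fix z assume "z \<in> {b0 + b1 * y | b0 b1. b0 \<in> {l0..h0} \<and> b1 \<in> {l1..h1}}"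
  then obtain b0 b1 where z: "z = b0 + b1 * y" "l0 \<le> b0" "b0 \<le> h0" "l1 \<le> b1" "b1 \<le> h1" by auto
  have "min (l1 * y) (h1 * y) \<le> b1 * y" "b1 * y \<le> max (l1 * y) (h1 * y)"
    using z by (cases "0 \<le> y"; simp add: min_le_iff_disj le_max_iff_disj mult_right_mono mult_right_mono_neg)+
  with z show "z \<in> {l0 + min (l1 * y) (h1 * y)..h0 + max (l1 * y) (h1 * y)}" by auto
next
  fix z assume z: "z \<in> {l0 + min (l1 * y) (h1 * y)..h0 + max (l1 * y) (h1 * y)}"
  \<comment> \<open>The end point of the slope range that minimizes \<open>b1 * y\<close>; which of
    the two it is depends on the sign of \<open>y\<close>.\<close>
  define c where "c = (if l1 * y \<le> h1 * y then l1 else h1)"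
  have c: "c \<in> {l1..h1}" "min (l1 * y) (h1 * y) = c * y" using assms by (auto simp: c_def min_def)
  show "z \<in> {b0 + b1 * y | b0 b1. b0 \<in> {l0..h0} \<and> b1 \<in> {l1..h1}}"
  proof (cases "z - c * y \<le> h0")
    case True
    then have "z = (z - c * y) + c * y" "z - c * y \<in> {l0..h0}" using z c by auto
    with c show ?thesis by blast
  next
    case False
    have y: "y \<noteq> 0" using False z c by auto
    have "(z - h0) / y \<in> {l1..h1}"
    proof (cases "0 < y")
      case True
      then have "l1 * y \<le> h1 * y" using assms by (simp add: mult_right_mono)
      then have "l1 * y \<le> z - h0" "z - h0 \<le> h1 * y" using False z c by auto
      with True show ?thesis by (simp add: field_simps)
    next
      case neg: False
      then have "y < 0" using y by simp
      then have "h1 * y \<le> l1 * y" using assms by (simp add: mult_right_mono_neg)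
      then have "h1 * y \<le> z - h0" "z - h0 \<le> l1 * y" using False z c by auto
      with \<open>y < 0\<close> show ?thesis by (simp add: field_simps)
    qed
    moreover have "z = h0 + (z - h0) / y * y" using y by simp
    moreover have "h0 \<in> {l0..h0}" using assms by simp
    ultimately show ?thesis by blast
  qed
qed

text \<open>Only increments enter the test, so initial values may be added or removed.\<close>

lemma (in filtered_prob) centered_cong_increments:
  assumes "\<And>s t \<omega>. 0 \<le> s \<Longrightarrow> s \<le> t \<Longrightarrow> t \<le> T \<Longrightarrow> \<omega> \<in> space P \<Longrightarrow> N t \<omega> - N s \<omega> = N' t \<omega> - N' s \<omega>"
    and "centered N"
  shows "centered N'"
  unfolding centered_def
proof safe
  fix s t :: real and Z :: "'a \<Rightarrow> real"
  assume st: "0 \<le> s" "s \<le> t" "t \<le> T" and Z: "Z \<in> borel_measurable (F s)" "ae_bounded Z"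
  have "expectation (\<lambda>\<omega>. Z \<omega> * (N' t \<omega> - N' s \<omega>)) = expectation (\<lambda>\<omega>. Z \<omega> * (N t \<omega> - N s \<omega>))"
    by (intro Bochner_Integration.integral_cong refl) (simp only: assms(1)[OF st])
  with centeredD[OF assms(2) st Z] show "expectation (\<lambda>\<omega>. Z \<omega> * (N' t \<omega> - N' s \<omega>)) = 0" by simp
qed

context path_space
begin

text \<open>\<open>B\<close>, \<open>M\<close> and \<open>A\<close> are kept: by Fubini almost every
  path sees the integrands change on a null set of times, so the time integrals stay the same.
  Nonnegativity of the second characteristic is demanded at every point and therefore assumed
  separately.\<close>

lemma differential_characteristics_modification:
  assumes dc: "differential_characteristics T P Y \<beta> \<alpha>"
    and p: "predictable T \<beta>'" "predictable T \<alpha>'"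
    and nonneg: "\<And>\<omega> s. \<omega> \<in> paths T \<Longrightarrow> s \<in> {0..T} \<Longrightarrow> 0 \<le> \<alpha>' s \<omega>"
    and ae: "ae_path_time T P (\<lambda>\<omega> s. \<beta>' s \<omega> = \<beta> s \<omega> \<and> \<alpha>' s \<omega> = \<alpha> s \<omega>)"
  shows "differential_characteristics T P Y \<beta>' \<alpha>'"
proof -
  from dc obtain B M A where 1: "semimartingale_decomposition T P Y B M" "angle_bracket T P M A"
      "is_time_integral T P B \<beta>" "is_time_integral T P A \<alpha>"
    and p0: "predictable T \<beta>" "predictable T \<alpha>"
    unfolding differential_characteristics_def by blast
  let ?R = "restrict_space lborel {0<..T} :: real measure"
  interpret R: sigma_finite_measure ?R
    by (intro sigma_finite_measure_restrict_space sigma_finite_lborel) simp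
  interpret pair_sigma_finite P ?R ..
  have ae_path: "AE \<omega> in P. AE s in ?R. \<beta>' s \<omega> = \<beta> s \<omega> \<and> \<alpha>' s \<omega> = \<alpha> s \<omega>"
    using AE_pair[OF ae[unfolded ae_path_time_def]] by simp
  have transfer: "is_time_integral T P C g'"
    if C: "is_time_integral T P C g" and g: "predictable T g" "predictable T g'"
      and eq: "AE \<omega> in P. AE s in ?R. g' s \<omega> = g s \<omega>" for C g g'
    unfolding is_time_integral_def
    using C[unfolded is_time_integral_def] eq AE_space
  proof eventually_elim
    case (elim \<omega>)
    have \<omega>: "\<omega> \<in> paths T" using elim by simp
    have "AE s in lborel. s \<in> {0<..T} \<longrightarrow> g' s \<omega> = g s \<omega>"
      using elim(2) by (simp add: AE_restrict_space_iff)
    \<comment> \<open>Time 0 is absent from the product measure and is added back as a single point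
      of measure 0.\<close>
    then have eq': "AE s in lborel. s \<in> {0..T} \<longrightarrow> g' s \<omega> = g s \<omega>"
      using AE_lborel_singleton[of 0] by eventually_elim auto
    have m: "(\<lambda>s. indicator {0..T} s *\<^sub>R g' s \<omega>) \<in> borel_measurable lborel"
        "(\<lambda>s. indicator {0..T} s *\<^sub>R g s \<omega>) \<in> borel_measurable lborel"
      using predictable_path_measurable[OF g(1) \<omega>] predictable_path_measurable[OF g(2) \<omega>]
      by (simp_all add: set_borel_measurable_def)
    have ae_ind: "AE s in lborel. indicator {0..T} s *\<^sub>R g s \<omega> = indicator {0..T} s *\<^sub>R g' s \<omega>"
      using eq' by eventually_elim (auto simp: indicator_def)
    have int: "set_integrable lborel {0..T} (\<lambda>s. g' s \<omega>)"
      using elim(1)[THEN conjunct1] unfolding set_integrable_def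
      by (rule integrable_cong_AE[THEN iffD1, rotated 3]) (use m ae_ind in simp_all)
    have "time_integral (\<lambda>s. g' s \<omega>) t = time_integral (\<lambda>s. g s \<omega>) t" if t: "t \<in> {0..T}" for t
      unfolding time_integral_def set_lebesgue_integral_def
    proof (rule integral_cong_AE)
      have *: "(\<lambda>s. indicator {0..t} s *\<^sub>R h s) = (\<lambda>s. indicator {0..t} s *\<^sub>R (indicator {0..T} s *\<^sub>R h s))" for h :: "real \<Rightarrow> real"
        using t by (auto simp: indicator_def)
      show "(\<lambda>s. indicator {0..t} s *\<^sub>R g' s \<omega>) \<in> borel_measurable lborel"
          "(\<lambda>s. indicator {0..t} s *\<^sub>R g s \<omega>) \<in> borel_measurable lborel"
        by (subst *, intro borel_measurable_scaleR m borel_measurable_indicator, simp)+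
      show "AE s in lborel. indicator {0..t} s *\<^sub>R g' s \<omega> = indicator {0..t} s *\<^sub>R g s \<omega>"
        using eq' by eventually_elim (use t in \<open>auto simp: indicator_def\<close>)
    qed
    with int elim(1)[THEN conjunct2] show ?case by (simp add: time_integral_def)
  qed
  have ae_path1: "AE \<omega> in P. AE s in ?R. \<beta>' s \<omega> = \<beta> s \<omega>"
    using ae_path
  proof eventually_elim
    case (elim \<omega>)
    then show ?case by eventually_elim (rule conjunct1)
  qed
  have ae_path2: "AE \<omega> in P. AE s in ?R. \<alpha>' s \<omega> = \<alpha> s \<omega>"
    using ae_path
  proof eventually_elim
    case (elim \<omega>)
    then show ?case by eventually_elim (rule conjunct2)
  qed
  have tB: "is_time_integral T P B \<beta>'" by (rule transfer[OF 1(3) p0(1) p(1) ae_path1])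
  have tA: "is_time_integral T P A \<alpha>'" by (rule transfer[OF 1(4) p0(2) p(2) ae_path2])
  have nn: "\<forall>\<omega>\<in>paths T. \<forall>s\<in>{0..T}. 0 \<le> \<alpha>' s \<omega>" using nonneg by simp
  have "semimartingale_decomposition T P Y B M \<and> angle_bracket T P M A \<and>
        is_time_integral T P B \<beta>' \<and> is_time_integral T P A \<alpha>'"
    by (rule conjI[OF 1(1) conjI[OF 1(2) conjI[OF tB tA]]])
  then have "\<exists>B M A. semimartingale_decomposition T P Y B M \<and> angle_bracket T P M A \<and>
        is_time_integral T P B \<beta>' \<and> is_time_integral T P A \<alpha>'"
    by (intro exI)
  then show ?thesis
    unfolding differential_characteristics_def by (rule conjI[OF p(1) conjI[OF p(2) conjI[OF nn]]])
qed

definition regular_integrand :: "process \<Rightarrow> bool" where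
  "regular_integrand g \<longleftrightarrow> predictable T g \<and> path_bounded g"

lemma regular_integrandD: "regular_integrand g \<Longrightarrow> predictable T g" "regular_integrand g \<Longrightarrow> path_bounded g"
  by (simp_all add: regular_integrand_def)

lemma regular_integrable:
  "regular_integrand g \<Longrightarrow> \<omega> \<in> paths T \<Longrightarrow> set_integrable lborel {0..T} (\<lambda>s. g s \<omega>)"
  using path_bounded_integrable[of g \<omega>] regular_integrandD[of g] by simp

lemma predictable_compose:
  assumes "continuous_on UNIV h"
  shows "predictable T (\<lambda>s \<omega>. h (canonical s \<omega>))"
proof -
  have "h \<in> borel_measurable borel" using assms by (rule borel_measurable_continuous_onI)
  from measurable_compose[OF predictable_canonical[unfolded predictable_def] this] show ?thesis
    unfolding predictable_def by (simp only: case_prod_beta')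
qed

lemma predictable_add: "predictable T g \<Longrightarrow> predictable T h \<Longrightarrow> predictable T (\<lambda>s \<omega>. g s \<omega> + h s \<omega>)"
  unfolding predictable_def case_prod_beta' by (rule borel_measurable_add)

lemma predictable_mult: "predictable T g \<Longrightarrow> predictable T h \<Longrightarrow> predictable T (\<lambda>s \<omega>. g s \<omega> * h s \<omega>)"
  unfolding predictable_def case_prod_beta' by (rule borel_measurable_times)

lemma predictable_max: "predictable T g \<Longrightarrow> predictable T h \<Longrightarrow> predictable T (\<lambda>s \<omega>. max (g s \<omega>) (h s \<omega>))"
  unfolding predictable_def case_prod_beta' by (rule borel_measurable_max)

lemma predictable_min: "predictable T g \<Longrightarrow> predictable T h \<Longrightarrow> predictable T (\<lambda>s \<omega>. min (g s \<omega>) (h s \<omega>))"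
  unfolding predictable_def case_prod_beta' by (rule borel_measurable_min)

lemma regular_integrand_compose:
  assumes h: "continuous_on UNIV h"
  shows "regular_integrand (\<lambda>s \<omega>. h (canonical s \<omega>))"
  unfolding regular_integrand_def path_bounded_def
proof (intro conjI ballI predictable_compose h)
  fix \<omega> assume "\<omega> \<in> paths T"
  then have "continuous_on {0..T} (\<lambda>s. h (\<omega> s))"
    by (intro continuous_on_compose2[OF h] path_continuous) auto
  then have "compact ((\<lambda>s. h (\<omega> s)) ` {0..T})" by (intro compact_continuous_image) auto
  then have "bounded ((\<lambda>s. h (\<omega> s)) ` {0..T})" by (rule compact_imp_bounded)
  then show "\<exists>c. \<forall>s\<in>{0..T}. \<bar>h (canonical s \<omega>)\<bar> \<le> c"
    by (auto simp: bounded_iff canonical_def)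
qed

lemma regular_integrand_add:
  assumes "regular_integrand g" "regular_integrand h"
  shows "regular_integrand (\<lambda>s \<omega>. g s \<omega> + h s \<omega>)"
  unfolding regular_integrand_def path_bounded_def
proof (intro conjI ballI predictable_add regular_integrandD assms)
  fix \<omega> assume "\<omega> \<in> paths T"
  then obtain c d where "\<And>s. s \<in> {0..T} \<Longrightarrow> \<bar>g s \<omega>\<bar> \<le> c" "\<And>s. s \<in> {0..T} \<Longrightarrow> \<bar>h s \<omega>\<bar> \<le> d"
    using assms unfolding regular_integrand_def path_bounded_def by blast
  then have "\<bar>g s \<omega> + h s \<omega>\<bar> \<le> c + d" if "s \<in> {0..T}" for s
    using that by (intro order_trans[OF abs_triangle_ineq] add_mono)
  then show "\<exists>c. \<forall>s\<in>{0..T}. \<bar>g s \<omega> + h s \<omega>\<bar> \<le> c" by blast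
qed

lemma regular_integrand_mult:
  assumes "regular_integrand g" "regular_integrand h"
  shows "regular_integrand (\<lambda>s \<omega>. g s \<omega> * h s \<omega>)"
  unfolding regular_integrand_def path_bounded_def
proof (intro conjI ballI predictable_mult regular_integrandD assms)
  fix \<omega> assume "\<omega> \<in> paths T"
  then obtain c d where "\<And>s. s \<in> {0..T} \<Longrightarrow> \<bar>g s \<omega>\<bar> \<le> c" "\<And>s. s \<in> {0..T} \<Longrightarrow> \<bar>h s \<omega>\<bar> \<le> d"
    using assms unfolding regular_integrand_def path_bounded_def by blast
  then have "\<bar>g s \<omega> * h s \<omega>\<bar> \<le> c * d" if "s \<in> {0..T}" for s
    unfolding abs_mult using that by (intro mult_mono') auto
  then show "\<exists>c. \<forall>s\<in>{0..T}. \<bar>g s \<omega> * h s \<omega>\<bar> \<le> c" by blast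
qed

text \<open>In contrast to \<open>path_bounded\<close>, one constant serves almost all paths, but
  only up to and including time \<open>\<rho>\<close>. This is the boundedness that localization
  produces.\<close>

definition bounded_until :: "(path \<Rightarrow> real) \<Rightarrow> process \<Rightarrow> bool" where
  "bounded_until \<rho> g \<longleftrightarrow> (\<exists>c. AE \<omega> in P. \<forall>s\<in>{0..T}. s \<le> \<rho> \<omega> \<longrightarrow> \<bar>g s \<omega>\<bar> \<le> c)"

lemma bounded_until_add:
  assumes "bounded_until \<rho> g" "bounded_until \<rho> h"
  shows "bounded_until \<rho> (\<lambda>s \<omega>. g s \<omega> + h s \<omega>)"
proof -
  obtain c d where "AE \<omega> in P. \<forall>s\<in>{0..T}. s \<le> \<rho> \<omega> \<longrightarrow> \<bar>g s \<omega>\<bar> \<le> c" "AE \<omega> in P. \<forall>s\<in>{0..T}. s \<le> \<rho> \<omega> \<longrightarrow> \<bar>h s \<omega>\<bar> \<le> d"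
    using assms unfolding bounded_until_def by blast
  then have "AE \<omega> in P. \<forall>s\<in>{0..T}. s \<le> \<rho> \<omega> \<longrightarrow> \<bar>g s \<omega> + h s \<omega>\<bar> \<le> c + d"
    by eventually_elim (blast intro: order_trans[OF abs_triangle_ineq] add_mono)
  then show ?thesis unfolding bounded_until_def by blast
qed

lemma bounded_until_mult:
  assumes "bounded_until \<rho> g" "bounded_until \<rho> h"
  shows "bounded_until \<rho> (\<lambda>s \<omega>. g s \<omega> * h s \<omega>)"
proof -
  obtain c d where "AE \<omega> in P. \<forall>s\<in>{0..T}. s \<le> \<rho> \<omega> \<longrightarrow> \<bar>g s \<omega>\<bar> \<le> c" "AE \<omega> in P. \<forall>s\<in>{0..T}. s \<le> \<rho> \<omega> \<longrightarrow> \<bar>h s \<omega>\<bar> \<le> d"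
    using assms unfolding bounded_until_def by blast
  then have "AE \<omega> in P. \<forall>s\<in>{0..T}. s \<le> \<rho> \<omega> \<longrightarrow> \<bar>g s \<omega> * h s \<omega>\<bar> \<le> c * d"
    unfolding abs_mult by eventually_elim (simp add: mult_mono')
  then show ?thesis unfolding bounded_until_def by blast
qed

lemma bounded_until_compose:
  assumes "bounded_until \<rho> canonical" "continuous_on UNIV h"
  shows "bounded_until \<rho> (\<lambda>s \<omega>. h (canonical s \<omega>))"
proof -
  obtain c where c: "AE \<omega> in P. \<forall>s\<in>{0..T}. s \<le> \<rho> \<omega> \<longrightarrow> \<bar>canonical s \<omega>\<bar> \<le> c"
    using assms(1) unfolding bounded_until_def by blast
  have "compact (h ` {-c..c})"
    by (intro compact_continuous_image continuous_on_subset[OF assms(2)]) auto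
  then have "bounded (h ` {-c..c})" by (rule compact_imp_bounded)
  then obtain d where d: "\<And>y. y \<in> {-c..c} \<Longrightarrow> \<bar>h y\<bar> \<le> d" by (fastforce simp: bounded_iff)
  from c have "AE \<omega> in P. \<forall>s\<in>{0..T}. s \<le> \<rho> \<omega> \<longrightarrow> \<bar>h (canonical s \<omega>)\<bar> \<le> d"
  proof eventually_elim
    case (elim \<omega>)
    show ?case
    proof (intro ballI impI)
      fix s assume "s \<in> {0..T}" "s \<le> \<rho> \<omega>"
      then have "\<bar>canonical s \<omega>\<bar> \<le> c" using elim by blast
      then show "\<bar>h (canonical s \<omega>)\<bar> \<le> d" by (intro d) (simp add: abs_le_iff)
    qed
  qed
  then show ?thesis unfolding bounded_until_def by blast
qed

text \<open>The stopped integral is constant after \<open>\<rho>\<close>, and up to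
  \<open>\<rho>\<close> one constant bounds the integrand. Capping two times at
  \<open>\<rho>\<close> does not increase their distance.\<close>

lemma stopped_time_integral_lipschitz:
  assumes g: "regular_integrand g" "bounded_until \<rho> g" and \<rho>: "\<And>\<omega>. \<omega> \<in> paths T \<Longrightarrow> 0 \<le> \<rho> \<omega>"
  shows "\<exists>c\<ge>0. AE \<omega> in P. \<forall>s\<in>{0..T}. \<forall>t\<in>{s..T}.
    \<bar>time_integral (\<lambda>r. g r \<omega>) (min t (\<rho> \<omega>)) - time_integral (\<lambda>r. g r \<omega>) (min s (\<rho> \<omega>))\<bar> \<le> c * (t - s)"
proof -
  obtain c where c: "AE \<omega> in P. \<forall>s\<in>{0..T}. s \<le> \<rho> \<omega> \<longrightarrow> \<bar>g s \<omega>\<bar> \<le> c"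
    using g(2) unfolding bounded_until_def by blast
  have "AE \<omega> in P. \<forall>s\<in>{0..T}. \<forall>t\<in>{s..T}.
    \<bar>time_integral (\<lambda>r. g r \<omega>) (min t (\<rho> \<omega>)) - time_integral (\<lambda>r. g r \<omega>) (min s (\<rho> \<omega>))\<bar> \<le> \<bar>c\<bar> * (t - s)"
    using c AE_space
  proof eventually_elim
    case (elim \<omega>)
    then have \<omega>: "\<omega> \<in> paths T" by simp
    show ?case
    proof (intro ballI)
      fix s t assume st: "s \<in> {0..T}" "t \<in> {s..T}"
      have "\<bar>time_integral (\<lambda>r. g r \<omega>) (min t (\<rho> \<omega>)) - time_integral (\<lambda>r. g r \<omega>) (min s (\<rho> \<omega>))\<bar>
          \<le> \<bar>c\<bar> * (min t (\<rho> \<omega>) - min s (\<rho> \<omega>))"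
      proof (rule time_integral_increment_le[OF regular_integrable[OF g(1) \<omega>]])
        fix r assume "min s (\<rho> \<omega>) \<le> r" "r \<le> min t (\<rho> \<omega>)"
        then have "r \<in> {0..T}" "r \<le> \<rho> \<omega>" using st \<rho>[OF \<omega>] by auto
        then show "\<bar>g r \<omega>\<bar> \<le> \<bar>c\<bar>" using elim(1) by (meson abs_ge_self order_trans)
      qed (use st \<rho>[OF \<omega>] in auto)
      also have "\<dots> \<le> \<bar>c\<bar> * (t - s)" using st by (intro mult_left_mono) auto
      finally show "\<bar>time_integral (\<lambda>r. g r \<omega>) (min t (\<rho> \<omega>)) - time_integral (\<lambda>r. g r \<omega>) (min s (\<rho> \<omega>))\<bar> \<le> \<bar>c\<bar> * (t - s)" .
    qed
  qed
  then show ?thesis by (intro exI[of _ "\<bar>c\<bar>"]) simp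
qed

lemma stopped_time_integral_ae_bounded:
  assumes g: "regular_integrand g" "bounded_until \<rho> g" and \<rho>: "\<And>\<omega>. \<omega> \<in> paths T \<Longrightarrow> 0 \<le> \<rho> \<omega>"
    and t: "0 \<le> t" "t \<le> T"
  shows "ae_bounded (\<lambda>\<omega>. time_integral (\<lambda>r. g r \<omega>) (min t (\<rho> \<omega>)))"
proof -
  obtain c where c: "AE \<omega> in P. \<forall>s\<in>{0..T}. \<forall>t\<in>{s..T}.
    \<bar>time_integral (\<lambda>r. g r \<omega>) (min t (\<rho> \<omega>)) - time_integral (\<lambda>r. g r \<omega>) (min s (\<rho> \<omega>))\<bar> \<le> c * (t - s)"
    using stopped_time_integral_lipschitz[OF g \<rho>] by blast
  show ?thesis
  proof (rule ae_boundedI)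
    show "AE \<omega> in P. \<bar>time_integral (\<lambda>r. g r \<omega>) (min t (\<rho> \<omega>))\<bar> \<le> c * t"
      using c AE_space
    proof eventually_elim
      case (elim \<omega>)
      have "min 0 (\<rho> \<omega>) = 0" using \<rho> elim(2) by simp
      with elim(1)[rule_format, of 0 t] t show ?case by simp
    qed
  qed
qed

end

section \<open>Differential characteristics of a transformed process\<close>

context path_space
begin

lemma stopped_riemann_sum:
  fixes \<rho> :: real
  assumes g: "regular_integrand g" and h: "continuous_on UNIV h" and \<omega>: "\<omega> \<in> paths T"
    and st: "0 \<le> s" "s \<le> t" "t \<le> T" and \<rho>: "0 \<le> \<rho>"
  shows "(\<lambda>n. \<Sum>i<n. h (canonical (min (grid s t n i) \<rho>) \<omega>)
      * (time_integral (\<lambda>r. g r \<omega>) (min (grid s t n (Suc i)) \<rho>) - time_integral (\<lambda>r. g r \<omega>) (min (grid s t n i) \<rho>)))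
    \<longlonglongrightarrow> time_integral (\<lambda>r. h (canonical r \<omega>) * g r \<omega>) (min t \<rho>) - time_integral (\<lambda>r. h (canonical r \<omega>) * g r \<omega>) (min s \<rho>)"
proof -
  obtain c where c: "\<And>r. r \<in> {0..T} \<Longrightarrow> \<bar>g r \<omega>\<bar> \<le> c"
    using regular_integrandD(2)[OF g] \<omega> unfolding path_bounded_def by blast
  have cont: "continuous_on {0..T} (\<lambda>r. h (canonical r \<omega>))"
    using continuous_on_compose2[OF h path_continuous[OF \<omega>]] by (simp add: canonical_def)
  show ?thesis
    by (rule riemann_sum_time_integral[where g = "\<lambda>r. g r \<omega>" and \<phi> = "\<lambda>r. h (canonical r \<omega>)" and \<rho> = \<rho>,
          OF predictable_path_measurable[OF regular_integrandD(1)[OF g] \<omega>] c cont st \<rho>])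
qed

text \<open>Linear growth lets the hitting times of |X| bound both integrands, and with them all
  processes involved. The change of variables for \<open>f\<close> and for its square gives drifts
  \<open>j1\<close> and \<open>j2\<close>; with \<open>j3 = f j1\<close> the bracket theorem
  compensates the squared martingale part by the integral of \<open>j2 - 2 j3\<close>, which is the
  claimed second characteristic.\<close>

theorem ito_differential_characteristics:
  fixes f f' f'' :: "real \<Rightarrow> real"
  assumes dc: "differential_characteristics T P canonical \<beta> \<alpha>"
    and growth: "\<And>s \<omega>. \<omega> \<in> paths T \<Longrightarrow> s \<in> {0..T} \<Longrightarrow> \<bar>\<beta> s \<omega>\<bar> \<le> \<kappa> * (1 + \<bar>canonical s \<omega>\<bar>)"
      "\<And>s \<omega>. \<omega> \<in> paths T \<Longrightarrow> s \<in> {0..T} \<Longrightarrow> \<bar>\<alpha> s \<omega>\<bar> \<le> \<kappa> * (1 + \<bar>canonical s \<omega>\<bar>)" "0 \<le> \<kappa>"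
    and initial: "AE \<omega> in P. canonical 0 \<omega> = x"
    and f': "\<And>y. (f has_real_derivative f' y) (at y)"
    and f'': "\<And>y. (f' has_real_derivative f'' y) (at y)"
    and cont: "continuous_on UNIV f''"
  shows "differential_characteristics T P (\<lambda>t \<omega>. f (canonical t \<omega>))
    (\<lambda>s \<omega>. f' (canonical s \<omega>) * \<beta> s \<omega> + f'' (canonical s \<omega>) / 2 * \<alpha> s \<omega>)
    (\<lambda>s \<omega>. (f' (canonical s \<omega>))\<^sup>2 * \<alpha> s \<omega>)"
proof -
  from dc obtain B M A where dec: "semimartingale_decomposition T P canonical B M" and bracket: "angle_bracket T P M A"
      and int_B: "is_time_integral T P B \<beta>" and int_A: "is_time_integral T P A \<alpha>"
    and p: "predictable T \<beta>" "predictable T \<alpha>" and \<alpha>_nonneg: "\<forall>\<omega>\<in>paths T. \<forall>s\<in>{0..T}. 0 \<le> \<alpha> s \<omega>"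
    unfolding differential_characteristics_def by blast
  note dec' = dec[unfolded semimartingale_decomposition_def]
  note bracket' = bracket[unfolded angle_bracket_def]
  have B: "adapted T B" "continuous_process T B" and M: "continuous_process T M" "is_local_martingale T P M"
    and A: "adapted T A" "continuous_process T A"
    and M2: "is_local_martingale T P (\<lambda>t \<omega>. (M t \<omega>)\<^sup>2 - A t \<omega>)"
    and X_eq: "AE \<omega> in P. \<forall>t\<in>{0..T}. canonical t \<omega> = canonical 0 \<omega> + B t \<omega> + M t \<omega>"
    using dec' bracket' by auto
  have M_ad: "adapted T M" using M(2) by (simp add: is_local_martingale_def)
  have M2_cont: "continuous_process T (\<lambda>t \<omega>. (M t \<omega>)\<^sup>2 - A t \<omega>)"
    using M(1) A(2) by (auto simp: continuous_process_def intro!: continuous_intros)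
  have B_eq: "AE \<omega> in P. \<forall>t\<in>{0..T}. B t \<omega> = time_integral (\<lambda>s. \<beta> s \<omega>) t"
    using int_B unfolding is_time_integral_def by eventually_elim (simp add: time_integral_def)
  have A_eq: "AE \<omega> in P. \<forall>t\<in>{0..T}. A t \<omega> = time_integral (\<lambda>s. \<alpha> s \<omega>) t"
    using int_A unfolding is_time_integral_def by eventually_elim (simp add: time_integral_def)
  have cont_f: "continuous_on UNIV f" and cont_f': "continuous_on UNIV f'"
    using DERIV_isCont[OF f'] DERIV_isCont[OF f''] by (auto intro!: continuous_at_imp_continuous_on)
  have cont_f''2: "continuous_on UNIV (\<lambda>y. f'' y / 2)" using cont by (auto intro!: continuous_intros)
  have cont_growth: "continuous_on UNIV (\<lambda>y. \<kappa> * (1 + \<bar>y\<bar>))" by (intro continuous_intros)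
  have reg: "regular_integrand \<beta>" "regular_integrand \<alpha>"
  proof -
    have "path_bounded (\<lambda>s \<omega>. \<kappa> * (1 + \<bar>canonical s \<omega>\<bar>))"
      using regular_integrand_compose[OF cont_growth] by (simp add: regular_integrand_def)
    then have "\<exists>c. \<forall>s\<in>{0..T}. \<bar>g s \<omega>\<bar> \<le> c" if "\<omega> \<in> paths T" "\<And>s. s \<in> {0..T} \<Longrightarrow> \<bar>g s \<omega>\<bar> \<le> \<kappa> * (1 + \<bar>canonical s \<omega>\<bar>)" for g :: process and \<omega>
      using that unfolding path_bounded_def by (meson abs_ge_self order_trans)
    then show "regular_integrand \<beta>" "regular_integrand \<alpha>"
      using p growth unfolding regular_integrand_def path_bounded_def by blast+
  qed

  \<comment> \<open>First and second derivative of the square of \<open>f\<close>, the other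
    function to which the change of variables is applied.\<close>
  define f2' where "f2' y = 2 * f y * f' y" for y
  define f2'' where "f2'' y = 2 * (f' y)\<^sup>2 + 2 * f y * f'' y" for y
  have f2: "((\<lambda>y. (f y)\<^sup>2) has_real_derivative f2' y) (at y)" "(f2' has_real_derivative f2'' y) (at y)" for y
    unfolding f2'_def[abs_def] f2''_def
    by (auto intro!: derivative_eq_intros f' f'' simp: power2_eq_square algebra_simps)
  have cont_f2: "continuous_on UNIV f2'" "continuous_on UNIV f2''" "continuous_on UNIV (\<lambda>y. f2'' y / 2)"
    unfolding f2'_def[abs_def] f2''_def[abs_def] by (auto intro!: continuous_intros cont_f cont_f' cont)
  have cont_sq: "continuous_on UNIV (\<lambda>y. (f' y)\<^sup>2)" by (intro continuous_intros cont_f')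

  define j where "j h1 h2 s \<omega> = h1 (canonical s \<omega>) * \<beta> s \<omega> + h2 (canonical s \<omega>) * \<alpha> s \<omega>" for h1 h2 :: "real \<Rightarrow> real" and s \<omega>
  have j_reg: "regular_integrand (j h1 h2)" if "continuous_on UNIV h1" "continuous_on UNIV h2" for h1 h2
    unfolding j_def[abs_def]
    by (rule regular_integrand_add[OF regular_integrand_mult[OF regular_integrand_compose[OF that(1)] reg(1)]
          regular_integrand_mult[OF regular_integrand_compose[OF that(2)] reg(2)]])
  define j1 where "j1 = j f' (\<lambda>y. f'' y / 2)"
  define j2 where "j2 = j f2' (\<lambda>y. f2'' y / 2)"
  define j3 where "j3 s \<omega> = f (canonical s \<omega>) * j1 s \<omega>" for s \<omega>
  define jA where "jA s \<omega> = (f' (canonical s \<omega>))\<^sup>2 * \<alpha> s \<omega>" for s \<omega>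
  have j1: "regular_integrand j1" and j2: "regular_integrand j2"
    unfolding j1_def j2_def by (rule j_reg[OF cont_f' cont_f''2] j_reg[OF cont_f2(1,3)])+
  have j3: "regular_integrand j3" unfolding j3_def[abs_def]
    by (rule regular_integrand_mult[OF regular_integrand_compose[OF cont_f] j1])
  have jA: "regular_integrand jA" unfolding jA_def[abs_def]
    by (rule regular_integrand_mult[OF regular_integrand_compose[OF cont_sq] reg(2)])
  define J where "J g t \<omega> = time_integral (\<lambda>s. g s \<omega>) t" for g :: process and t \<omega>
  \<comment> \<open>Both \<open>\<beta>\<close> and \<open>f''\<close> cancel, since
    \<open>2 f f' \<beta> + ((f')^2 + f f'') \<alpha>\<close> minus
    \<open>2 f (f' \<beta> + f'' / 2 \<alpha>)\<close> equals
    \<open>(f')^2 \<alpha>\<close>.\<close>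
  have JA: "J jA t \<omega> = J j2 t \<omega> - 2 * J j3 t \<omega>" if \<omega>: "\<omega> \<in> paths T" and t: "t \<le> T" for t \<omega>
  proof -
    have "(\<lambda>s. jA s \<omega>) = (\<lambda>s. j2 s \<omega> - 2 * j3 s \<omega>)"
      unfolding jA_def j2_def j3_def j1_def j_def f2'_def f2''_def
      by (rule ext) (simp add: field_simps power2_eq_square)
    moreover have "set_integrable lborel {0..T} (\<lambda>s. 2 * j3 s \<omega>)"
      using regular_integrable[OF j3 \<omega>] by simp
    ultimately show ?thesis
      unfolding J_def using time_integral_diff[OF regular_integrable[OF j2 \<omega>] _ t, of "\<lambda>s. 2 * j3 s \<omega>"]
      by (simp add: time_integral_mult)
  qed

  define Y where "Y t \<omega> = \<bar>canonical t \<omega>\<bar>" for t \<omega>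
  have Y: "adapted T Y" "continuous_process T Y"
    using adapted_canonical continuous_process_canonical unfolding Y_def adapted_def continuous_process_def
    by (auto intro!: continuous_intros borel_measurable_abs)
  have until: "bounded_until \<rho> canonical"
    if \<rho>: "\<forall>\<omega>\<in>paths T. 0 \<le> \<rho> \<omega> \<and> \<rho> \<omega> \<le> hitting_time Y (real n) \<omega>" for n \<rho>
  proof -
    have "AE \<omega> in P. \<forall>s\<in>{0..T}. s \<le> \<rho> \<omega> \<longrightarrow> \<bar>canonical s \<omega>\<bar> \<le> max (real n) \<bar>x\<bar>"
      using initial AE_space
    proof eventually_elim
      case (elim \<omega>)
      then have \<omega>: "\<omega> \<in> paths T" by simp
      show ?case
      proof (intro ballI impI)
        fix s assume "s \<in> {0..T}" "s \<le> \<rho> \<omega>"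
        then have "Y s \<omega> \<le> max (real n) (Y 0 \<omega>)"
          using bspec[OF \<rho> \<omega>] by (intro process_le_until_hitting_time[where Y = Y, OF continuous_processD[OF Y(2) \<omega>]]) auto
        then show "\<bar>canonical s \<omega>\<bar> \<le> max (real n) \<bar>x\<bar>" using elim(1) by (simp add: Y_def)
      qed
    qed
    then show ?thesis unfolding bounded_until_def by blast
  qed
  have until_\<beta>\<alpha>: "bounded_until \<rho> \<beta>" "bounded_until \<rho> \<alpha>" if \<rho>: "bounded_until \<rho> canonical" for \<rho>
  proof -
    obtain c where c: "AE \<omega> in P. \<forall>s\<in>{0..T}. s \<le> \<rho> \<omega> \<longrightarrow> \<bar>\<kappa> * (1 + \<bar>canonical s \<omega>\<bar>)\<bar> \<le> c"
      using bounded_until_compose[OF \<rho> cont_growth] unfolding bounded_until_def by blast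
    have "bounded_until \<rho> g" if g: "\<And>s \<omega>. \<omega> \<in> paths T \<Longrightarrow> s \<in> {0..T} \<Longrightarrow> \<bar>g s \<omega>\<bar> \<le> \<kappa> * (1 + \<bar>canonical s \<omega>\<bar>)" for g
    proof -
      have "AE \<omega> in P. \<forall>s\<in>{0..T}. s \<le> \<rho> \<omega> \<longrightarrow> \<bar>g s \<omega>\<bar> \<le> c"
        using c AE_space
      proof eventually_elim
        case (elim \<omega>)
        show ?case
        proof (intro ballI impI)
          fix s assume s: "s \<in> {0..T}" "s \<le> \<rho> \<omega>"
          have "\<bar>g s \<omega>\<bar> \<le> \<kappa> * (1 + \<bar>canonical s \<omega>\<bar>)" using g elim(2) s(1) by simp
          also have "\<dots> \<le> \<bar>\<kappa> * (1 + \<bar>canonical s \<omega>\<bar>)\<bar>" by (rule abs_ge_self)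
          also have "\<dots> \<le> c" using elim(1) s by blast
          finally show "\<bar>g s \<omega>\<bar> \<le> c" .
        qed
      qed
      then show ?thesis unfolding bounded_until_def by blast
    qed
    with growth show "bounded_until \<rho> \<beta>" "bounded_until \<rho> \<alpha>" by blast+
  qed
  have j_until: "bounded_until \<rho> (j h1 h2)" if "bounded_until \<rho> canonical" "continuous_on UNIV h1" "continuous_on UNIV h2" for \<rho> h1 h2
    unfolding j_def[abs_def]
    by (rule bounded_until_add[OF bounded_until_mult[OF bounded_until_compose[OF that(1,2)] until_\<beta>\<alpha>(1)[OF that(1)]]
          bounded_until_mult[OF bounded_until_compose[OF that(1,3)] until_\<beta>\<alpha>(2)[OF that(1)]]])

  have stopped_bounds: "\<exists>K C. 0 \<le> K \<and> 0 \<le> C \<and> (AE \<omega> in P. \<forall>t\<in>{0..T}. \<bar>canonical (min t (\<rho> \<omega>)) \<omega>\<bar> \<le> K)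
      \<and> (AE \<omega> in P. \<forall>t\<in>{0..T}. \<bar>M (min t (\<rho> \<omega>)) \<omega>\<bar> \<le> K)
      \<and> (AE \<omega> in P. \<forall>s\<in>{0..T}. \<forall>t\<in>{s..T}. \<bar>B (min t (\<rho> \<omega>)) \<omega> - B (min s (\<rho> \<omega>)) \<omega>\<bar> \<le> C * (t - s))
      \<and> (AE \<omega> in P. \<forall>s\<in>{0..T}. \<forall>t\<in>{s..T}. \<bar>A (min t (\<rho> \<omega>)) \<omega> - A (min s (\<rho> \<omega>)) \<omega>\<bar> \<le> C * (t - s))
      \<and> (AE \<omega> in P. \<forall>t\<in>{0..T}. \<bar>B (min t (\<rho> \<omega>)) \<omega>\<bar> \<le> C * T \<and> \<bar>A (min t (\<rho> \<omega>)) \<omega>\<bar> \<le> C * T)"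
    if \<rho>: "\<forall>\<omega>\<in>paths T. 0 \<le> \<rho> \<omega> \<and> \<rho> \<omega> \<le> hitting_time Y (real n) \<omega>" for n \<rho>
  proof -
    have nn: "0 \<le> \<rho> \<omega>" if "\<omega> \<in> paths T" for \<omega> using bspec[OF \<rho> that] by blast
    note unt = until[OF \<rho>]
    obtain k where k: "AE \<omega> in P. \<forall>s\<in>{0..T}. s \<le> \<rho> \<omega> \<longrightarrow> \<bar>canonical s \<omega>\<bar> \<le> k"
      using unt unfolding bounded_until_def by blast
    obtain c1 where c1: "0 \<le> c1" "AE \<omega> in P. \<forall>s\<in>{0..T}. \<forall>t\<in>{s..T}.
      \<bar>time_integral (\<lambda>r. \<beta> r \<omega>) (min t (\<rho> \<omega>)) - time_integral (\<lambda>r. \<beta> r \<omega>) (min s (\<rho> \<omega>))\<bar> \<le> c1 * (t - s)"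
      using stopped_time_integral_lipschitz[OF reg(1) until_\<beta>\<alpha>(1)[OF unt] nn] by blast
    obtain c2 where c2: "0 \<le> c2" "AE \<omega> in P. \<forall>s\<in>{0..T}. \<forall>t\<in>{s..T}.
      \<bar>time_integral (\<lambda>r. \<alpha> r \<omega>) (min t (\<rho> \<omega>)) - time_integral (\<lambda>r. \<alpha> r \<omega>) (min s (\<rho> \<omega>))\<bar> \<le> c2 * (t - s)"
      using stopped_time_integral_lipschitz[OF reg(2) until_\<beta>\<alpha>(2)[OF unt] nn] by blast
    define C where "C = max c1 c2"
    \<comment> \<open>\<open>M\<close> is recovered as the process minus its initial value minus
      \<open>B\<close>, so two values bounded by \<open>k\<close> and one bounded by
      \<open>C * T\<close> enter.\<close>
    define K where "K = 2 * \<bar>k\<bar> + C * T"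
    have C: "0 \<le> C" "c1 \<le> C" "c2 \<le> C" using c1 c2 by (auto simp: C_def)
    have K: "0 \<le> K" "\<bar>k\<bar> \<le> K" using C T_pos by (auto simp: K_def)
    have Bl: "AE \<omega> in P. \<forall>s\<in>{0..T}. \<forall>t\<in>{s..T}. \<bar>B (min t (\<rho> \<omega>)) \<omega> - B (min s (\<rho> \<omega>)) \<omega>\<bar> \<le> C * (t - s)"
      using c1(2) B_eq AE_space
    proof eventually_elim
      case (elim \<omega>)
      show ?case
      proof (intro ballI)
        fix s t assume st: "s \<in> {0..T}" "t \<in> {s..T}"
        then have "\<bar>B (min t (\<rho> \<omega>)) \<omega> - B (min s (\<rho> \<omega>)) \<omega>\<bar> \<le> c1 * (t - s)"
          using elim(1)[rule_format, OF st] elim(2)[rule_format, of "min t (\<rho> \<omega>)"] elim(2)[rule_format, of "min s (\<rho> \<omega>)"] nn elim(3) by auto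
        also have "\<dots> \<le> C * (t - s)" using C st by (intro mult_right_mono) auto
        finally show "\<bar>B (min t (\<rho> \<omega>)) \<omega> - B (min s (\<rho> \<omega>)) \<omega>\<bar> \<le> C * (t - s)" .
      qed
    qed
    have Al: "AE \<omega> in P. \<forall>s\<in>{0..T}. \<forall>t\<in>{s..T}. \<bar>A (min t (\<rho> \<omega>)) \<omega> - A (min s (\<rho> \<omega>)) \<omega>\<bar> \<le> C * (t - s)"
      using c2(2) A_eq AE_space
    proof eventually_elim
      case (elim \<omega>)
      show ?case
      proof (intro ballI)
        fix s t assume st: "s \<in> {0..T}" "t \<in> {s..T}"
        then have "\<bar>A (min t (\<rho> \<omega>)) \<omega> - A (min s (\<rho> \<omega>)) \<omega>\<bar> \<le> c2 * (t - s)"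
          using elim(1)[rule_format, OF st] elim(2)[rule_format, of "min t (\<rho> \<omega>)"] elim(2)[rule_format, of "min s (\<rho> \<omega>)"] nn elim(3) by auto
        also have "\<dots> \<le> C * (t - s)" using C st by (intro mult_right_mono) auto
        finally show "\<bar>A (min t (\<rho> \<omega>)) \<omega> - A (min s (\<rho> \<omega>)) \<omega>\<bar> \<le> C * (t - s)" .
      qed
    qed
    have BA: "AE \<omega> in P. \<forall>t\<in>{0..T}. \<bar>B (min t (\<rho> \<omega>)) \<omega>\<bar> \<le> C * T \<and> \<bar>A (min t (\<rho> \<omega>)) \<omega>\<bar> \<le> C * T"
      using Bl Al B_eq A_eq AE_space
    proof eventually_elim
      case (elim \<omega>)
      have 0: "min 0 (\<rho> \<omega>) = 0" "B 0 \<omega> = 0" "A 0 \<omega> = 0" using nn elim T_pos by auto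
      show ?case
      proof
        fix t assume t: "t \<in> {0..T}"
        have "\<bar>B (min t (\<rho> \<omega>)) \<omega>\<bar> \<le> C * t" "\<bar>A (min t (\<rho> \<omega>)) \<omega>\<bar> \<le> C * t"
          using elim(1)[rule_format, of 0 t] elim(2)[rule_format, of 0 t] t 0 by auto
        moreover have "C * t \<le> C * T" using t C by (intro mult_left_mono) auto
        ultimately show "\<bar>B (min t (\<rho> \<omega>)) \<omega>\<bar> \<le> C * T \<and> \<bar>A (min t (\<rho> \<omega>)) \<omega>\<bar> \<le> C * T" by simp
      qed
    qed
    have X: "AE \<omega> in P. \<forall>t\<in>{0..T}. \<bar>canonical (min t (\<rho> \<omega>)) \<omega>\<bar> \<le> k"
      using k AE_space
    proof eventually_elim
      case (elim \<omega>)
      have nn\<omega>: "0 \<le> \<rho> \<omega>" using nn elim(2) by simp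
      show ?case
      proof
        fix t assume "t \<in> {0..T}"
        then show "\<bar>canonical (min t (\<rho> \<omega>)) \<omega>\<bar> \<le> k"
          using elim(1)[rule_format, of "min t (\<rho> \<omega>)"] nn\<omega> by auto
      qed
    qed
    have XK: "AE \<omega> in P. \<forall>t\<in>{0..T}. \<bar>canonical (min t (\<rho> \<omega>)) \<omega>\<bar> \<le> K"
      using X
    proof eventually_elim
      case (elim \<omega>)
      have "k \<le> K" using K(2) by (rule order_trans[OF abs_ge_self])
      with elim show ?case by (blast intro: order_trans)
    qed
    have MK: "AE \<omega> in P. \<forall>t\<in>{0..T}. \<bar>M (min t (\<rho> \<omega>)) \<omega>\<bar> \<le> K"
      using X BA X_eq AE_space
    proof eventually_elim
      case (elim \<omega>)
      have nn\<omega>: "0 \<le> \<rho> \<omega>" using nn elim(4) by simp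
      show ?case
      proof
        fix t assume t: "t \<in> {0..T}"
        define u where "u = min t (\<rho> \<omega>)"
        have u: "u \<in> {0..T}" using t nn\<omega> by (auto simp: u_def)
        have "min 0 (\<rho> \<omega>) = 0" using nn\<omega> by simp
        then have "\<bar>canonical 0 \<omega>\<bar> \<le> k" using elim(1)[rule_format, of 0] T_pos by simp
        moreover have "\<bar>canonical u \<omega>\<bar> \<le> k" "\<bar>B u \<omega>\<bar> \<le> C * T"
          using elim(1)[rule_format, OF t] elim(2)[rule_format, OF t] by (auto simp: u_def)
        moreover have "M u \<omega> = canonical u \<omega> - canonical 0 \<omega> - B u \<omega>" using elim(3)[rule_format, OF u] by linarith
        ultimately have "\<bar>M u \<omega>\<bar> \<le> K" unfolding K_def by linarith
        then show "\<bar>M (min t (\<rho> \<omega>)) \<omega>\<bar> \<le> K" by (simp add: u_def)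
      qed
    qed
    show ?thesis
      by (rule exI[of _ K], rule exI[of _ C]) (intro conjI K C XK MK Bl Al BA)
  qed

  \<comment> \<open>Candidates for the martingale part of \<open>f (X)\<close> and for its
    compensated square. Regular integrands make both adapted, and continuous on every path.\<close>
  define Mf where "Mf t \<omega> = f (canonical t \<omega>) - f (canonical 0 \<omega>) - J j1 t \<omega>" for t \<omega>
  define Nf where "Nf t \<omega> = (Mf t \<omega>)\<^sup>2 - J jA t \<omega>" for t \<omega>
  have fX: "adapted T (\<lambda>t \<omega>. f (canonical t \<omega>))" "continuous_process T (\<lambda>t \<omega>. f (canonical t \<omega>))"
  proof -
    have [measurable]: "f \<in> borel_measurable borel" using cont_f by (rule borel_measurable_continuous_onI)
    show "adapted T (\<lambda>t \<omega>. f (canonical t \<omega>))"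
      using adapted_canonical unfolding adapted_def by (auto intro: measurable_compose[of _ _ borel])
    show "continuous_process T (\<lambda>t \<omega>. f (canonical t \<omega>))"
      unfolding continuous_process_def canonical_def
      by (intro ballI continuous_on_compose2[OF cont_f path_continuous]) auto
  qed
  have J_ad: "adapted T (J g)" and J_cont: "continuous_process T (J g)" if "regular_integrand g" for g
    unfolding J_def[abs_def] using adapted_time_integral path_bounded_time_integral(1) regular_integrandD[OF that] by auto
  have Mf: "adapted T Mf" "continuous_process T Mf"
  proof -
    show "adapted T Mf"
      unfolding Mf_def[abs_def] adapted_def
    proof
      fix t assume "t \<in> {0..T}"
      then have t: "0 \<le> t" "t \<le> T" by auto
      have "(\<lambda>\<omega>. f (canonical 0 \<omega>)) \<in> borel_measurable (raw_filtration T t)"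
        using t by (intro F_measurable_mono[OF adaptedD[OF fX(1)]]) auto
      then show "(\<lambda>\<omega>. f (canonical t \<omega>) - f (canonical 0 \<omega>) - J j1 t \<omega>) \<in> borel_measurable (raw_filtration T t)"
        by (intro borel_measurable_diff adaptedD[OF fX(1) t] adaptedD[OF J_ad[OF j1] t])
    qed
    show "continuous_process T Mf"
      using fX(2) J_cont[OF j1] unfolding continuous_process_def Mf_def by (auto intro!: continuous_intros)
  qed
  have Nf: "adapted T Nf" "continuous_process T Nf"
    using Mf J_ad[OF jA] J_cont[OF jA] unfolding Nf_def[abs_def] adapted_def continuous_process_def
    by (auto intro!: continuous_intros borel_measurable_diff borel_measurable_power)

  have local_martingales: "is_local_martingale T P Mf \<and> is_local_martingale T P Nf"
  proof -
    have bnd: "\<exists>c. AE \<omega> in P. \<forall>t\<in>{0..T}. \<bar>M (min t (\<rho> \<omega>)) \<omega>\<bar> \<le> c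
        \<and> \<bar>(M (min t (\<rho> \<omega>)) \<omega>)\<^sup>2 - A (min t (\<rho> \<omega>)) \<omega>\<bar> \<le> c"
      if \<rho>: "\<And>\<omega>. \<omega> \<in> paths T \<Longrightarrow> 0 \<le> \<rho> \<omega> \<and> \<rho> \<omega> \<le> hitting_time Y (real n) \<omega>" for n \<rho>
    proof -
      have \<rho>_ball: "\<forall>\<omega>\<in>paths T. 0 \<le> \<rho> \<omega> \<and> \<rho> \<omega> \<le> hitting_time Y (real n) \<omega>" using \<rho> by simp
      obtain K C where KC: "0 \<le> K" "0 \<le> C" and MK: "AE \<omega> in P. \<forall>t\<in>{0..T}. \<bar>M (min t (\<rho> \<omega>)) \<omega>\<bar> \<le> K"
        and BA: "AE \<omega> in P. \<forall>t\<in>{0..T}. \<bar>B (min t (\<rho> \<omega>)) \<omega>\<bar> \<le> C * T \<and> \<bar>A (min t (\<rho> \<omega>)) \<omega>\<bar> \<le> C * T"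
        using stopped_bounds[OF \<rho>_ball] by (elim exE conjE) (rule that)
      \<comment> \<open>The joint localization asks for one constant. All three summands are
        nonnegative, so their sum exceeds the bound \<open>K\<close> of \<open>M\<close> as well as
        the bound of its compensated square.\<close>
      have "AE \<omega> in P. \<forall>t\<in>{0..T}. \<bar>M (min t (\<rho> \<omega>)) \<omega>\<bar> \<le> K + K\<^sup>2 + C * T
        \<and> \<bar>(M (min t (\<rho> \<omega>)) \<omega>)\<^sup>2 - A (min t (\<rho> \<omega>)) \<omega>\<bar> \<le> K + K\<^sup>2 + C * T"
        using MK BA
      proof eventually_elim
        case (elim \<omega>)
        show ?case
        proof
          fix t assume t: "t \<in> {0..T}"
          define m a where "m = M (min t (\<rho> \<omega>)) \<omega>" and "a = A (min t (\<rho> \<omega>)) \<omega>"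
          have ma: "\<bar>m\<bar> \<le> K" "\<bar>a\<bar> \<le> C * T" using elim t by (auto simp: m_def a_def)
          have "m\<^sup>2 \<le> K\<^sup>2" using ma KC by (intro power2_le_iff_abs_le[THEN iffD2]) auto
          moreover have "0 \<le> C * T" using KC T_pos by simp
          moreover have "0 \<le> m\<^sup>2" "0 \<le> K\<^sup>2" by simp_all
          ultimately have "\<bar>m\<bar> \<le> K + K\<^sup>2 + C * T \<and> \<bar>m\<^sup>2 - a\<bar> \<le> K + K\<^sup>2 + C * T"
            using ma KC(1) by (intro conjI; linarith)
          then show "\<bar>M (min t (\<rho> \<omega>)) \<omega>\<bar> \<le> K + K\<^sup>2 + C * T
            \<and> \<bar>(M (min t (\<rho> \<omega>)) \<omega>)\<^sup>2 - A (min t (\<rho> \<omega>)) \<omega>\<bar> \<le> K + K\<^sup>2 + C * T"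
            unfolding m_def a_def .
        qed
      qed
      then show ?thesis by (rule exI)
    qed
    show ?thesis
    proof (rule common_localization[OF M M2_cont M2 Y bnd])
      fix \<rho>
      assume \<rho>_stop: "\<And>n. stopping_time (raw_filtration T) (\<rho> n)"
        and \<rho>_mono: "\<And>n \<omega>. \<omega> \<in> paths T \<Longrightarrow> 0 \<le> \<rho> n \<omega> \<and> \<rho> n \<omega> \<le> \<rho> (Suc n) \<omega>"
        and \<rho>_T: "AE \<omega> in P. \<exists>n. T \<le> \<rho> n \<omega>"
        and \<rho>_hit: "\<And>n \<omega>. \<omega> \<in> paths T \<Longrightarrow> \<rho> n \<omega> \<le> hitting_time Y (real n) \<omega>"
        and cM: "\<And>n. centered (\<lambda>t \<omega>. M (min t (\<rho> n \<omega>)) \<omega>)"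
        and cM2: "\<And>n. centered (\<lambda>t \<omega>. (M (min t (\<rho> n \<omega>)) \<omega>)\<^sup>2 - A (min t (\<rho> n \<omega>)) \<omega>)"
      have \<rho>_nn: "0 \<le> \<rho> n \<omega>" if "\<omega> \<in> paths T" for n \<omega> using \<rho>_mono[OF that] by blast
      have \<rho>_hit': "\<forall>\<omega>\<in>paths T. 0 \<le> \<rho> n \<omega> \<and> \<rho> n \<omega> \<le> hitting_time Y (real n) \<omega>" for n
        using \<rho>_hit \<rho>_nn by simp
      have stopped: "centered (\<lambda>t \<omega>. Mf (min t (\<rho> n \<omega>)) \<omega>) \<and> centered (\<lambda>t \<omega>. Nf (min t (\<rho> n \<omega>)) \<omega>)
          \<and> (\<forall>t. 0 \<le> t \<longrightarrow> t \<le> T \<longrightarrow> ae_bounded (\<lambda>\<omega>. Mf (min t (\<rho> n \<omega>)) \<omega>) \<and> ae_bounded (\<lambda>\<omega>. Nf (min t (\<rho> n \<omega>)) \<omega>))" for n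
      proof -
        obtain K C where KC: "0 \<le> K" "0 \<le> C"
          and XK: "AE \<omega> in P. \<forall>t\<in>{0..T}. \<bar>canonical (min t (\<rho> n \<omega>)) \<omega>\<bar> \<le> K"
          and MK: "AE \<omega> in P. \<forall>t\<in>{0..T}. \<bar>M (min t (\<rho> n \<omega>)) \<omega>\<bar> \<le> K"
          and Bl: "AE \<omega> in P. \<forall>s\<in>{0..T}. \<forall>t\<in>{s..T}. \<bar>B (min t (\<rho> n \<omega>)) \<omega> - B (min s (\<rho> n \<omega>)) \<omega>\<bar> \<le> C * (t - s)"
          and Al: "AE \<omega> in P. \<forall>s\<in>{0..T}. \<forall>t\<in>{s..T}. \<bar>A (min t (\<rho> n \<omega>)) \<omega> - A (min s (\<rho> n \<omega>)) \<omega>\<bar> \<le> C * (t - s)"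
          and BA: "AE \<omega> in P. \<forall>t\<in>{0..T}. \<bar>B (min t (\<rho> n \<omega>)) \<omega>\<bar> \<le> C * T \<and> \<bar>A (min t (\<rho> n \<omega>)) \<omega>\<bar> \<le> C * T"
          using stopped_bounds[OF \<rho>_hit'[of n]] by (elim exE conjE) (rule that)
        have unt: "bounded_until (\<rho> n) canonical" by (rule until[OF \<rho>_hit'[of n]])
        have sad: "(\<lambda>\<omega>. V (min t (\<rho> n \<omega>)) \<omega>) \<in> borel_measurable (raw_filtration T t)"
          if "adapted T V" "continuous_process T V" "0 \<le> t" "t \<le> T" for V t
          by (rule adaptedD[OF adapted_stopped[OF that(1,2) \<rho>_stop \<rho>_nn] that(3,4)])
        have cont_stop: "continuous_process T (\<lambda>t \<omega>. V (min t (\<rho> n \<omega>)) \<omega>)" if "continuous_process T V" for V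
          by (rule continuous_process_stopped[OF that \<rho>_nn])
        interpret ito_setting P "raw_filtration T" T "\<lambda>t \<omega>. M (min t (\<rho> n \<omega>)) \<omega>" "\<lambda>t \<omega>. A (min t (\<rho> n \<omega>)) \<omega>" K C
          "\<lambda>t \<omega>. canonical (min t (\<rho> n \<omega>)) \<omega>" "\<lambda>t \<omega>. B (min t (\<rho> n \<omega>)) \<omega>"
        proof unfold_locales
          show "0 \<le> K" "0 \<le> C" by fact+
          show "(\<lambda>\<omega>. M (min t (\<rho> n \<omega>)) \<omega>) \<in> borel_measurable (raw_filtration T t)" if "0 \<le> t" "t \<le> T" for t
            by (rule sad[OF M_ad M(1) that])
          show "(\<lambda>\<omega>. A (min t (\<rho> n \<omega>)) \<omega>) \<in> borel_measurable (raw_filtration T t)" if "0 \<le> t" "t \<le> T" for t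
            by (rule sad[OF A that])
          show "(\<lambda>\<omega>. B (min t (\<rho> n \<omega>)) \<omega>) \<in> borel_measurable (raw_filtration T t)" if "0 \<le> t" "t \<le> T" for t
            by (rule sad[OF B that])
          show "(\<lambda>\<omega>. canonical (min t (\<rho> n \<omega>)) \<omega>) \<in> borel_measurable (raw_filtration T t)" if "0 \<le> t" "t \<le> T" for t
            by (rule sad[OF adapted_canonical continuous_process_canonical that])
          show "AE \<omega> in P. \<forall>t\<in>{0..T}. \<bar>M (min t (\<rho> n \<omega>)) \<omega>\<bar> \<le> K" by (rule MK)
          show "AE \<omega> in P. \<forall>t\<in>{0..T}. \<bar>canonical (min t (\<rho> n \<omega>)) \<omega>\<bar> \<le> K" by (rule XK)
          show "ae_bounded (\<lambda>\<omega>. A (min t (\<rho> n \<omega>)) \<omega>)" if "0 \<le> t" "t \<le> T" for t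
            by (rule ae_boundedI[of _ "C * T"], use BA in eventually_elim, use that in auto)
          show "ae_bounded (\<lambda>\<omega>. B (min t (\<rho> n \<omega>)) \<omega>)" if "0 \<le> t" "t \<le> T" for t
            by (rule ae_boundedI[of _ "C * T"], use BA in eventually_elim, use that in auto)
          show "AE \<omega> in P. \<forall>s\<in>{0..T}. \<forall>t\<in>{s..T}. \<bar>A (min t (\<rho> n \<omega>)) \<omega> - A (min s (\<rho> n \<omega>)) \<omega>\<bar> \<le> C * (t - s)" by (rule Al)
          show "AE \<omega> in P. \<forall>s\<in>{0..T}. \<forall>t\<in>{s..T}. \<bar>B (min t (\<rho> n \<omega>)) \<omega> - B (min s (\<rho> n \<omega>)) \<omega>\<bar> \<le> C * (t - s)" by (rule Bl)
          show "centered (\<lambda>t \<omega>. M (min t (\<rho> n \<omega>)) \<omega>)" by (rule cM)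
          show "centered (\<lambda>t \<omega>. (M (min t (\<rho> n \<omega>)) \<omega>)\<^sup>2 - A (min t (\<rho> n \<omega>)) \<omega>)" by (rule cM2)
          show "AE \<omega> in P. continuous_on {0..T} (\<lambda>t. canonical (min t (\<rho> n \<omega>)) \<omega>)"
          proof (rule AE_I2)
            fix \<omega> assume "\<omega> \<in> space P"
            then have \<omega>: "\<omega> \<in> paths T" by simp
            show "continuous_on {0..T} (\<lambda>t. canonical (min t (\<rho> n \<omega>)) \<omega>)"
              by (rule continuous_processD[OF cont_stop[OF continuous_process_canonical] \<omega>])
          qed
          show "AE \<omega> in P. \<forall>t\<in>{0..T}. canonical (min t (\<rho> n \<omega>)) \<omega> = canonical (min 0 (\<rho> n \<omega>)) \<omega> + B (min t (\<rho> n \<omega>)) \<omega> + M (min t (\<rho> n \<omega>)) \<omega>"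
            using X_eq AE_space
          proof eventually_elim
            case (elim \<omega>)
            have nn: "0 \<le> \<rho> n \<omega>" using \<rho>_nn elim(2) by simp
            then have 0: "min 0 (\<rho> n \<omega>) = 0" by simp
            show ?case
              unfolding 0
            proof
              fix t assume "t \<in> {0..T}"
              then have "min t (\<rho> n \<omega>) \<in> {0..T}" using nn by auto
              with elim(1) show "canonical (min t (\<rho> n \<omega>)) \<omega> = canonical 0 \<omega> + B (min t (\<rho> n \<omega>)) \<omega> + M (min t (\<rho> n \<omega>)) \<omega>"
                by (rule bspec)
            qed
          qed
        qed
        \<comment> \<open>\<open>B\<close> and \<open>A\<close> coincide with time integrals only
          almost surely, so the convergence is established for the integrals and carried over on
          that event.\<close>
        have lim: "AE \<omega> in P. (\<lambda>k. \<Sum>i<k. let u = grid s t k i; v = grid s t k (Suc i) in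
            h1 (canonical (min u (\<rho> n \<omega>)) \<omega>) * (B (min v (\<rho> n \<omega>)) \<omega> - B (min u (\<rho> n \<omega>)) \<omega>)
            + h2 (canonical (min u (\<rho> n \<omega>)) \<omega>) / 2 * (A (min v (\<rho> n \<omega>)) \<omega> - A (min u (\<rho> n \<omega>)) \<omega>))
          \<longlonglongrightarrow> J (j h1 (\<lambda>y. h2 y / 2)) (min t (\<rho> n \<omega>)) \<omega> - J (j h1 (\<lambda>y. h2 y / 2)) (min s (\<rho> n \<omega>)) \<omega>"
          if st: "0 \<le> s" "s \<le> t" "t \<le> T" and h: "continuous_on UNIV h1" "continuous_on UNIV (\<lambda>y. h2 y / 2)" for s t h1 h2
          using B_eq A_eq AE_space
        proof eventually_elim
          case (elim \<omega>)
          have \<omega>: "\<omega> \<in> paths T" using elim(3) by simp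
          have nn: "0 \<le> \<rho> n \<omega>" by (rule \<rho>_nn[OF \<omega>])
          have Jsum: "J (j h1 (\<lambda>y. h2 y / 2)) r \<omega> = time_integral (\<lambda>r. h1 (canonical r \<omega>) * \<beta> r \<omega>) r
              + time_integral (\<lambda>r. h2 (canonical r \<omega>) / 2 * \<alpha> r \<omega>) r" if "r \<le> T" for r
            unfolding J_def j_def
            by (rule time_integral_add[OF regular_integrable[OF regular_integrand_mult[OF regular_integrand_compose[OF h(1)] reg(1)] \<omega>]
                  regular_integrable[OF regular_integrand_mult[OF regular_integrand_compose[OF h(2)] reg(2)] \<omega>] that])
          have le: "min t (\<rho> n \<omega>) \<le> T" "min s (\<rho> n \<omega>) \<le> T" using st by auto
          have lim0: "(\<lambda>k. (\<Sum>i<k. h1 (canonical (min (grid s t k i) (\<rho> n \<omega>)) \<omega>)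
                * (time_integral (\<lambda>r. \<beta> r \<omega>) (min (grid s t k (Suc i)) (\<rho> n \<omega>)) - time_integral (\<lambda>r. \<beta> r \<omega>) (min (grid s t k i) (\<rho> n \<omega>))))
              + (\<Sum>i<k. h2 (canonical (min (grid s t k i) (\<rho> n \<omega>)) \<omega>) / 2
                * (time_integral (\<lambda>r. \<alpha> r \<omega>) (min (grid s t k (Suc i)) (\<rho> n \<omega>)) - time_integral (\<lambda>r. \<alpha> r \<omega>) (min (grid s t k i) (\<rho> n \<omega>)))))
            \<longlonglongrightarrow> (time_integral (\<lambda>r. h1 (canonical r \<omega>) * \<beta> r \<omega>) (min t (\<rho> n \<omega>)) - time_integral (\<lambda>r. h1 (canonical r \<omega>) * \<beta> r \<omega>) (min s (\<rho> n \<omega>)))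
              + (time_integral (\<lambda>r. h2 (canonical r \<omega>) / 2 * \<alpha> r \<omega>) (min t (\<rho> n \<omega>)) - time_integral (\<lambda>r. h2 (canonical r \<omega>) / 2 * \<alpha> r \<omega>) (min s (\<rho> n \<omega>)))"
            by (intro tendsto_add stopped_riemann_sum[OF reg(1) h(1) \<omega> st nn] stopped_riemann_sum[OF reg(2) h(2) \<omega> st nn])
          have eq: "(\<Sum>i<k. let u = grid s t k i; v = grid s t k (Suc i) in
            h1 (canonical (min u (\<rho> n \<omega>)) \<omega>) * (B (min v (\<rho> n \<omega>)) \<omega> - B (min u (\<rho> n \<omega>)) \<omega>)
            + h2 (canonical (min u (\<rho> n \<omega>)) \<omega>) / 2 * (A (min v (\<rho> n \<omega>)) \<omega> - A (min u (\<rho> n \<omega>)) \<omega>))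
            = (\<Sum>i<k. h1 (canonical (min (grid s t k i) (\<rho> n \<omega>)) \<omega>)
                * (time_integral (\<lambda>r. \<beta> r \<omega>) (min (grid s t k (Suc i)) (\<rho> n \<omega>)) - time_integral (\<lambda>r. \<beta> r \<omega>) (min (grid s t k i) (\<rho> n \<omega>))))
              + (\<Sum>i<k. h2 (canonical (min (grid s t k i) (\<rho> n \<omega>)) \<omega>) / 2
                * (time_integral (\<lambda>r. \<alpha> r \<omega>) (min (grid s t k (Suc i)) (\<rho> n \<omega>)) - time_integral (\<lambda>r. \<alpha> r \<omega>) (min (grid s t k i) (\<rho> n \<omega>))))" for k
            unfolding sum.distrib[symmetric] Let_def
          proof (rule sum.cong[OF refl])
            fix i assume "i \<in> {..<k}"
            then have "min (grid s t k i) (\<rho> n \<omega>) \<in> {0..T}" "min (grid s t k (Suc i)) (\<rho> n \<omega>) \<in> {0..T}"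
              using nn st grid_ge[of s t k i] grid_ge[of s t k "Suc i"] grid_le[of s t i k] grid_le[of s t "Suc i" k] by auto
            then show "h1 (canonical (min (grid s t k i) (\<rho> n \<omega>)) \<omega>) * (B (min (grid s t k (Suc i)) (\<rho> n \<omega>)) \<omega> - B (min (grid s t k i) (\<rho> n \<omega>)) \<omega>)
              + h2 (canonical (min (grid s t k i) (\<rho> n \<omega>)) \<omega>) / 2 * (A (min (grid s t k (Suc i)) (\<rho> n \<omega>)) \<omega> - A (min (grid s t k i) (\<rho> n \<omega>)) \<omega>)
              = h1 (canonical (min (grid s t k i) (\<rho> n \<omega>)) \<omega>)
                * (time_integral (\<lambda>r. \<beta> r \<omega>) (min (grid s t k (Suc i)) (\<rho> n \<omega>)) - time_integral (\<lambda>r. \<beta> r \<omega>) (min (grid s t k i) (\<rho> n \<omega>)))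
              + h2 (canonical (min (grid s t k i) (\<rho> n \<omega>)) \<omega>) / 2
                * (time_integral (\<lambda>r. \<alpha> r \<omega>) (min (grid s t k (Suc i)) (\<rho> n \<omega>)) - time_integral (\<lambda>r. \<alpha> r \<omega>) (min (grid s t k i) (\<rho> n \<omega>)))"
              using elim(1,2) by (simp only:)
          qed
          show ?case
            unfolding eq Jsum[OF le(1)] Jsum[OF le(2)] add_diff_add by (rule lim0)
        qed
        have J_st_ad: "(\<lambda>\<omega>. J g (min t (\<rho> n \<omega>)) \<omega>) \<in> borel_measurable (raw_filtration T t)"
          if "regular_integrand g" "0 \<le> t" "t \<le> T" for g t
          by (rule sad[OF J_ad[OF that(1)] J_cont[OF that(1)] that(2,3)])
        have J_st_m: "(\<lambda>\<omega>. J g (min t (\<rho> n \<omega>)) \<omega>) \<in> borel_measurable P" if "regular_integrand g" "0 \<le> t" "t \<le> T" for g t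
          by (rule F_measurable_P[OF J_st_ad[OF that] that(2,3)])
        have J_bd: "ae_bounded (\<lambda>\<omega>. J g (min t (\<rho> n \<omega>)) \<omega>)"
          if "regular_integrand g" "bounded_until (\<rho> n) g" "0 \<le> t" "t \<le> T" for g t
          unfolding J_def by (rule stopped_time_integral_ae_bounded[OF that(1,2) \<rho>_nn that(3,4)])
        have u1: "bounded_until (\<rho> n) j1" and u2: "bounded_until (\<rho> n) j2"
          unfolding j1_def j2_def by (rule j_until[OF unt cont_f' cont_f''2] j_until[OF unt cont_f2(1,3)])+
        have u3: "bounded_until (\<rho> n) j3"
          unfolding j3_def[abs_def] by (rule bounded_until_mult[OF bounded_until_compose[OF unt cont_f] u1])
        have uA: "bounded_until (\<rho> n) jA"
          unfolding jA_def[abs_def]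
          by (rule bounded_until_mult[OF bounded_until_compose[OF unt cont_sq] until_\<beta>\<alpha>(2)[OF unt]])
        have c1: "centered (\<lambda>t \<omega>. f (canonical (min t (\<rho> n \<omega>)) \<omega>) - J j1 (min t (\<rho> n \<omega>)) \<omega>)"
        proof (rule ito_centered[OF f' f'' cont])
          show "(\<lambda>\<omega>. J j1 (min t (\<rho> n \<omega>)) \<omega>) \<in> borel_measurable P" if "0 \<le> t" "t \<le> T" for t
            by (rule J_st_m[OF j1 that])
        qed (unfold j1_def, rule lim[OF _ _ _ cont_f' cont_f''2])
        have c2: "centered (\<lambda>t \<omega>. (f (canonical (min t (\<rho> n \<omega>)) \<omega>))\<^sup>2 - J j2 (min t (\<rho> n \<omega>)) \<omega>)"
        proof (rule ito_centered[OF f2 cont_f2(2)])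
          show "(\<lambda>\<omega>. J j2 (min t (\<rho> n \<omega>)) \<omega>) \<in> borel_measurable P" if "0 \<le> t" "t \<le> T" for t
            by (rule J_st_m[OF j2 that])
        qed (unfold j2_def, rule lim[OF _ _ _ cont_f2(1,3)])
        have fX_stop_bd: "\<exists>D\<ge>0. AE \<omega> in P. \<forall>t\<in>{0..T}. \<bar>f (canonical (min t (\<rho> n \<omega>)) \<omega>)\<bar> \<le> D"
        proof -
          obtain D where D: "AE \<omega> in P. \<forall>s\<in>{0..T}. s \<le> \<rho> n \<omega> \<longrightarrow> \<bar>f (canonical s \<omega>)\<bar> \<le> D"
            using bounded_until_compose[OF unt cont_f] unfolding bounded_until_def by blast
          have "AE \<omega> in P. \<forall>t\<in>{0..T}. \<bar>f (canonical (min t (\<rho> n \<omega>)) \<omega>)\<bar> \<le> \<bar>D\<bar>"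
            using D AE_space
          proof eventually_elim
            case (elim \<omega>)
            have nn: "0 \<le> \<rho> n \<omega>" using \<rho>_nn elim(2) by simp
            show ?case
            proof
              fix t assume t: "t \<in> {0..T}"
              have "\<bar>f (canonical (min t (\<rho> n \<omega>)) \<omega>)\<bar> \<le> D"
                using elim(1)[rule_format, of "min t (\<rho> n \<omega>)"] t nn by auto
              also have "\<dots> \<le> \<bar>D\<bar>" by (rule abs_ge_self)
              finally show "\<bar>f (canonical (min t (\<rho> n \<omega>)) \<omega>)\<bar> \<le> \<bar>D\<bar>" .
            qed
          qed
          then show ?thesis by (intro exI[of _ "\<bar>D\<bar>"]) simp
        qed
        then obtain D where D: "0 \<le> D" "AE \<omega> in P. \<forall>t\<in>{0..T}. \<bar>f (canonical (min t (\<rho> n \<omega>)) \<omega>)\<bar> \<le> D" by blast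
        obtain C1 where C1: "0 \<le> C1" "AE \<omega> in P. \<forall>s\<in>{0..T}. \<forall>t\<in>{s..T}.
            \<bar>J j1 (min t (\<rho> n \<omega>)) \<omega> - J j1 (min s (\<rho> n \<omega>)) \<omega>\<bar> \<le> C1 * (t - s)"
          using stopped_time_integral_lipschitz[OF j1 u1 \<rho>_nn] unfolding J_def by blast
        have c3: "centered (\<lambda>t \<omega>. (f (canonical (min t (\<rho> n \<omega>)) \<omega>) - f (canonical (min 0 (\<rho> n \<omega>)) \<omega>) - J j1 (min t (\<rho> n \<omega>)) \<omega>)\<^sup>2
            - (J j2 (min t (\<rho> n \<omega>)) \<omega> - 2 * J j3 (min t (\<rho> n \<omega>)) \<omega>))"
        proof (rule bracket_centered[where y = "\<lambda>t \<omega>. f (canonical (min t (\<rho> n \<omega>)) \<omega>)"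
              and ?J1.0 = "\<lambda>t \<omega>. J j1 (min t (\<rho> n \<omega>)) \<omega>" and ?J2.0 = "\<lambda>t \<omega>. J j2 (min t (\<rho> n \<omega>)) \<omega>"
              and ?J3.0 = "\<lambda>t \<omega>. J j3 (min t (\<rho> n \<omega>)) \<omega>" and K = D and C = C1])
          show "(\<lambda>\<omega>. f (canonical (min t (\<rho> n \<omega>)) \<omega>)) \<in> borel_measurable (raw_filtration T t)" if "0 \<le> t" "t \<le> T" for t
            by (rule sad[OF fX that])
          show "(\<lambda>\<omega>. J j1 (min t (\<rho> n \<omega>)) \<omega>) \<in> borel_measurable (raw_filtration T t)" if "0 \<le> t" "t \<le> T" for t
            by (rule J_st_ad[OF j1 that])
          show "(\<lambda>\<omega>. J j2 (min t (\<rho> n \<omega>)) \<omega>) \<in> borel_measurable P" if "0 \<le> t" "t \<le> T" for t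
            by (rule J_st_m[OF j2 that])
          show "(\<lambda>\<omega>. J j3 (min t (\<rho> n \<omega>)) \<omega>) \<in> borel_measurable P" if "0 \<le> t" "t \<le> T" for t
            by (rule J_st_m[OF j3 that])
          show "AE \<omega> in P. continuous_on {0..T} (\<lambda>t. f (canonical (min t (\<rho> n \<omega>)) \<omega>))"
          proof (rule AE_I2)
            fix \<omega> assume "\<omega> \<in> space P"
            then have \<omega>: "\<omega> \<in> paths T" by simp
            show "continuous_on {0..T} (\<lambda>t. f (canonical (min t (\<rho> n \<omega>)) \<omega>))"
              by (rule continuous_processD[OF cont_stop[OF fX(2)] \<omega>])
          qed
          show "ae_bounded (\<lambda>\<omega>. J j1 (min t (\<rho> n \<omega>)) \<omega>)" if "0 \<le> t" "t \<le> T" for t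
            by (rule J_bd[OF j1 u1 that])
          show "ae_bounded (\<lambda>\<omega>. J j2 (min t (\<rho> n \<omega>)) \<omega>)" if "0 \<le> t" "t \<le> T" for t
            by (rule J_bd[OF j2 u2 that])
          show "ae_bounded (\<lambda>\<omega>. J j3 (min t (\<rho> n \<omega>)) \<omega>)" if "0 \<le> t" "t \<le> T" for t
            by (rule J_bd[OF j3 u3 that])
          show "AE \<omega> in P. (\<lambda>k. \<Sum>i<k. f (canonical (min (grid s t k i) (\<rho> n \<omega>)) \<omega>)
              * (J j1 (min (grid s t k (Suc i)) (\<rho> n \<omega>)) \<omega> - J j1 (min (grid s t k i) (\<rho> n \<omega>)) \<omega>))
              \<longlonglongrightarrow> J j3 (min t (\<rho> n \<omega>)) \<omega> - J j3 (min s (\<rho> n \<omega>)) \<omega>" if st: "0 \<le> s" "s \<le> t" "t \<le> T" for s t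
          proof (rule AE_I2)
            fix \<omega> assume "\<omega> \<in> space P"
            then have \<omega>: "\<omega> \<in> paths T" by simp
            show "(\<lambda>k. \<Sum>i<k. f (canonical (min (grid s t k i) (\<rho> n \<omega>)) \<omega>)
              * (J j1 (min (grid s t k (Suc i)) (\<rho> n \<omega>)) \<omega> - J j1 (min (grid s t k i) (\<rho> n \<omega>)) \<omega>))
              \<longlonglongrightarrow> J j3 (min t (\<rho> n \<omega>)) \<omega> - J j3 (min s (\<rho> n \<omega>)) \<omega>"
              unfolding J_def j3_def by (rule stopped_riemann_sum[OF j1 cont_f \<omega> st \<rho>_nn[OF \<omega>]])
          qed
        qed (fact D C1 c1 c2)+
        \<comment> \<open>The initial value \<open>f (canonical 0)\<close> cancels in
          increments.\<close>
        have cMf: "centered (\<lambda>t \<omega>. Mf (min t (\<rho> n \<omega>)) \<omega>)"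
          by (rule centered_cong_increments[OF _ c1]) (simp add: Mf_def)
        have cNf: "centered (\<lambda>t \<omega>. Nf (min t (\<rho> n \<omega>)) \<omega>)"
        proof (rule centered_cong_increments[OF _ c3])
          fix s t \<omega> assume st: "0 \<le> s" "s \<le> t" "t \<le> T" and "\<omega> \<in> space P"
          then have \<omega>: "\<omega> \<in> paths T" by simp
          have 0: "min 0 (\<rho> n \<omega>) = 0" using \<rho>_nn[OF \<omega>] by simp
          have le: "min t (\<rho> n \<omega>) \<le> T" "min s (\<rho> n \<omega>) \<le> T" using st by auto
          show "(f (canonical (min t (\<rho> n \<omega>)) \<omega>) - f (canonical (min 0 (\<rho> n \<omega>)) \<omega>) - J j1 (min t (\<rho> n \<omega>)) \<omega>)\<^sup>2
            - (J j2 (min t (\<rho> n \<omega>)) \<omega> - 2 * J j3 (min t (\<rho> n \<omega>)) \<omega>)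
            - ((f (canonical (min s (\<rho> n \<omega>)) \<omega>) - f (canonical (min 0 (\<rho> n \<omega>)) \<omega>) - J j1 (min s (\<rho> n \<omega>)) \<omega>)\<^sup>2
            - (J j2 (min s (\<rho> n \<omega>)) \<omega> - 2 * J j3 (min s (\<rho> n \<omega>)) \<omega>))
            = Nf (min t (\<rho> n \<omega>)) \<omega> - Nf (min s (\<rho> n \<omega>)) \<omega>"
            unfolding Nf_def Mf_def JA[OF \<omega> le(1)] JA[OF \<omega> le(2)] 0 ..
        qed
        have "ae_bounded (\<lambda>\<omega>. Mf (min t (\<rho> n \<omega>)) \<omega>) \<and> ae_bounded (\<lambda>\<omega>. Nf (min t (\<rho> n \<omega>)) \<omega>)" if t: "0 \<le> t" "t \<le> T" for t
        proof -
          have "ae_bounded (\<lambda>\<omega>. f (canonical (min t (\<rho> n \<omega>)) \<omega>))"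
            by (rule ae_boundedI[of _ D], use D(2) in eventually_elim, use t in auto)
          moreover have "ae_bounded (\<lambda>\<omega>. f (canonical 0 \<omega>))"
            by (rule ae_boundedI[of _ "\<bar>f x\<bar>"], use initial in eventually_elim, auto)
          ultimately have "ae_bounded (\<lambda>\<omega>. Mf (min t (\<rho> n \<omega>)) \<omega>)"
            unfolding Mf_def by (intro ae_bounded_diff J_bd[OF j1 u1 t])
          then show ?thesis
            unfolding Nf_def by (intro conjI ae_bounded_diff ae_bounded_power J_bd[OF jA uA t])
        qed
        with cMf cNf show ?thesis by blast
      qed
      show ?thesis
      proof
        show "is_local_martingale T P Mf"
          by (rule is_local_martingaleI[OF Mf \<rho>_stop \<rho>_mono \<rho>_T]) (use stopped in blast)+
        show "is_local_martingale T P Nf"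
          by (rule is_local_martingaleI[OF Nf \<rho>_stop \<rho>_mono \<rho>_T]) (use stopped in blast)+
      qed
    qed
  qed

  have J0: "J g 0 \<omega> = 0" for g \<omega> by (simp add: J_def)
  have "semimartingale_decomposition T P (\<lambda>t \<omega>. f (canonical t \<omega>)) (J j1) Mf"
    unfolding semimartingale_decomposition_def
  proof (intro conjI fX J_ad[OF j1] J_cont[OF j1] Mf(2) local_martingales[THEN conjunct1])
    show "AE \<omega> in P. finite_variation_on T (\<lambda>t. J j1 t \<omega>)"
      unfolding J_def using path_bounded_time_integral(2)[OF regular_integrandD[OF j1]] by (intro AE_I2) simp
    show "AE \<omega> in P. J j1 0 \<omega> = 0 \<and> Mf 0 \<omega> = 0" by (simp add: Mf_def J0)
    show "AE \<omega> in P. \<forall>t\<in>{0..T}. f (canonical t \<omega>) = f (canonical 0 \<omega>) + J j1 t \<omega> + Mf t \<omega>" by (simp add: Mf_def)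
  qed
  moreover have "angle_bracket T P Mf (J jA)"
    unfolding angle_bracket_def
  proof (intro conjI J_ad[OF jA] J_cont[OF jA])
    show "AE \<omega> in P. J jA 0 \<omega> = 0 \<and> mono_on {0..T} (\<lambda>t. J jA t \<omega>)"
    proof (rule AE_I2)
      fix \<omega> assume "\<omega> \<in> space P"
      then have \<omega>: "\<omega> \<in> paths T" by simp
      have "mono_on {0..T} (\<lambda>t. J jA t \<omega>)"
        unfolding J_def
        by (rule time_integral_mono_on[OF regular_integrable[OF jA \<omega>]]) (use \<alpha>_nonneg \<omega> in \<open>simp add: jA_def\<close>)
      then show "J jA 0 \<omega> = 0 \<and> mono_on {0..T} (\<lambda>t. J jA t \<omega>)" by (simp add: J0)
    qed
    show "is_local_martingale T P (\<lambda>t \<omega>. (Mf t \<omega>)\<^sup>2 - J jA t \<omega>)"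
      using local_martingales[THEN conjunct2] by (simp add: Nf_def[abs_def])
  qed
  moreover have "is_time_integral T P (J j1) j1" "is_time_integral T P (J jA) jA"
    unfolding J_def[abs_def]
    by (rule path_bounded_time_integral(3)[OF regular_integrandD[OF j1]] path_bounded_time_integral(3)[OF regular_integrandD[OF jA]])+
  ultimately have ex: "\<exists>B M A. semimartingale_decomposition T P (\<lambda>t \<omega>. f (canonical t \<omega>)) B M \<and> angle_bracket T P M A \<and>
      is_time_integral T P B j1 \<and> is_time_integral T P A jA"
    by blast
  have nn: "\<forall>\<omega>\<in>paths T. \<forall>s\<in>{0..T}. 0 \<le> jA s \<omega>" using \<alpha>_nonneg by (simp add: jA_def)
  have "differential_characteristics T P (\<lambda>t \<omega>. f (canonical t \<omega>)) j1 jA"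
    unfolding differential_characteristics_def
    by (rule conjI[OF regular_integrandD(1)[OF j1] conjI[OF regular_integrandD(1)[OF jA] conjI[OF nn ex]]])
  then show ?thesis unfolding j1_def j_def[abs_def] jA_def[abs_def] .
qed

end

section \<open>Affine domination\<close>

lemma b_star_interval:
  assumes "valid_bounds \<Theta>"
  shows "b_star \<Theta> y = {b0_lo \<Theta> + min (b1_lo \<Theta> * y) (b1_hi \<Theta> * y)..b0_hi \<Theta> + max (b1_lo \<Theta> * y) (b1_hi \<Theta> * y)}"
  unfolding b_star_def using assms by (intro affine_range_interval) (auto simp: valid_bounds_def)

lemma a_star_interval:
  assumes "valid_bounds \<Theta>"
  shows "a_star \<Theta> y = {a0_lo \<Theta> + a1_lo \<Theta> * max y 0..a0_hi \<Theta> + a1_hi \<Theta> * max y 0}"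
proof -
  have "a1_lo \<Theta> * max y 0 \<le> a1_hi \<Theta> * max y 0"
    using assms by (intro mult_right_mono) (auto simp: valid_bounds_def)
  then show ?thesis
    unfolding a_star_def using assms by (subst affine_range_interval) (auto simp: valid_bounds_def)
qed

lemma star_linear_growth:
  assumes "valid_bounds \<Theta>"
  obtains \<kappa> where "0 \<le> \<kappa>" "\<And>y \<beta>. \<beta> \<in> b_star \<Theta> y \<Longrightarrow> \<bar>\<beta>\<bar> \<le> \<kappa> * (1 + \<bar>y\<bar>)"
    "\<And>y \<alpha>. \<alpha> \<in> a_star \<Theta> y \<Longrightarrow> \<bar>\<alpha>\<bar> \<le> \<kappa> * (1 + \<bar>y\<bar>)"
proof
  define k where "k l h = \<bar>l\<bar> + \<bar>h\<bar>" for l h :: real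
  \<comment> \<open>Sums the absolute values of all eight end points, so that one constant dominates
    every coefficient of both sets.\<close>
  define \<kappa> where "\<kappa> = k (b0_lo \<Theta>) (b0_hi \<Theta>) + k (b1_lo \<Theta>) (b1_hi \<Theta>)
    + k (a0_lo \<Theta>) (a0_hi \<Theta>) + k (a1_lo \<Theta>) (a1_hi \<Theta>)"
  have k: "0 \<le> k l h" "c \<in> {l..h} \<Longrightarrow> \<bar>c\<bar> \<le> k l h" for c l h by (auto simp: k_def)
  show "0 \<le> \<kappa>" by (simp add: \<kappa>_def k)
  have affine: "\<bar>c0 + c1 * z\<bar> \<le> \<kappa> * (1 + \<bar>y\<bar>)" if "\<bar>c0\<bar> \<le> \<kappa>" "\<bar>c1\<bar> \<le> \<kappa>" "\<bar>z\<bar> \<le> \<bar>y\<bar>" for c0 c1 z y :: real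
  proof -
    have "\<bar>c0 + c1 * z\<bar> \<le> \<bar>c0\<bar> + \<bar>c1\<bar> * \<bar>z\<bar>"
      by (rule order_trans[OF abs_triangle_ineq]) (simp add: abs_mult)
    also have "\<dots> \<le> \<kappa> + \<kappa> * \<bar>y\<bar>" using that \<open>0 \<le> \<kappa>\<close> by (intro add_mono mult_mono) auto
    finally show ?thesis by (simp add: distrib_left)
  qed
  show "\<bar>\<beta>\<bar> \<le> \<kappa> * (1 + \<bar>y\<bar>)" if mem: "\<beta> \<in> b_star \<Theta> y" for y \<beta>
  proof -
    obtain c0 c1 where c: "\<beta> = c0 + c1 * y" "c0 \<in> {b0_lo \<Theta>..b0_hi \<Theta>}" "c1 \<in> {b1_lo \<Theta>..b1_hi \<Theta>}"
      using mem unfolding b_star_def by blast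
    have "\<bar>c0\<bar> \<le> \<kappa>" "\<bar>c1\<bar> \<le> \<kappa>"
      using k(2)[OF c(2)] k(2)[OF c(3)] k(1)[of "b0_lo \<Theta>" "b0_hi \<Theta>"] k(1)[of "b1_lo \<Theta>" "b1_hi \<Theta>"]
        k(1)[of "a0_lo \<Theta>" "a0_hi \<Theta>"] k(1)[of "a1_lo \<Theta>" "a1_hi \<Theta>"] by (simp_all add: \<kappa>_def)
    then show ?thesis unfolding c(1) by (rule affine) simp
  qed
  show "\<bar>\<alpha>\<bar> \<le> \<kappa> * (1 + \<bar>y\<bar>)" if mem: "\<alpha> \<in> a_star \<Theta> y" for y \<alpha>
  proof -
    obtain c0 c1 where c: "\<alpha> = c0 + c1 * max y 0" "c0 \<in> {a0_lo \<Theta>..a0_hi \<Theta>}" "c1 \<in> {a1_lo \<Theta>..a1_hi \<Theta>}"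
      using mem unfolding a_star_def by blast
    have "\<bar>c0\<bar> \<le> \<kappa>" "\<bar>c1\<bar> \<le> \<kappa>"
      using k(2)[OF c(2)] k(2)[OF c(3)] k(1)[of "b0_lo \<Theta>" "b0_hi \<Theta>"] k(1)[of "b1_lo \<Theta>" "b1_hi \<Theta>"]
        k(1)[of "a0_lo \<Theta>" "a0_hi \<Theta>"] k(1)[of "a1_lo \<Theta>" "a1_hi \<Theta>"] by (simp_all add: \<kappa>_def)
    then show ?thesis unfolding c(1) by (rule affine) simp
  qed
qed

lemma a_F_memI:
  assumes "valid_bounds \<Theta>" "\<alpha> \<in> a_star \<Theta> y"
  shows "(deriv F y)\<^sup>2 * \<alpha> \<in> a_F \<Theta> F y"
  using assms(2) unfolding a_star_interval[OF assms(1)] a_F_def by (auto intro!: mult_left_mono)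

text \<open>Real infima and suprema bound their elements only when the set is bounded. The parameter
  sets are compact intervals and the expression is continuous, so its image is compact.\<close>

lemma b_F_memI:
  assumes \<Theta>: "valid_bounds \<Theta>" and mem: "\<beta> \<in> b_star \<Theta> y" "\<alpha> \<in> a_star \<Theta> y"
  shows "deriv F y * \<beta> + deriv (deriv F) y / 2 * \<alpha> \<in> b_F \<Theta> F y"
proof -
  let ?g = "\<lambda>(\<beta>, \<alpha>). deriv F y * \<beta> + 1/2 * deriv (deriv F) y * \<alpha>"
  have "compact (b_star \<Theta> y \<times> a_star \<Theta> y)"
    unfolding b_star_interval[OF \<Theta>] a_star_interval[OF \<Theta>] by (intro compact_Times compact_Icc)
  then have "compact (?g ` (b_star \<Theta> y \<times> a_star \<Theta> y))"
    by (intro compact_continuous_image) (auto simp: case_prod_beta' intro!: continuous_intros)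
  then have "bounded (?g ` (b_star \<Theta> y \<times> a_star \<Theta> y))" by (rule compact_imp_bounded)
  then have "bdd_below (?g ` (b_star \<Theta> y \<times> a_star \<Theta> y))" "bdd_above (?g ` (b_star \<Theta> y \<times> a_star \<Theta> y))"
    by (rule bounded_imp_bdd_below, rule bounded_imp_bdd_above)
  moreover have "(\<beta>, \<alpha>) \<in> b_star \<Theta> y \<times> a_star \<Theta> y" using mem by simp
  ultimately have "Inf (?g ` (b_star \<Theta> y \<times> a_star \<Theta> y)) \<le> ?g (\<beta>, \<alpha>)" "?g (\<beta>, \<alpha>) \<le> Sup (?g ` (b_star \<Theta> y \<times> a_star \<Theta> y))"
    by (blast intro: cINF_lower cSUP_upper)+
  then show ?thesis unfolding b_F_def by simp
qed

text \<open>Domination is given for one version of the characteristics of X, while the claim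
  concerns all versions for \<open>F (X)\<close>. Clamped characteristics satisfy the domination at
  every point, so the formula yields one version with values in the stated intervals everywhere, and
  uniqueness transfers this to the others almost everywhere.\<close>

theorem proposition5p1:
  fixes T x :: real and \<O> :: "real set" and \<Theta> :: affine_bounds
    and F :: "real \<Rightarrow> real" and P :: "path measure"
  assumes "T > 0"
    and "valid_bounds \<Theta>"
    and "\<O> = UNIV \<or> \<O> = {0..} \<or> \<O> = {0<..}"
    and "x \<in> \<O>"
    and "C2 F"
    and "P \<in> nonlinear_affine T x \<Theta>"
  shows "semimartingale T P (\<lambda>t \<omega>. F (canonical t \<omega>)) \<and>
    (\<exists>\<beta> \<alpha>. differential_characteristics T P (\<lambda>t \<omega>. F (canonical t \<omega>)) \<beta> \<alpha>) \<and>
    (\<forall>\<beta> \<alpha>. differential_characteristics T P (\<lambda>t \<omega>. F (canonical t \<omega>)) \<beta> \<alpha> \<longrightarrow>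
       ae_path_time T P (\<lambda>\<omega> s. \<alpha> s \<omega> \<in> a_F \<Theta> F (canonical s \<omega>) \<and>
                               \<beta> s \<omega> \<in> b_F \<Theta> F (canonical s \<omega>)))"
proof -
  note \<Theta> = \<open>valid_bounds \<Theta>\<close>
  have law: "path_law T P" and initial: "AE \<omega> in P. canonical 0 \<omega> = x"
    using assms(6) by (auto simp: nonlinear_affine_def ac_semimartingale_laws_def)
  obtain \<beta> \<alpha> where dc: "differential_characteristics T P canonical \<beta> \<alpha>"
    and dom: "ae_path_time T P (\<lambda>\<omega> s. \<beta> s \<omega> \<in> b_star \<Theta> (canonical s \<omega>) \<and> \<alpha> s \<omega> \<in> a_star \<Theta> (canonical s \<omega>))"
    using assms(6) unfolding nonlinear_affine_def by blast
  interpret path_space T P using \<open>T > 0\<close> law by unfold_locales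
  have F': "(F has_real_derivative deriv F y) (at y)" and F'': "(deriv F has_real_derivative deriv (deriv F) y) (at y)" for y
    using \<open>C2 F\<close> by (auto simp: C2_def DERIV_deriv_iff_real_differentiable)
  have cont: "continuous_on UNIV (deriv (deriv F))" using \<open>C2 F\<close> by (simp add: C2_def)

  text \<open>Clamping the characteristics into the parameter sets changes them only on a null set and
    bounds them along every path, so that their time integrals are continuous for every path.\<close>
  define bl where "bl y = b0_lo \<Theta> + min (b1_lo \<Theta> * y) (b1_hi \<Theta> * y)" for y
  define bh where "bh y = b0_hi \<Theta> + max (b1_lo \<Theta> * y) (b1_hi \<Theta> * y)" for y
  define al where "al y = a0_lo \<Theta> + a1_lo \<Theta> * max y 0" for y
  define ah where "ah y = a0_hi \<Theta> + a1_hi \<Theta> * max y 0" for y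
  have b_int: "b_star \<Theta> y = {bl y..bh y}" and a_int: "a_star \<Theta> y = {al y..ah y}" for y
    by (simp_all add: b_star_interval[OF \<Theta>] a_star_interval[OF \<Theta>] bl_def bh_def al_def ah_def)
  have order: "bl y \<le> bh y" "al y \<le> ah y" "0 \<le> al y" for y
  proof -
    show "bl y \<le> bh y" using \<Theta> unfolding bl_def bh_def valid_bounds_def by (intro add_mono) auto
    show "al y \<le> ah y" using \<Theta> unfolding al_def ah_def valid_bounds_def by (intro add_mono mult_right_mono) auto
    show "0 \<le> al y" using \<Theta> by (simp add: al_def valid_bounds_def)
  qed
  define \<beta>' where "\<beta>' s \<omega> = max (bl (canonical s \<omega>)) (min (bh (canonical s \<omega>)) (\<beta> s \<omega>))" for s \<omega>
  define \<alpha>' where "\<alpha>' s \<omega> = max (al (canonical s \<omega>)) (min (ah (canonical s \<omega>)) (\<alpha> s \<omega>))" for s \<omega>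
  have \<beta>'_mem: "\<beta>' s \<omega> \<in> b_star \<Theta> (canonical s \<omega>)" and \<alpha>'_mem: "\<alpha>' s \<omega> \<in> a_star \<Theta> (canonical s \<omega>)" for s \<omega>
    using order by (auto simp: b_int a_int \<beta>'_def \<alpha>'_def)
  have \<alpha>'_nonneg: "0 \<le> \<alpha>' s \<omega>" for s \<omega>
    using order(3)[of "canonical s \<omega>"] by (simp add: \<alpha>'_def le_max_iff_disj)
  have p: "predictable T \<beta>" "predictable T \<alpha>" using dc by (simp_all add: differential_characteristics_def)
  have cont_bounds: "continuous_on UNIV bl" "continuous_on UNIV bh" "continuous_on UNIV al" "continuous_on UNIV ah"
    unfolding bl_def[abs_def] bh_def[abs_def] al_def[abs_def] ah_def[abs_def] by (intro continuous_intros)+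
  have p': "predictable T \<beta>'" "predictable T \<alpha>'"
    unfolding \<beta>'_def[abs_def] \<alpha>'_def[abs_def]
    by (rule predictable_max[OF predictable_compose[OF cont_bounds(1)] predictable_min[OF predictable_compose[OF cont_bounds(2)] p(1)]]
        predictable_max[OF predictable_compose[OF cont_bounds(3)] predictable_min[OF predictable_compose[OF cont_bounds(4)] p(2)]])+
  \<comment> \<open>On the set where domination holds the clamp is the identity.\<close>
  have "ae_path_time T P (\<lambda>\<omega> s. \<beta>' s \<omega> = \<beta> s \<omega> \<and> \<alpha>' s \<omega> = \<alpha> s \<omega>)"
    using dom unfolding ae_path_time_def by eventually_elim (auto simp: b_int a_int \<beta>'_def \<alpha>'_def)
  from differential_characteristics_modification[OF dc p' \<alpha>'_nonneg this]
  have dc': "differential_characteristics T P canonical \<beta>' \<alpha>'" .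
  obtain \<kappa> where \<kappa>: "0 \<le> \<kappa>" "\<And>y \<beta>. \<beta> \<in> b_star \<Theta> y \<Longrightarrow> \<bar>\<beta>\<bar> \<le> \<kappa> * (1 + \<bar>y\<bar>)"
      "\<And>y \<alpha>. \<alpha> \<in> a_star \<Theta> y \<Longrightarrow> \<bar>\<alpha>\<bar> \<le> \<kappa> * (1 + \<bar>y\<bar>)"
    using star_linear_growth[OF \<Theta>] by blast
  define \<beta>F where "\<beta>F s \<omega> = deriv F (canonical s \<omega>) * \<beta>' s \<omega> + deriv (deriv F) (canonical s \<omega>) / 2 * \<alpha>' s \<omega>" for s \<omega>
  define \<alpha>F where "\<alpha>F s \<omega> = (deriv F (canonical s \<omega>))\<^sup>2 * \<alpha>' s \<omega>" for s \<omega>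
  have dcF: "differential_characteristics T P (\<lambda>t \<omega>. F (canonical t \<omega>)) \<beta>F \<alpha>F"
    unfolding \<beta>F_def[abs_def] \<alpha>F_def[abs_def]
    by (rule ito_differential_characteristics[OF dc' \<kappa>(2)[OF \<beta>'_mem] \<kappa>(3)[OF \<alpha>'_mem] \<kappa>(1) initial F' F'' cont])
  show ?thesis
  proof (intro conjI allI impI)
    show "semimartingale T P (\<lambda>t \<omega>. F (canonical t \<omega>))"
      using dcF unfolding differential_characteristics_def semimartingale_def by blast
    show "\<exists>\<beta> \<alpha>. differential_characteristics T P (\<lambda>t \<omega>. F (canonical t \<omega>)) \<beta> \<alpha>"
      using dcF by blast
    fix \<beta>2 \<alpha>2 assume "differential_characteristics T P (\<lambda>t \<omega>. F (canonical t \<omega>)) \<beta>2 \<alpha>2"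
    from differential_characteristics_unique[OF this dcF]
    show "ae_path_time T P (\<lambda>\<omega> s. \<alpha>2 s \<omega> \<in> a_F \<Theta> F (canonical s \<omega>) \<and> \<beta>2 s \<omega> \<in> b_F \<Theta> F (canonical s \<omega>))"
      unfolding ae_path_time_def
    proof eventually_elim
      case (elim z)
      obtain \<omega> s where z: "z = (\<omega>, s)" by (cases z)
      have "\<alpha>F s \<omega> \<in> a_F \<Theta> F (canonical s \<omega>)" unfolding \<alpha>F_def by (rule a_F_memI[OF \<Theta> \<alpha>'_mem])
      moreover have "\<beta>F s \<omega> \<in> b_F \<Theta> F (canonical s \<omega>)" unfolding \<beta>F_def by (rule b_F_memI[OF \<Theta> \<beta>'_mem \<alpha>'_mem])
      ultimately show ?case using elim by (simp add: z)
    qed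
  qed
qed

end
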